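(* For every integer $n\ge 1$, $$\overline{a}(n) = \frac{3\pi}{16n \sqrt{2}} \sum_{\substack{k\ge 1 \\ k~\text{odd}}} \frac{A_k^{(1)}(n)}{k}\, I_2\!\left( \frac{\pi}{k} \sqrt{\frac{3n}{2}} \right) + \frac{\pi}{4n \sqrt{2}} \sum_{\substack{k\ge 1 \\ k\equiv 2 \ (\mathrm{mod}\ 4)}} \frac{A_k^{(2)}(n)}{k}\, I_2\!\left( \frac{\pi}{k} \sqrt{2n} \right),$$ where $$A_k^{(1)}(n)=\sum_{\substack{0\le h\le k-1 \\ \gcd(h,k)=1}} \exp\!\Big( \pi i \big(2s(h,k) + s(2h,k)-s(4h,k) \big) -2\pi i n \tfrac{h}{k} \Big),$$ $$A_k^{(2)}(n)=\sum_{\substack{0\le h\le k-1 \\ \gcd(h,k)=1}} \exp\!\Big( \pi i \big(2s(h,k) + s(h,\tfrac{k}{2})-s(2h,\tfrac{k}{2}) \big)-2\pi i n \tfrac{h}{k}\Big),$$ and both series converge absolutely.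
   Context: The cubic overpartition function $\overline{a}(n)$ is defined by the generating function $\sum_{n\ge 0}\overline{a}(n)q^n=\frac{(-q;q)_\infty(-q^2;q^2)_\infty}{(q;q)_\infty(q^2;q^2)_\infty}$ for $|q|<1$, where $(a;q)_\infty=\prod_{j\ge 0}(1-aq^j)$. (Combinatorially, $\overline{a}(n)$ counts partitions of $n$ in which even parts may come in two colors and the first occurrence of each distinct part may be overlined.) The Dedekind sum is $s(h,k)=\sum_{r=1}^{k-1}\frac{r}{k}\left(\frac{hr}{k}-\left\lfloor\frac{hr}{k}\right\rfloor-\frac12\right)$ for integers $h$ and $k\ge1$. $I_\nu$ denotes the modified Bessel function of the first kind. *)

theory Defs
  imports "HOL-Analysis.Analysis" "HOL-Computational_Algebra.Formal_Power_Series"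
begin

text \<open>Cubic overpartition function, defined through its generating function
  (-q;q)(-q^2;q^2)/((q;q)(q^2;q^2)).  The coefficient of q^n only depends on the
  factors with index j \<le> n, so we take the n-th coefficient of the finite
  product over j = 1..n of formal power series.\<close>
definition cubic_overpartition :: "nat \<Rightarrow> real" where
  "cubic_overpartition n =
     fps_nth (\<Prod>j\<in>{1..n}. (1 + fps_X ^ j) * (1 + fps_X ^ (2 * j))
                * inverse ((1 - fps_X ^ j) * (1 - fps_X ^ (2 * j)))) n"

definition dedekind_sum :: "int \<Rightarrow> nat \<Rightarrow> real" where
  "dedekind_sum h k = (\<Sum>r = 1..<k. (real r / real k) *
      (real_of_int (h * int r) / real k - of_int \<lfloor>real_of_int (h * int r) / real k\<rfloor> - 1 / 2))"

definition bessel_I :: "nat \<Rightarrow> real \<Rightarrow> real" where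
  "bessel_I \<nu> x = (\<Sum>m. (x / 2) ^ (2 * m + \<nu>) / (fact m * fact (m + \<nu>)))"

definition A1 :: "nat \<Rightarrow> nat \<Rightarrow> complex" where
  "A1 k n = (\<Sum>h \<in> {h. h < k \<and> coprime h k}.
     exp (complex_of_real pi * \<i> * of_real (2 * dedekind_sum (int h) k
            + dedekind_sum (2 * int h) k - dedekind_sum (4 * int h) k)
          - 2 * complex_of_real pi * \<i> * of_nat n * of_nat h / of_nat k))"

definition A2 :: "nat \<Rightarrow> nat \<Rightarrow> complex" where
  "A2 k n = (\<Sum>h \<in> {h. h < k \<and> coprime h k}.
     exp (complex_of_real pi * \<i> * of_real (2 * dedekind_sum (int h) k
            + dedekind_sum (int h) (k div 2) - dedekind_sum (2 * int h) (k div 2))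
          - 2 * complex_of_real pi * \<i> * of_nat n * of_nat h / of_nat k))"

end

theory Submission
  imports Defs "HOL-Complex_Analysis.Complex_Analysis" "HOL-Number_Theory.Number_Theory" "HOL-Real_Asymp.Real_Asymp"
begin

text \<open>The generating function is phi(q^4) / (phi(q)^2 phi(q^2)) with Euler's product
  phi(q) = (q;q), hence up to normalisation an eta quotient of weight -1. Near a primitive k-th root
  of unity the transformation law of phi shows that it equals w times an exponential
  exp(const / (k^2 w)), up to a bounded multiple of w, where the exponential is present exactly when
  4 does not divide k. This is Rademacher's circle method on the segment Im = 1/N^2, dissected into
  Farey arcs: because the weight is an integer, the main term on an arc is single-valued in w, so
  closing the arc to a rectangle around 0 evaluates it as a residue at an essential singularity,
  whose Laurent coefficient is the Bessel series; the errors add up to O(1/N).\<close>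

subsection \<open>Partial fractions of the cotangent\<close>

text \<open>The logarithmic derivative of phi is a weight 2 Eisenstein series, whose double series
  converges only conditionally; the discrepancy between the two orders of summation is what becomes
  the square root factor in the inversion of phi under t -> -1/t. Iterating the inversion along
  Euclid's algorithm for h/k gives the law at every cusp, and Dedekind reciprocity absorbs the roots
  of unity. The height 1/N^2 balances two demands: it keeps exp(2 pi n Im t) bounded, and on Farey
  arcs, which reach at most 1/(k N) to either side of h/k, it still gives Re(1/w) >= k^2/2, so that
  the transformed nome is small uniformly in k. Each arc then costs C/(k N^2), and at most k arcs
  for each k <= N add up to C/N. This argument controls only the sum over all k in its natural
  order; separating it into two series rests on absolute convergence, which comes from I_2(x) being
  of order x^2 near 0.\<close>

lemma cot_conv_Digamma:
  fixes z :: complex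
  assumes z: "z \<notin> \<int>"
  shows "of_real pi * cot (of_real pi * z) = Digamma (1 - z) - Digamma (1 + z) + 1 / z"
proof -
  have nz: "z \<notin> \<int>\<^sub>\<le>\<^sub>0" "1 - z \<notin> \<int>\<^sub>\<le>\<^sub>0" "z \<noteq> 0"
    using z by (auto dest!: subsetD[OF nonpos_Ints_subset_Ints])
  have eq: "(\<lambda>z. rGamma z * rGamma (1 - z :: complex)) = (\<lambda>z. sin (of_real pi * z) / of_real pi)"
    using rGamma_reflection_complex by auto
  \<comment> \<open>The reflection formula is differentiated as an identity of entire functions; the
    logarithmic derivative of the left side is a difference of Digamma values, that of the right
    side a cotangent.\<close>
  have "((\<lambda>z. rGamma z * rGamma (1 - z)) has_field_derivative
          rGamma z * rGamma (1 - z) * (Digamma (1 - z) - Digamma z)) (at z)"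
    using nz by (auto intro!: derivative_eq_intros simp: algebra_simps)
  moreover have "((\<lambda>z. sin (of_real pi * z) / of_real pi) has_field_derivative cos (of_real pi * z)) (at z)"
    by (auto intro!: derivative_eq_intros)
  ultimately have *: "rGamma z * rGamma (1 - z) * (Digamma (1 - z) - Digamma z) = cos (of_real pi * z)"
    unfolding eq by (rule DERIV_unique)
  have "rGamma z \<noteq> 0" "rGamma (1 - z) \<noteq> 0"
    using nz by (auto simp: rGamma_eq_zero_iff)
  hence "sin (of_real pi * z) \<noteq> 0"
    using rGamma_reflection_complex[of z] by auto
  hence "of_real pi * cot (of_real pi * z) = Digamma (1 - z) - Digamma z"
    using * unfolding rGamma_reflection_complex by (auto simp: cot_def field_simps)
  also have "Digamma (1 + z) = Digamma z + 1 / z"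
    using Digamma_plus1[of z] nz by (simp add: add.commute)
  hence "Digamma (1 - z) - Digamma z = Digamma (1 - z) - Digamma (1 + z) + 1 / z" by simp
  finally show ?thesis .
qed

lemma sin_pi_nonzero:
  fixes z :: complex
  assumes "z \<notin> \<int>"
  shows "sin (of_real pi * z) \<noteq> 0"
  using assms by (subst sin_eq_0) (auto simp: Ints_def)

text \<open>Subtract the Digamma series at 1 - z from the one at 1 + z: the convergence terms
  1/(n+1) and Euler's constant cancel.\<close>

lemma cot_partial_fraction:
  fixes z :: complex
  assumes z: "z \<notin> \<int>"
  shows "(\<lambda>n. 1 / (of_nat (Suc n) - z) - 1 / (of_nat (Suc n) + z)) sums
           (1 / z - of_real pi * cot (of_real pi * z))"
proof -
  have nz: "1 - z \<noteq> 0" "1 + z \<noteq> 0"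
    using z by (auto simp: add_eq_0_iff)
  define f where "f = (\<lambda>w n. inverse (of_nat (Suc n)) - inverse (w + of_nat n :: complex))"
  have "f w sums (Digamma w + euler_mascheroni)" if "w \<noteq> 0" for w
    using summable_Digamma[OF that] by (auto simp: f_def Digamma_def sums_iff)
  hence "(\<lambda>n. f (1 + z) n - f (1 - z) n) sums (Digamma (1 + z) + euler_mascheroni - (Digamma (1 - z) + euler_mascheroni))"
    using nz by (intro sums_diff) auto
  also have "(\<lambda>n. f (1 + z) n - f (1 - z) n) = (\<lambda>n. 1 / (of_nat (Suc n) - z) - 1 / (of_nat (Suc n) + z))"
    by (auto simp: f_def field_simps)
  also have "Digamma (1 + z) + euler_mascheroni - (Digamma (1 - z) + euler_mascheroni) = 1 / z - of_real pi * cot (of_real pi * z)"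
    using cot_conv_Digamma[OF z] by simp
  finally show ?thesis .
qed

text \<open>Derivative of the cotangent expansion. Differentiating on the Digamma side replaces
  termwise differentiation by the known series of \<open>Polygamma 1\<close>.\<close>

lemma sin_squared_partial_fraction:
  fixes z :: complex
  assumes z: "z \<notin> \<int>"
  shows "(\<lambda>n. 1 / (z + of_nat (Suc n))\<^sup>2 + 1 / (z - of_nat (Suc n))\<^sup>2) sums
           ((of_real pi / sin (of_real pi * z))\<^sup>2 - 1 / z\<^sup>2)"
proof -
  have op: "open (- \<int> :: complex set)"
    by (simp add: closed_Ints flip: closed_open)
  have nz: "1 - z \<notin> \<int>\<^sub>\<le>\<^sub>0" "1 + z \<notin> \<int>\<^sub>\<le>\<^sub>0" "z \<noteq> 0" "1 - z \<noteq> 0" "1 + z \<noteq> 0"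
    using z by (auto dest!: subsetD[OF nonpos_Ints_subset_Ints] simp: add_eq_0_iff)
  have D1: "((\<lambda>z. Digamma (1 - z) - Digamma (1 + z) + 1 / z) has_field_derivative
          (- Polygamma 1 (1 - z) - Polygamma 1 (1 + z) - 1 / z\<^sup>2)) (at z)"
    using nz by (auto intro!: derivative_eq_intros simp: algebra_simps power2_eq_square)
  have "((\<lambda>z. of_real pi * cot (of_real pi * z)) has_field_derivative - (of_real pi / sin (of_real pi * z))\<^sup>2) (at z)"
  proof -
    have alg: "- (s * p) * s - c * (c * p) = - p * (s\<^sup>2 + c\<^sup>2)" for s c p :: complex
      by (simp add: algebra_simps power2_eq_square)
    have "((\<lambda>z. of_real pi * (cos (of_real pi * z) / sin (of_real pi * z))) has_field_derivative
            of_real pi * ((- (sin (of_real pi * z) * of_real pi) * sin (of_real pi * z) - cos (of_real pi * z) * (cos (of_real pi * z) * of_real pi))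
              / (sin (of_real pi * z) * sin (of_real pi * z)))) (at z)"
      using sin_pi_nonzero[OF z] by (auto intro!: derivative_eq_intros) (simp add: algebra_simps)
    also have "- (sin (of_real pi * z) * of_real pi) * sin (of_real pi * z) - cos (of_real pi * z) * (cos (of_real pi * z) * of_real pi)
                 = - of_real pi * ((sin (of_real pi * z))\<^sup>2 + (cos (of_real pi * z))\<^sup>2)"
      by (rule alg)
    finally show ?thesis
      by (simp only: cot_def sin_cos_squared_add mult_1_right power_divide) (simp add: power2_eq_square)
  qed
  moreover have ev: "\<forall>\<^sub>F w in nhds z. of_real pi * cot (of_real pi * w) = Digamma (1 - w) - Digamma (1 + w) + 1 / w"
    using z by (intro eventually_mono[OF eventually_nhds_in_open[OF op, of z]]) (auto simp: cot_conv_Digamma)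
  ultimately have "((\<lambda>z. Digamma (1 - z) - Digamma (1 + z) + 1 / z) has_field_derivative - (of_real pi / sin (of_real pi * z))\<^sup>2) (at z)"
    using DERIV_cong_ev[OF refl ev refl] by simp
  with D1 have *: "(of_real pi / sin (of_real pi * z))\<^sup>2 = Polygamma 1 (1 - z) + Polygamma 1 (1 + z) + 1 / z\<^sup>2"
    by (metis (no_types, lifting) DERIV_unique add.inverse_inverse minus_add_distrib diff_conv_add_uminus)
  have P: "(\<lambda>n. inverse ((w + of_nat n)\<^sup>2)) sums Polygamma 1 w" if "w \<noteq> 0" for w :: complex
    using Polygamma_converges'[OF that, of 2] by (auto simp: Polygamma_def sums_iff numeral_2_eq_2)
  have "(\<lambda>n. inverse ((1 + z + of_nat n)\<^sup>2) + inverse ((1 - z + of_nat n)\<^sup>2)) sums (Polygamma 1 (1 + z) + Polygamma 1 (1 - z))"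
    by (intro sums_add P nz)
  also have "(\<lambda>n. inverse ((1 + z + of_nat n)\<^sup>2) + inverse ((1 - z + of_nat n)\<^sup>2)) = (\<lambda>n. 1 / (z + of_nat (Suc n))\<^sup>2 + 1 / (z - of_nat (Suc n))\<^sup>2)"
    by (auto simp: divide_inverse power2_commute[of z] algebra_simps)
  also have "Polygamma 1 (1 + z) + Polygamma 1 (1 - z) = (of_real pi / sin (of_real pi * z))\<^sup>2 - 1 / z\<^sup>2"
    using * by simp
  finally show ?thesis .
qed

text \<open>Fubini under a product majorant. The common value stays existential because the row sums
  and the column sums are evaluated separately, and equating the two evaluations is the
  goal.\<close>

lemma abs_summable_swap_sums:
  fixes d :: "nat \<Rightarrow> nat \<Rightarrow> complex" and u v :: "nat \<Rightarrow> real"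
  assumes bound: "\<And>m n. norm (d m n) \<le> u m * v n"
    and u: "summable u" "\<And>m. u m \<ge> 0" and v: "summable v" "\<And>n. v n \<ge> 0"
    and rows: "\<And>m. d m sums r m" and cols: "\<And>n. (\<lambda>m. d m n) sums c n"
  shows "\<exists>S. r sums S \<and> c sums S"
proof -
  have "(\<lambda>(m,n). u m * v n) summable_on UNIV \<times> UNIV"
    using u v by (intro summable_on_SigmaI[where g = "\<lambda>m. u m * suminf v"])
      (auto intro!: summable_nonneg_imp_summable_on has_sum_cmult_right summable_on_cmult_left norm_summable_imp_has_sum summable_sums)
  hence abs: "(\<lambda>x. norm (case x of (m,n) \<Rightarrow> d m n)) summable_on UNIV \<times> UNIV"
    by (rule Infinite_Sum.abs_summable_on_comparison_test') (use bound in auto)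
  hence "(\<lambda>(m,n). d m n) summable_on UNIV \<times> UNIV"
    by (rule Infinite_Sum.abs_summable_summable)
  then obtain S where S: "((\<lambda>(m,n). d m n) has_sum S) (UNIV \<times> UNIV)"
    by (auto simp: summable_on_def)
  have S': "((\<lambda>(n,m). d m n) has_sum S) (UNIV \<times> UNIV)"
    using S by (subst (asm) has_sum_swap) (auto simp: case_prod_unfold)
  have R: "(d m has_sum r m) UNIV" for m
    by (intro norm_summable_imp_has_sum rows summable_comparison_test'[OF summable_mult[OF v(1), of "u m"], of 0]) (use bound in auto)
  have C: "((\<lambda>m. d m n) has_sum c n) UNIV" for n
    by (intro norm_summable_imp_has_sum cols summable_comparison_test'[OF summable_mult2[OF u(1), of "v n"], of 0]) (use bound in auto)
  have "(r has_sum S) UNIV"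
    by (rule has_sum_SigmaD[OF S]) (use R in auto)
  moreover have "(c has_sum S) UNIV"
    by (rule has_sum_SigmaD[OF S']) (use C in auto)
  ultimately show ?thesis
    using has_sum_imp_sums by blast
qed

subsection \<open>The quasimodular Eisenstein series of weight 2\<close>

text \<open>The imaginary part of m t + x controls m, and then the triangle inequality controls x.
  With x real rather than integral, the bound also covers the half-integers of the telescoping
  family.\<close>

lemma norm_lattice_ge:
  fixes t :: complex
  assumes t: "Im t > 0"
  obtains c where "c > 0" "\<And>m x. m \<ge> 0 \<Longrightarrow> norm (of_real m * t + of_real x) \<ge> c * (m + \<bar>x\<bar>)"
proof
  define C where "C = 1 / Im t + 1 + norm t / Im t"
  have C: "C > 0" using t unfolding C_def by (intro add_pos_nonneg) auto
  show "1 / C > 0" using C by simp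
  fix m x :: real
  assume m: "m \<ge> 0"
  define N where "N = norm (of_real m * t + of_real x)"
  have "m * Im t \<le> N"
    using abs_Im_le_cmod[of "of_real m * t + of_real x"] m t by (simp add: N_def abs_mult)
  hence mN: "m \<le> N / Im t" using t by (simp add: field_simps)
  have "\<bar>x\<bar> = norm ((of_real m * t + of_real x) - of_real m * t)" by simp
  also have "\<dots> \<le> N + m * norm t"
    unfolding N_def using m by (intro order.trans[OF norm_triangle_ineq4]) (auto simp: norm_mult)
  also have "m * norm t \<le> N / Im t * norm t"
    using mN by (intro mult_right_mono) auto
  finally have "m + \<bar>x\<bar> \<le> N * C"
    using mN by (simp add: C_def algebra_simps)
  thus "1 / C * (m + \<bar>x\<bar>) \<le> norm (of_real m * t + of_real x)"
    using C unfolding N_def by (simp add: field_simps)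
qed

lemma Im_nonzero_imp_not_Ints: "Im z \<noteq> 0 \<Longrightarrow> z \<notin> \<int>"
  by (auto elim!: Ints_cases)

text \<open>The difference equals -1/4 divided by y^2 (y - 1/2)(y + 1/2), so quadratic decay
  improves to quartic, enough for absolute convergence over a lattice. As T >= 1 gives T - 1/2 >=
  T/2, the two halved factors use up the constant 1/4.\<close>

lemma second_difference_bound:
  fixes z :: complex and x T c :: real
  assumes c: "c > 0" and T: "T \<ge> 1"
    and z: "norm (z + of_real x) \<ge> c * T"
      "norm (z + of_real (x - 1/2)) \<ge> c * (T - 1/2)" "norm (z + of_real (x + 1/2)) \<ge> c * (T - 1/2)"
  shows "norm (1 / (z + of_real x)\<^sup>2 - (1 / (z + of_real (x - 1/2)) - 1 / (z + of_real (x + 1/2)))) \<le> 1 / (c * T) ^ 4"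
proof -
  have pos: "c * T > 0" "c * (T - 1/2) > 0" using c T by auto
  have half: "c * T / 2 \<le> c * (T - 1/2)" using c T by (simp add: field_simps)
  have nz: "z + of_real x \<noteq> 0" "z + of_real (x - 1/2) \<noteq> 0" "z + of_real (x + 1/2) \<noteq> 0"
    using z pos by (auto simp: norm_le_zero_iff[symmetric] simp del: norm_le_zero_iff)
  define y where "y = z + of_real x"
  have y: "z + of_real (x - 1/2) = y - 1/2" "z + of_real (x + 1/2) = y + 1/2" "z + of_real x = y"
    by (auto simp: y_def)
  have "1 / y\<^sup>2 - (1 / (y - 1/2) - 1 / (y + 1/2)) = - (1/4) / (y\<^sup>2 * ((y - 1/2) * (y + 1/2)))"
    using nz unfolding y by (simp add: divide_simps) (auto simp: algebra_simps power2_eq_square)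
  also have "norm \<dots> = (1/4) / (norm y ^ 2 * (norm (y - 1/2) * norm (y + 1/2)))"
    by (simp add: norm_divide norm_mult norm_power)
  also have "\<dots> \<le> (1/4) / ((c * T) ^ 2 * ((c * T / 2) * (c * T / 2)))"
    using z pos half nz unfolding y by (intro divide_left_mono mult_mono power_mono) (auto intro!: mult_pos_pos)
  also have "\<dots> = 1 / (c * T) ^ 4"
    using pos by (simp add: field_simps eval_nat_numeral)
  finally show ?thesis unfolding y .
qed

text \<open>In terms of exp(-2 i z), which tends to 0 far down in the lower half-plane, the
  cotangent is a fraction with limit i. This limit is the source of the term \<pi>i/t in the
  quasimodular law.\<close>

lemma tendsto_cot_at_minus_i_infinity:
  fixes w :: "nat \<Rightarrow> complex"
  assumes "filterlim (\<lambda>n. Im (w n)) at_bot sequentially"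
  shows "(\<lambda>n. cot (w n)) \<longlonglongrightarrow> \<i>"
proof -
  have "(\<lambda>n. exp (2 * Im (w n))) \<longlonglongrightarrow> 0"
    by (intro filterlim_compose[OF exp_at_bot] filterlim_tendsto_pos_mult_at_bot[OF tendsto_const] assms) auto
  hence lim: "(\<lambda>n. exp (-2 * \<i> * w n)) \<longlonglongrightarrow> 0"
    by (intro tendsto_norm_zero_cancel[of "\<lambda>n. exp (-2 * \<i> * w n)"]) simp
  have eq: "cot z = \<i> * (1 + exp (-2 * \<i> * z)) / (1 - exp (-2 * \<i> * z))" for z :: complex
  proof -
    have e: "exp (-2 * \<i> * z) = exp (- (\<i> * z)) * exp (- (\<i> * z))"
      by (simp add: mult.assoc flip: exp_add)
    have i: "exp (- (\<i> * z)) = inverse (exp (\<i> * z))" by (simp add: exp_minus)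
    have nz: "exp (\<i> * z) \<noteq> 0" by simp
    define X where "X = exp (\<i> * z)"
    \<comment> \<open>For Q = 0 both sides are 0 by the convention x/0 = 0, so the formula for cot
      holds at the zeros of sin as well.\<close>
    have halves: "(P / 2) / (Q / (2 * \<i>)) = \<i> * P / Q" for P Q :: complex
      by (cases "Q = 0") (simp_all add: divide_simps)
    have "cot z = ((X + inverse X) / 2) / ((X - inverse X) / (2 * \<i>))"
      unfolding cot_def cos_exp_eq sin_exp_eq i X_def ..
    also have "\<dots> = \<i> * (X + inverse X) / (X - inverse X)" by (rule halves)
    also have "\<dots> = \<i> * (1 + inverse X * inverse X) / (1 - inverse X * inverse X)"
    proof -
      have "X + inverse X = X * (1 + inverse X * inverse X)" "X - inverse X = X * (1 - inverse X * inverse X)"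
        using nz unfolding X_def[symmetric] by (auto simp: field_simps)
      thus ?thesis using nz unfolding X_def[symmetric] by simp
    qed
    finally show ?thesis unfolding e i X_def .
  qed
  have "(\<lambda>n. \<i> * (1 + exp (-2 * \<i> * w n)) / (1 - exp (-2 * \<i> * w n))) \<longlonglongrightarrow> \<i> * (1 + 0) / (1 - 0)"
    by (intro tendsto_intros lim) auto
  thus ?thesis by (simp add: eq)
qed

text \<open>By the partial fraction of the squared cosecant, this sums 1/(m t + n)^2 over all
  integers n first and then over m >= 1. Hence \<pi>^2/3 + 2 \<open>csc2_sum t\<close> is the
  Eisenstein series G_2(t).\<close>

definition csc2_sum :: "complex \<Rightarrow> complex" where
  "csc2_sum t = (\<Sum>m. (of_real pi / sin (of_real pi * (of_nat (Suc m) * t)))\<^sup>2)"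

text \<open>The two iterated sums of \<open>1/(m t + n)^2\<close> differ. Subtracting the telescoping family
  \<open>1/(m t + n - 1/2) - 1/(m t + n + 1/2)\<close> makes the double series absolutely convergent,
  and the term \<open>\<pi>\<i>/t\<close> is what the telescoping family contributes when summed by columns.\<close>

lemma csc2_sum_transformation:
  fixes t :: complex
  assumes t: "Im t > 0"
  shows "(\<lambda>m. (of_real pi / sin (of_real pi * (of_nat (Suc m) * t)))\<^sup>2) sums csc2_sum t" (is ?th1)
    and "csc2_sum t = (of_real (pi\<^sup>2 / 6) + csc2_sum (-1/t)) / t\<^sup>2 - of_real (pi\<^sup>2 / 6) + of_real pi * \<i> / t" (is ?th2)
proof -
  \<comment> \<open>Nothing is known about the value of \<open>csc2_sum (-1/t)\<close> until its
    series is known to converge, so the formula is stated conditionally. The unconditional half,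
    applied at -1/t, then supplies the condition.\<close>
  have main: "\<exists>S. (\<lambda>m. (of_real pi / sin (of_real pi * (of_nat (Suc m) * t)))\<^sup>2) sums S \<and>
    ((\<lambda>n. (of_real pi / sin (of_real pi * (of_nat (Suc n) * (-1/t))))\<^sup>2) sums csc2_sum (-1/t) \<longrightarrow>
       S = (of_real (pi\<^sup>2 / 6) + csc2_sum (-1/t)) / t\<^sup>2 - of_real (pi\<^sup>2 / 6) + of_real pi * \<i> / t)"
    if t: "Im t > 0" for t
  proof -
    have t0: "t \<noteq> 0" using t by auto
    obtain c where c: "c > 0" and lat: "\<And>m x. m \<ge> 0 \<Longrightarrow> norm (of_real m * t + of_real x) \<ge> c * (m + \<bar>x\<bar>)"
      using norm_lattice_ge[OF t] by metis
    define z where "z = (\<lambda>m. of_nat (Suc m) * t)"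
    have zI: "z m \<notin> \<int>" for m
      using t by (intro Im_nonzero_imp_not_Ints) (simp add: z_def)
    define a where "a = (\<lambda>w n. 1 / (w + of_nat (Suc n))\<^sup>2 + 1 / (w - of_nat (Suc n) :: complex)\<^sup>2)"
    define b where "b = (\<lambda>w n. (1 / (w + of_nat (Suc n) - 1/2) - 1 / (w + of_nat (Suc n) + 1/2)) + 
                        (1 / (w - of_nat (Suc n) - 1/2) - 1 / (w - of_nat (Suc n) + 1/2) :: complex))"
    define d where "d = (\<lambda>m n. a (z m) n - b (z m) n)"
    define s where "s = (\<lambda>m. (of_real pi / sin (of_real pi * (of_nat (Suc m) * t)))\<^sup>2)"
    define s' where "s' = (\<lambda>m. (of_real pi / sin (of_real pi * (of_nat (Suc m) * (-1/t))))\<^sup>2)"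
    \<comment> \<open>The telescoping term for n = 0; \<open>a\<close> and \<open>b\<close> pair n
      with -n for n >= 1. The telescoping family sums to 0 over all n, which is why the row sum of
      \<open>b\<close> is minus this term.\<close>
    define b0 where "b0 = (\<lambda>m. 1 / (z m - 1/2) - 1 / (z m + 1/2))"
    have bound: "norm (d m n) \<le> 1 / (8 * c ^ 4 * (real (Suc m))\<^sup>2) * (1 / (real (Suc n))\<^sup>2)" for m n
    proof -
      define M X where "M = real (Suc m)" and "X = real (Suc n)"
      have MX: "M \<ge> 1" "X \<ge> 1" by (auto simp: M_def X_def)
      have zM: "z m = of_real M * t" by (simp add: z_def M_def)
      have lat': "norm (z m + of_real y) \<ge> c * r" if "r \<le> M + \<bar>y\<bar>" for y r
      proof -
        have "c * r \<le> c * (M + \<bar>y\<bar>)" using that c by (intro mult_left_mono) auto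
        also have "\<dots> \<le> norm (z m + of_real y)" unfolding zM using MX by (intro lat) auto
        finally show ?thesis .
      qed
      have ms: "norm (1 / (z m + of_real y)\<^sup>2 - (1 / (z m + of_real (y - 1/2)) - 1 / (z m + of_real (y + 1/2)))) \<le> 1 / (16 * c ^ 4 * M\<^sup>2) * (1 / X\<^sup>2)" 
        if y: "\<bar>y\<bar> = X" for y
      proof -
        have "norm (1 / (z m + of_real y)\<^sup>2 - (1 / (z m + of_real (y - 1/2)) - 1 / (z m + of_real (y + 1/2)))) \<le> 1 / (c * (M + X)) ^ 4"
          using y MX by (intro second_difference_bound lat' c) auto
        also have "\<dots> \<le> 1 / (c ^ 4 * (4 * M * X)\<^sup>2)"
        proof -
          \<comment> \<open>The arithmetic-geometric mean inequality converts decay in M + X into a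
            product majorant.\<close>
          have "4 * M * X \<le> (M + X)\<^sup>2"
            using zero_le_power2[of "M - X"] by (simp add: power2_eq_square algebra_simps)
          hence "(4 * M * X)\<^sup>2 \<le> ((M + X)\<^sup>2)\<^sup>2"
            using MX by (intro power_mono) auto
          thus ?thesis using c MX
            by (intro divide_left_mono) (auto simp: power_mult_distrib intro!: mult_left_mono)
        qed
        also have "\<dots> = 1 / (16 * c ^ 4 * M\<^sup>2) * (1 / X\<^sup>2)"
          using c MX by (simp add: field_simps)
        finally show ?thesis .
      qed
      have "d m n = (1 / (z m + of_real X)\<^sup>2 - (1 / (z m + of_real (X - 1/2)) - 1 / (z m + of_real (X + 1/2)))) +
                    (1 / (z m + of_real (-X))\<^sup>2 - (1 / (z m + of_real (-X - 1/2)) - 1 / (z m + of_real (-X + 1/2))))"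
        by (simp add: d_def a_def b_def X_def algebra_simps)
      also have "norm \<dots> \<le> 1 / (16 * c ^ 4 * M\<^sup>2) * (1 / X\<^sup>2) + 1 / (16 * c ^ 4 * M\<^sup>2) * (1 / X\<^sup>2)"
        using MX by (intro order.trans[OF norm_triangle_ineq] add_mono ms) auto
      also have "\<dots> = 1 / (8 * c ^ 4 * M\<^sup>2) * (1 / X\<^sup>2)"
        by (simp add: field_simps)
      finally show ?thesis by (simp only: M_def X_def)
    qed
    have b_partial: "(\<Sum>n<N. b w n) = 1 / (w + 1/2) - 1 / (w - 1/2) + (1 / (w - (of_nat N + 1/2)) - 1 / (w + (of_nat N + 1/2)))" for w N
      by (induction N) (simp_all add: b_def algebra_simps)
    have lim0: "(\<lambda>N. 1 / (w - (of_nat N + 1/2)) - 1 / (w + (of_nat N + 1/2) :: complex)) \<longlonglongrightarrow> 0" for w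
    proof -
      have 1: "filterlim (\<lambda>N. of_nat N + (1/2 + w) :: complex) at_infinity sequentially" for w
        by (rule tendsto_add_filterlim_at_infinity'[OF tendsto_of_nat tendsto_const])
      have "(\<lambda>N. - inverse (of_nat N + (1/2 - w)) - inverse (of_nat N + (1/2 + w) :: complex)) \<longlonglongrightarrow> - 0 - 0"
        using 1[of "-w"] by (intro tendsto_intros filterlim_compose[OF tendsto_inverse_0] 1) simp
      also have "(\<lambda>N. - inverse (of_nat N + (1/2 - w)) - inverse (of_nat N + (1/2 + w) :: complex)) = (\<lambda>N. 1 / (w - (of_nat N + 1/2)) - 1 / (w + (of_nat N + 1/2) :: complex))"
      proof
        fix N
        have "w - (of_nat N + 1/2) = - (of_nat N + (1/2 - w))" "w + (of_nat N + 1/2) = of_nat N + (1/2 + w)"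
          by (simp_all add: algebra_simps)
        thus "- inverse (of_nat N + (1/2 - w)) - inverse (of_nat N + (1/2 + w)) = 1 / (w - (of_nat N + 1/2)) - 1 / (w + (of_nat N + 1/2))"
          by (simp only: divide_inverse mult_1_left inverse_minus_eq)
      qed
      finally show ?thesis by simp
    qed
    have b_row: "b (z m) sums - b0 m" for m
    proof -
      have "(\<lambda>N. 1 / (z m + 1/2) - 1 / (z m - 1/2) + (1 / (z m - (of_nat N + 1/2)) - 1 / (z m + (of_nat N + 1/2)))) \<longlonglongrightarrow> 1 / (z m + 1/2) - 1 / (z m - 1/2) + 0"
        by (intro tendsto_intros lim0)
      thus ?thesis unfolding sums_def b_partial by (simp add: b0_def)
    qed
    have rows: "d m sums (s m - 1 / (z m)\<^sup>2 + b0 m)" for m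
      using sums_diff[OF sin_squared_partial_fraction[OF zI[of m]] b_row[of m]]
      unfolding d_def a_def s_def z_def by simp
    have sq: "(\<lambda>m. 1 / (z m)\<^sup>2) sums (of_real (pi\<^sup>2 / 6) / t\<^sup>2)"
    proof -
      have "(\<lambda>m. of_real (1 / (real m + 1)\<^sup>2)) sums (of_real (pi\<^sup>2 / 6) :: complex)"
        using inverse_squares_sums by (subst sums_of_real_iff) (simp only: of_nat_power of_nat_add of_nat_1)
      from sums_divide[OF this, of "t\<^sup>2"] show ?thesis
        by (simp add: z_def power_mult_distrib add_ac)
    qed
    have half: "(of_nat N + 1/2) / t \<notin> \<int>" for N
    proof (rule Im_nonzero_imp_not_Ints)
      have "Im ((of_real (real N + 1/2)) / t) \<noteq> 0"
        using t t0 by (auto simp: Im_divide sum_power2_eq_zero_iff)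
      thus "Im ((of_nat N + 1/2) / t) \<noteq> 0" by simp
    qed
    \<comment> \<open>Closed form, from the cotangent expansion at (N + 1/2)/t, of the sum over m >=
      1 of 1/(m t - N - 1/2) - 1/(m t + N + 1/2). The n-th column of \<open>b\<close> is the
      increment of \<open>e\<close>, so the columns telescope too.\<close>
    define e where "e = (\<lambda>N. (t / (of_nat N + 1/2) - of_real pi * cot (of_real pi * ((of_nat N + 1/2) / t))) / t)"
    have col_b: "(\<lambda>m. 1 / (z m - (of_nat N + 1/2)) - 1 / (z m + (of_nat N + 1/2))) sums e N" for N
    proof -
      have *: "1 / (of_nat (Suc m) - (of_nat N + 1/2) / t) = t / (z m - (of_nat N + 1/2))"
              "1 / (of_nat (Suc m) + (of_nat N + 1/2) / t) = t / (z m + (of_nat N + 1/2))" for m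
      proof -
        have "of_nat (Suc m) - (of_nat N + 1/2) / t = (z m - (of_nat N + 1/2)) / t"
             "of_nat (Suc m) + (of_nat N + 1/2) / t = (z m + (of_nat N + 1/2)) / t"
          using t0 by (simp_all only: z_def diff_divide_distrib add_divide_distrib nonzero_mult_div_cancel_right not_False_eq_True)
        thus "1 / (of_nat (Suc m) - (of_nat N + 1/2) / t) = t / (z m - (of_nat N + 1/2))"
             "1 / (of_nat (Suc m) + (of_nat N + 1/2) / t) = t / (z m + (of_nat N + 1/2))"
          by (simp_all only: divide_divide_eq_right mult_1_left)
      qed
      from sums_divide[OF cot_partial_fraction[OF half[of N]], of t] show ?thesis
        using t0 unfolding * e_def by (simp add: diff_divide_distrib)
    qed
    have b0_eq: "b0 m = 1 / (z m - (of_nat 0 + 1/2)) - 1 / (z m + (of_nat 0 + 1/2))" for m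
      by (simp add: b0_def)
    have b0_sums: "b0 sums e 0"
      using col_b[of 0] unfolding b0_eq .
    have col_bn: "(\<lambda>m. b (z m) n) sums (e (Suc n) - e n)" for n
      using sums_diff[OF col_b[of "Suc n"] col_b[of n]] by (simp add: b_def algebra_simps)
    have cols: "(\<lambda>m. d m n) sums ((s' n - (t / of_nat (Suc n))\<^sup>2) / t\<^sup>2 - (e (Suc n) - e n))" for n
    proof -
      have "- (of_nat (Suc n) / t) \<notin> \<int>"
      proof (rule Im_nonzero_imp_not_Ints)
        have "Im ((of_real (real (Suc n))) / t) \<noteq> 0"
          using t t0 by (auto simp: Im_divide sum_power2_eq_zero_iff)
        thus "Im (- (of_nat (Suc n) / t)) \<noteq> 0" by simp
      qed
      from sin_squared_partial_fraction[OF this]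
      have "(\<lambda>m. 1 / (- (of_nat (Suc n) / t) + of_nat (Suc m))\<^sup>2 + 1 / (- (of_nat (Suc n) / t) - of_nat (Suc m))\<^sup>2) sums (s' n - (t / of_nat (Suc n))\<^sup>2)"
        by (simp add: s'_def power_divide)
      moreover have "(1 / (- (of_nat (Suc n) / t) + of_nat (Suc m))\<^sup>2 + 1 / (- (of_nat (Suc n) / t) - of_nat (Suc m))\<^sup>2) / t\<^sup>2 = a (z m) n" for m
      proof -
        have "- (of_nat (Suc n) / t) + of_nat (Suc m) = (z m - of_nat (Suc n)) / t"
             "- (of_nat (Suc n) / t) - of_nat (Suc m) = - ((z m + of_nat (Suc n)) / t)"
          using t0 by (auto simp: z_def field_simps)
        thus ?thesis using t0
          unfolding a_def by (simp only: power2_minus power_divide) (simp add: add_divide_distrib add.commute)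
      qed
      ultimately have "(\<lambda>m. a (z m) n) sums ((s' n - (t / of_nat (Suc n))\<^sup>2) / t\<^sup>2)"
        using sums_divide[of _ _ "t\<^sup>2"] by fastforce
      from sums_diff[OF this col_bn[of n]] show ?thesis by (simp add: d_def)
    qed
    have su: "summable (\<lambda>n. 1 / (real (Suc n))\<^sup>2)"
      using inverse_squares_sums by (auto simp: sums_iff add_ac)
    have su': "summable (\<lambda>n. 1 / (8 * c ^ 4 * (real (Suc n))\<^sup>2))"
      using summable_mult[OF su, of "1 / (8 * c ^ 4)"] by (simp del: of_nat_Suc)
    obtain S where S: "(\<lambda>m. s m - 1 / (z m)\<^sup>2 + b0 m) sums S"
        "(\<lambda>n. (s' n - (t / of_nat (Suc n))\<^sup>2) / t\<^sup>2 - (e (Suc n) - e n)) sums S"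
      using abs_summable_swap_sums[OF bound su' _ su _ rows cols] c by force
    have s: "s sums (S + of_real (pi\<^sup>2 / 6) / t\<^sup>2 - e 0)"
      using sums_diff[OF sums_add[OF S(1) sq] b0_sums] by simp
    \<comment> \<open>The points (N + 1/2)/t descend in the lower half-plane, where cot tends to i.
      Summed by rows the telescoping family contributes 0; summed by columns it leaves this nonzero
      limit.\<close>
    have e_lim: "e \<longlonglongrightarrow> - of_real pi * \<i> / t"
    proof -
      have "(\<lambda>N. inverse (of_nat N + 1/2 :: complex)) \<longlonglongrightarrow> 0"
        by (rule filterlim_compose[OF tendsto_inverse_0 tendsto_add_filterlim_at_infinity'[OF tendsto_of_nat tendsto_const]])
      hence 1: "(\<lambda>N. t / (of_nat N + 1/2)) \<longlonglongrightarrow> t * 0"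
        unfolding divide_inverse by (intro tendsto_intros)
      have "Im (of_real pi * ((of_nat N + 1/2) / t)) = (real N + 1/2) * (- pi * Im t / (norm t)\<^sup>2)" for N
      proof -
        have "of_real pi * ((of_nat N + 1/2) / t) = of_real (pi * (real N + 1/2)) / t" by simp
        also have "Im \<dots> = pi * (real N + 1/2) * (- Im t / (norm t)\<^sup>2)"
          by (simp add: Im_divide cmod_power2 del: of_real_mult of_real_add)
        finally show ?thesis by (simp add: field_simps)
      qed
      moreover have "filterlim (\<lambda>N. (- pi * Im t / (norm t)\<^sup>2) * (real N + 1/2)) at_bot sequentially"
      proof (rule filterlim_tendsto_neg_mult_at_bot[OF tendsto_const])
        show "filterlim (\<lambda>N. real N + 1/2) at_top sequentially" by real_asymp
        show "- pi * Im t / (norm t)\<^sup>2 < 0" using t t0 by (simp add: field_simps)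
      qed
      ultimately have 2: "(\<lambda>N. cot (of_real pi * ((of_nat N + 1/2) / t))) \<longlonglongrightarrow> \<i>"
        by (intro tendsto_cot_at_minus_i_infinity) (simp add: mult.commute)
      have "e \<longlonglongrightarrow> (t * 0 - of_real pi * \<i>) / t"
        unfolding e_def using t0 by (intro tendsto_intros 1 2)
      thus ?thesis by simp
    qed
    have "S = (of_real (pi\<^sup>2 / 6) + csc2_sum (-1/t)) / t\<^sup>2 - of_real (pi\<^sup>2 / 6) + of_real pi * \<i> / t - of_real (pi\<^sup>2 / 6) / t\<^sup>2 + e 0"
      if s': "s' sums csc2_sum (-1/t)"
    proof -
      have e_tel: "(\<lambda>n. e (Suc n) - e n) sums (- of_real pi * \<i> / t - e 0)"
        by (rule telescope_sums[OF e_lim])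
      have "(\<lambda>m. of_real (1 / (real m + 1)\<^sup>2)) sums (of_real (pi\<^sup>2 / 6) :: complex)"
        using inverse_squares_sums by (subst sums_of_real_iff) (simp only: of_nat_power of_nat_add of_nat_1)
      hence "(\<lambda>n. s' n / t\<^sup>2 - of_real (1 / (real n + 1)\<^sup>2) - (e (Suc n) - e n)) sums
               (csc2_sum (-1/t) / t\<^sup>2 - of_real (pi\<^sup>2 / 6) - (- of_real pi * \<i> / t - e 0))"
        by (intro sums_diff e_tel sums_divide s')
      also have "(\<lambda>n. s' n / t\<^sup>2 - of_real (1 / (real n + 1)\<^sup>2) - (e (Suc n) - e n)) =
          (\<lambda>n. (s' n - (t / of_nat (Suc n))\<^sup>2) / t\<^sup>2 - (e (Suc n) - e n))"
        using t0 by (auto simp: diff_divide_distrib power_divide add_ac)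
      finally have "S = csc2_sum (-1/t) / t\<^sup>2 - of_real (pi\<^sup>2 / 6) - (- of_real pi * \<i> / t - e 0)"
        using S(2) sums_unique2 by blast
      thus ?thesis by (simp add: add_divide_distrib)
    qed
    with s show ?thesis unfolding s'_def s_def by auto
  qed
  have S: "(\<lambda>m. (of_real pi / sin (of_real pi * (of_nat (Suc m) * t)))\<^sup>2) sums csc2_sum t" if "Im t > 0" for t
    using main[OF that] by (auto simp: csc2_sum_def sums_iff)
  show ?th1 by (rule S[OF t])
  have "Im (-1/t) > 0" using t by (auto simp: Im_divide field_simps sum_power2_gt_zero_iff)
  from S[OF this] main[OF t] S[OF t] show ?th2
    using sums_unique2 by blast
qed

subsection \<open>Euler's product\<close>

text \<open>For \<open>|q| < 1\<close>, this is minus the logarithm of the product of 1 - q^m over all m > M.\<close>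

definition euler_log :: "nat \<Rightarrow> complex \<Rightarrow> complex" where
  "euler_log M q = (\<Sum>r. q ^ (Suc M * Suc r) / (of_nat (Suc r) * (1 - q ^ Suc r)))"

lemma norm_one_minus_power_ge:
  fixes q :: complex
  assumes "norm q < 1" "n > 0"
  shows "norm (1 - q ^ n) \<ge> 1 - norm q"
proof -
  have "norm q ^ n \<le> norm q ^ 1" using assms by (intro power_decreasing) auto
  hence "1 - norm q \<le> norm (1 :: complex) - norm (q ^ n)" by (simp add: norm_power)
  also have "\<dots> \<le> norm (1 - q ^ n)" by (rule norm_triangle_ineq2)
  finally show ?thesis .
qed

lemma euler_log_term_bound:
  fixes q :: complex
  assumes "norm q < 1"
  shows "norm (q ^ (Suc M * Suc r) / (of_nat (Suc r) * (1 - q ^ Suc r))) \<le> norm q ^ Suc M / (1 - norm q) * norm q ^ r"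
proof -
  have "norm q ^ (Suc M * Suc r) \<le> norm q ^ (Suc M + r)"
    using assms by (intro power_decreasing) auto
  moreover have "1 * (1 - norm q) \<le> norm (of_nat (Suc r) :: complex) * norm (1 - q ^ Suc r)"
    using norm_one_minus_power_ge[OF assms, of "Suc r"] assms by (intro mult_mono) (auto simp del: of_nat_Suc)
  ultimately have "norm q ^ (Suc M * Suc r) / (norm (of_nat (Suc r) :: complex) * norm (1 - q ^ Suc r)) \<le> norm q ^ (Suc M + r) / (1 * (1 - norm q))"
    using assms by (intro frac_le) auto
  thus ?thesis by (simp add: norm_divide norm_mult norm_power power_add del: of_nat_Suc)
qed

lemma summable_euler_log:
  fixes q :: complex
  assumes "norm q < 1"
  shows "summable (\<lambda>r. q ^ (Suc M * Suc r) / (of_nat (Suc r) * (1 - q ^ Suc r)))"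
proof (rule summable_comparison_test')
  show "summable (\<lambda>r. norm q ^ Suc M / (1 - norm q) * norm q ^ r)"
    using assms by (intro summable_mult summable_geometric) auto
qed (use euler_log_term_bound[OF assms] in blast)

text \<open>Used in two regimes: with M = 0 and small q for the transformed nome near a cusp, and
  with M tending to infinity for the tail of a truncated product.\<close>

lemma norm_euler_log_le:
  fixes q :: complex
  assumes "norm q < 1"
  shows "norm (euler_log M q) \<le> norm q ^ Suc M / (1 - norm q) ^ 2"
proof -
  have S: "(\<lambda>r. norm q ^ Suc M / (1 - norm q) * norm q ^ r) sums (norm q ^ Suc M / (1 - norm q) * (1 / (1 - norm q)))"
    using assms by (intro sums_mult geometric_sums) auto
  have "norm (euler_log M q) \<le> (\<Sum>r. norm q ^ Suc M / (1 - norm q) * norm q ^ r)"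
    unfolding euler_log_def by (rule norm_suminf_le[OF euler_log_term_bound[OF assms] sums_summable[OF S]])
  also have "\<dots> = norm q ^ Suc M / (1 - norm q) * (1 / (1 - norm q))"
    by (rule sums_unique[OF S, symmetric])
  finally have "norm (euler_log M q) \<le> norm q ^ Suc M / (1 - norm q) * (1 / (1 - norm q))" .
  thus ?thesis by (simp add: power2_eq_square)
qed

text \<open>The factor 1 - q^r produced by the subtraction cancels the denominator, which leaves the
  Mercator series of the logarithm.\<close>

lemma euler_log_diff:
  fixes q :: complex
  assumes q: "norm q < 1"
  shows "euler_log M q - euler_log (Suc M) q = - Ln (1 -(q ^ Suc M))"
proof -
  have "norm (q ^ Suc M) \<le> norm q ^ 1" unfolding norm_power using q by (intro power_decreasing) auto
  hence q': "norm (-(q ^ Suc M)) < 1" using q by simp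
  have "(\<lambda>r. q ^ (Suc M * Suc r) / (of_nat (Suc r) * (1 - q ^ Suc r)) - q ^ (Suc (Suc M) * Suc r) / (of_nat (Suc r) * (1 - q ^ Suc r)))
          sums (euler_log M q - euler_log (Suc M) q)"
    unfolding euler_log_def by (intro sums_diff summable_sums summable_euler_log q)
  also have "(\<lambda>r. q ^ (Suc M * Suc r) / (of_nat (Suc r) * (1 - q ^ Suc r)) - q ^ (Suc (Suc M) * Suc r) / (of_nat (Suc r) * (1 - q ^ Suc r)))
     = (\<lambda>r. - ((-1) ^ Suc (Suc r) / of_nat (Suc r) * (-(q ^ Suc M)) ^ Suc r))"
  proof
    fix r
    have nz: "1 - q ^ Suc r \<noteq> 0"
      using norm_one_minus_power_ge[OF q, of "Suc r"] q by auto
    have "q ^ (Suc (Suc M) * Suc r) = q ^ (Suc M * Suc r) * q ^ Suc r"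
      by (simp only: power_add[symmetric]) (simp add: add_ac)
    hence "q ^ (Suc M * Suc r) / (of_nat (Suc r) * (1 - q ^ Suc r)) - q ^ (Suc (Suc M) * Suc r) / (of_nat (Suc r) * (1 - q ^ Suc r))
      = q ^ (Suc M * Suc r) * (1 - q ^ Suc r) / (of_nat (Suc r) * (1 - q ^ Suc r))"
      by (simp only: right_diff_distrib mult_1_right diff_divide_distrib)
    also have "\<dots> = q ^ (Suc M * Suc r) / of_nat (Suc r)" using nz by simp
    also have "(-1) ^ Suc (Suc r) * (-(q ^ Suc M)) ^ Suc r = - (q ^ (Suc M * Suc r))"
      by (simp only: power_mult power_minus[of "q ^ Suc M"] mult.assoc[symmetric]) (simp flip: power_mult_distrib)
    hence "q ^ (Suc M * Suc r) / of_nat (Suc r) = - ((-1) ^ Suc (Suc r) / of_nat (Suc r) * (-(q ^ Suc M)) ^ Suc r)"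
      by (simp only: times_divide_eq_left) simp
    finally show "q ^ (Suc M * Suc r) / (of_nat (Suc r) * (1 - q ^ Suc r)) - q ^ (Suc (Suc M) * Suc r) / (of_nat (Suc r) * (1 - q ^ Suc r)) = - ((-1) ^ Suc (Suc r) / of_nat (Suc r) * (-(q ^ Suc M)) ^ Suc r)" .
  qed
  finally have 1: "\<dots> sums (euler_log M q - euler_log (Suc M) q)" .
  have "(\<lambda>r. (-1) ^ Suc (Suc r) / of_nat (Suc r) * (-(q ^ Suc M)) ^ Suc r) sums Ln (1 + (-(q ^ Suc M)))"
    using Ln_series[OF q'] by (subst sums_Suc_iff) simp
  from sums_minus[OF this] have 2: "(\<lambda>r. - ((-1) ^ Suc (Suc r) / of_nat (Suc r) * (-(q ^ Suc M)) ^ Suc r)) sums - Ln (1 -(q ^ Suc M))"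
    by simp
  show ?thesis by (rule sums_unique2[OF 1 2])
qed

lemma prod_one_minus_power_eq:
  fixes q :: complex
  assumes q: "norm q < 1"
  shows "(\<Prod>m = 1..M. 1 - q ^ m) = exp (euler_log M q - euler_log 0 q)"
proof (induction M)
  case (Suc M)
  have nz: "1 - q ^ Suc M \<noteq> 0"
    using norm_one_minus_power_ge[OF q, of "Suc M"] q by auto
  have "(\<Prod>m = 1..Suc M. 1 - q ^ m) = exp (euler_log M q - euler_log 0 q) * exp (Ln (1 -(q ^ Suc M)))"
    using Suc nz by (simp add: prod.nat_ivl_Suc')
  also have "\<dots> = exp (euler_log (Suc M) q - euler_log 0 q)"
    using euler_log_diff[OF q, of M] by (simp flip: exp_add add: algebra_simps)
  finally show ?case .
qed auto

definition cexp2pi :: "complex \<Rightarrow> complex" where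
  "cexp2pi t = exp (2 * of_real pi * \<i> * t)"

lemma norm_cexp2pi: "norm (cexp2pi t) = exp (-2 * pi * Im t)"
  by (simp add: cexp2pi_def)

lemma cexp2pi_power: "cexp2pi t ^ n = cexp2pi (of_nat n * t)"
  by (simp add: cexp2pi_def mult_ac flip: exp_of_nat_mult)

lemma cexp2pi_add_of_int [simp]: "cexp2pi (t + of_int n) = cexp2pi t"
proof -
  have "exp (2 * of_int n * of_real pi * \<i> :: complex) = 1" by (auto simp: exp_eq_1 intro: exI[of _ n])
  thus ?thesis by (simp add: cexp2pi_def ring_distribs exp_add mult_ac)
qed

text \<open>Bridge between the cosecant sums, where the modular law is visible, and power series in
  the nome.\<close>

lemma pi_over_sin_squared:
  "(of_real pi / sin (of_real pi * t))\<^sup>2 = -4 * of_real pi ^ 2 * cexp2pi t / (1 - cexp2pi t)\<^sup>2"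
proof -
  define X where "X = exp (\<i> * (of_real pi * t))"
  have X0: "X \<noteq> 0" by (simp add: X_def)
  have u: "cexp2pi t = X\<^sup>2"
    by (simp add: X_def cexp2pi_def power2_eq_square mult_ac flip: exp_add)
  have "sin (of_real pi * t) = (X - inverse X) / (2 * \<i>)"
    by (simp add: sin_exp_eq X_def exp_minus)
  also have "\<dots> = - (1 - X\<^sup>2) / (2 * \<i> * X)"
    using X0 by (simp add: field_simps power2_eq_square)
  finally have "(of_real pi / sin (of_real pi * t))\<^sup>2 = (of_real pi * (2 * \<i> * X))\<^sup>2 / (1 - X\<^sup>2)\<^sup>2"
    by (simp add: power_divide power2_commute[of "X\<^sup>2" 1])
  also have "(of_real pi * (2 * \<i> * X))\<^sup>2 = -4 * of_real pi ^ 2 * X\<^sup>2"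
    by (simp add: power_mult_distrib)
  finally show ?thesis unfolding u .
qed

text \<open>Differentiating q^r / (r (1 - q^r)) in t gives 2 \<pi> i q^r / (1 - q^r)^2, a squared
  cosecant at r t. On the half-plane above height Im t / 2 the nome stays below a fixed \<rho> < 1,
  so a geometric majorant justifies termwise differentiation.\<close>

lemma has_field_derivative_euler_log:
  assumes t: "Im t > 0"
  shows "((\<lambda>t. euler_log 0 (cexp2pi t)) has_field_derivative (- \<i> / (2 * of_real pi) * csc2_sum t)) (at t)"
proof -
  define y0 where "y0 = Im t / 2"
  have y0: "y0 > 0" using t by (simp add: y0_def)
  define A where "A = {z. Im z > y0}"
  define \<rho> where "\<rho> = exp (-2 * pi * y0)"
  have \<rho>: "0 < \<rho>" "\<rho> < 1" using y0 by (auto simp: \<rho>_def)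
  define f where "f = (\<lambda>r t. cexp2pi t ^ (Suc 0 * Suc r) / (of_nat (Suc r) * (1 - cexp2pi t ^ Suc r)))"
  define f' where "f' = (\<lambda>r t. - \<i> / (2 * of_real pi) * (of_real pi / sin (of_real pi * (of_nat (Suc r) * t)))\<^sup>2)"
  have f'_eq: "f' r z = 2 * of_real pi * \<i> * cexp2pi z ^ Suc r / (1 - cexp2pi z ^ Suc r)\<^sup>2" for r z
    unfolding f'_def pi_over_sin_squared cexp2pi_power by (simp add: power2_eq_square)
  have A: "open A" "convex A" "t \<in> A"
    unfolding A_def using t by (simp_all add: open_halfspace_Im_gt convex_halfspace_Im_gt) (simp add: y0_def)
  have norm_A: "norm (cexp2pi z) \<le> \<rho>" if "z \<in> A" for z
    using that by (auto simp: norm_cexp2pi A_def \<rho>_def)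
  have "\<exists>g. \<forall>x\<in>A. (\<lambda>r. f r x) sums g x \<and> (g has_field_derivative (\<Sum>r. f' r x)) (at x within A)"
  proof (rule has_field_derivative_series[OF A(2)])
    fix r z assume z: "z \<in> A"
    define u where "u = (\<lambda>z. cexp2pi (of_nat (Suc r) * z))"
    have "1 - cexp2pi z ^ Suc r \<noteq> 0"
      using norm_one_minus_power_ge[of "cexp2pi z" "Suc r"] norm_A[OF z] \<rho> by auto
    hence nz: "1 - u z \<noteq> 0" by (simp only: u_def cexp2pi_power not_False_eq_True)
    have "(u has_field_derivative (2 * of_real pi * \<i> * of_nat (Suc r) * u z)) (at z within A)"
      unfolding u_def cexp2pi_def by (auto intro!: derivative_eq_intros)
    hence "((\<lambda>z. u z / (of_nat (Suc r) * (1 - u z))) has_field_derivative (2 * of_real pi * \<i> * u z / (1 - u z)\<^sup>2)) (at z within A)"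
      using nz by (auto intro!: derivative_eq_intros simp del: of_nat_Suc) (simp add: divide_simps power2_eq_square del: of_nat_Suc, simp add: algebra_simps del: of_nat_Suc)
    thus "(f r has_field_derivative f' r z) (at z within A)"
      unfolding f'_eq f_def by (simp only: u_def cexp2pi_power mult_1_left One_nat_def[symmetric])
  next
    show "uniform_limit A (\<lambda>n x. \<Sum>i<n. f' i x) (\<lambda>x. \<Sum>i. f' i x) sequentially"
    proof (rule Weierstrass_m_test)
      fix r z assume z: "z \<in> A"
      have "norm (f' r z) = 2 * pi * norm (cexp2pi z) ^ Suc r / norm (1 - cexp2pi z ^ Suc r) ^ 2"
        unfolding f'_eq by (simp add: norm_mult norm_divide norm_power)
      also have "\<dots> \<le> 2 * pi * \<rho> ^ Suc r / (1 - \<rho>) ^ 2"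
        using norm_one_minus_power_ge[of "cexp2pi z" "Suc r"] norm_A[OF z] \<rho>
        by (intro frac_le mult_left_mono power_mono) auto
      finally show "norm (f' r z) \<le> 2 * pi * \<rho> ^ Suc r / (1 - \<rho>) ^ 2" .
    next
      have "summable (\<lambda>r. 2 * pi * \<rho> / (1 - \<rho>) ^ 2 * \<rho> ^ r)"
        using \<rho> by (intro summable_mult summable_geometric) auto
      thus "summable (\<lambda>r. 2 * pi * \<rho> ^ Suc r / (1 - \<rho>) ^ 2)" by (simp add: mult_ac)
    qed
  next
    show "t \<in> A" by fact
    show "summable (\<lambda>r. f r t)"
      unfolding f_def by (rule summable_euler_log) (use norm_A[OF A(3)] \<rho> in linarith)
  qed
  then obtain g where g: "\<And>x. x \<in> A \<Longrightarrow> (\<lambda>r. f r x) sums g x" 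
      "\<And>x. x \<in> A \<Longrightarrow> (g has_field_derivative (\<Sum>r. f' r x)) (at x within A)" by blast
  have g_eq: "g x = euler_log 0 (cexp2pi x)" if "x \<in> A" for x
    using g(1)[OF that] by (simp add: euler_log_def f_def sums_iff)
  have "(\<Sum>r. f' r t) = - \<i> / (2 * of_real pi) * csc2_sum t"
    unfolding f'_def using csc2_sum_transformation(1)[OF t] by (intro sums_unique[symmetric] sums_mult)
  note eq = this
  have "(g has_field_derivative (- \<i> / (2 * of_real pi) * csc2_sum t)) (at t)"
    using g(2)[OF A(3)] unfolding at_within_open[OF A(3,1)] eq .
  thus ?thesis
    by (rule has_field_derivative_transform_within_open[OF _ A(1) A(3)]) (use g_eq in auto)
qed

text \<open>Equal to the product (q;q) inside the unit disc. As an exponential it is visibly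
  nonzero, which makes its quotients harmless.\<close>

definition euler_phi :: "complex \<Rightarrow> complex" where
  "euler_phi q = exp (- euler_log 0 q)"

text \<open>The eta inversion. Below, \<open>l\<close> is a logarithm of eta: the \<pi>i t/12 in it
  stands for q^(1/24) and accounts for the first exponential. By the law of \<open>csc2_sum\<close>,
  \<open>l (-1/t) - l t\<close> and half the logarithm of t/i have the same derivative, so they
  differ by a constant.\<close>

lemma euler_phi_inversion:
  assumes t: "Im t > 0"
  shows "euler_phi (cexp2pi (-1/t)) = exp (of_real pi * \<i> * (t + 1/t) / 12) * csqrt (t / \<i>) * euler_phi (cexp2pi t)"
proof -
  define H where "H = {t. Im t > 0}"
  define l where "l = (\<lambda>t. of_real pi * \<i> * t / 12 - euler_log 0 (cexp2pi t))"
  define l' where "l' = (\<lambda>t. of_real pi * \<i> / 12 + \<i> / (2 * of_real pi) * csc2_sum t)"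
  have l: "(l has_field_derivative l' t) (at t)" if "Im t > 0" for t
    unfolding l_def l'_def using that
    by (auto intro!: derivative_eq_intros has_field_derivative_euler_log)
  have inv: "Im (-1/t) > 0" if "Im t > 0" for t
    using that by (auto simp: Im_divide field_simps sum_power2_gt_zero_iff)
  have "\<exists>c. \<forall>t\<in>H. l (-1/t) - l t - Ln (t / \<i>) / 2 = c"
  proof (rule has_field_derivative_zero_constant)
    show "convex H" by (simp add: H_def convex_halfspace_Im_gt)
    fix t assume "t \<in> H"
    hence t: "Im t > 0" "t \<noteq> 0" by (auto simp: H_def)
    have "((\<lambda>t. l (-1/t)) has_field_derivative (l' (-1/t) * (1 / t\<^sup>2))) (at t)"
      using t by (intro DERIV_chain2[OF l] inv) (auto intro!: derivative_eq_intros simp: power2_eq_square)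
    moreover have "((\<lambda>t. Ln (t / \<i>) / 2) has_field_derivative (1 / (2 * t))) (at t)"
    proof -
      have "t / \<i> \<notin> \<real>\<^sub>\<le>\<^sub>0" using t by (auto simp: complex_nonpos_Reals_iff)
      thus ?thesis using t by (auto intro!: derivative_eq_intros simp: field_simps)
    qed
    ultimately have "((\<lambda>t. l (-1/t) - l t - Ln (t / \<i>) / 2) has_field_derivative (l' (-1/t) * (1 / t\<^sup>2) - l' t - 1 / (2 * t))) (at t)"
      using t by (intro DERIV_diff l)
    also have "l' (-1/t) * (1 / t\<^sup>2) - l' t - 1 / (2 * t) = 0"
      unfolding l'_def csc2_sum_transformation(2)[OF t(1)] using t by (simp add: field_simps power2_eq_square)
    finally show "((\<lambda>t. l (-1/t) - l t - Ln (t / \<i>) / 2) has_field_derivative 0) (at t within H)"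
      by (rule has_field_derivative_at_within)
  qed
  then obtain c where c: "\<And>t. Im t > 0 \<Longrightarrow> l (-1/t) - l t - Ln (t / \<i>) / 2 = c" by (auto simp: H_def)
  \<comment> \<open>The point i is fixed by t -> -1/t, and there Ln (t/i) = 0.\<close>
  have "c = 0" using c[of \<i>] by simp
  with c[OF t] have "l (-1/t) = l t + Ln (t / \<i>) / 2" by (simp add: algebra_simps)
  hence "- euler_log 0 (cexp2pi (-1/t)) = of_real pi * \<i> * (t + 1/t) / 12 + Ln (t / \<i>) / 2 + - euler_log 0 (cexp2pi t)"
    by (simp add: l_def algebra_simps add_divide_distrib)
  moreover have "t / \<i> \<noteq> 0" using t by auto
  ultimately show ?thesis
    unfolding euler_phi_def by (simp only: exp_add csqrt_exp_Ln not_False_eq_True)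
qed

subsection \<open>Dedekind sums\<close>

lemma dedekind_sum_altdef:
  "dedekind_sum h k = (\<Sum>r = 1..<k. real r / real k * (frac (real_of_int (h * int r) / real k) - 1 / 2))"
  by (simp add: dedekind_sum_def frac_def)

lemma dedekind_sum_periodic:
  assumes "[h = h'] (mod int k)"
  shows "dedekind_sum h k = dedekind_sum h' k"
proof (cases "k = 0")
  case False
  have "frac (real_of_int (h * int r) / real k) = frac (real_of_int (h' * int r) / real k)" for r
  proof -
    obtain m where "h = h' + int k * m" using assms
      by (metis cong_iff_lin cong_sym)
    hence "real_of_int (h * int r) / real k = real_of_int (h' * int r) / real k + of_int (m * int r)"
      using False by (simp add: field_simps)
    thus ?thesis by (simp only: frac_def floor_add_int[symmetric] of_int_add)
  qed
  thus ?thesis by (simp add: dedekind_sum_altdef)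
qed (simp add: dedekind_sum_def)

text \<open>Coprimality keeps h r / k away from the integers, so its fractional part x becomes 1 - x
  and x - 1/2 changes sign.\<close>

lemma dedekind_sum_minus:
  assumes "coprime h (int k)"
  shows "dedekind_sum (-h) k = - dedekind_sum h k"
proof -
  have "real r / real k * (frac (real_of_int (-h * int r) / real k) - 1 / 2) =
        - (real r / real k * (frac (real_of_int (h * int r) / real k) - 1 / 2))"
    if r: "r \<in> {1..<k}" for r
  proof -
    have "real_of_int (h * int r) / real k \<notin> \<int>"
    proof
      assume "real_of_int (h * int r) / real k \<in> \<int>"
      then obtain m where "real_of_int (h * int r) / real k = of_int m" by (auto elim: Ints_cases)
      hence "real_of_int (h * int r) = real_of_int (m * int k)" using r by (simp add: field_simps)
      hence "h * int r = m * int k" by linarith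
      hence "int k dvd h * int r" by simp
      hence "int k dvd int r" using assms by (simp add: coprime_dvd_mult_right_iff coprime_commute)
      thus False using r by (auto dest: zdvd_imp_le)
    qed
    moreover have "real_of_int (-h * int r) / real k = - (real_of_int (h * int r) / real k)" by simp
    ultimately have eq: "frac (real_of_int (-h * int r) / real k) = 1 - frac (real_of_int (h * int r) / real k)"
      by (simp only: frac_neg if_False)
    show ?thesis unfolding eq by (simp add: algebra_simps)
  qed
  thus ?thesis unfolding dedekind_sum_altdef by (subst sum_negf [symmetric], intro sum.cong) auto
qed

lemma sum_permute_residues:
  fixes f :: "nat \<Rightarrow> 'a :: comm_monoid_add"
  assumes "coprime h k"
  shows "(\<Sum>r = 1..<k. f (h * r mod k)) = (\<Sum>r = 1..<k. f r)"
proof (rule sum.reindex_bij_betw)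
  have sub: "(\<lambda>r. h * r mod k) ` {1..<k} \<subseteq> {1..<k}"
  proof safe
    fix r assume r: "r \<in> {1..<k}"
    have "\<not> k dvd h * r" using r assms
      by (simp add: coprime_dvd_mult_right_iff coprime_commute) (auto dest: dvd_imp_le)
    thus "h * r mod k \<in> {1..<k}" using r by (auto simp: Suc_le_eq mod_greater_zero_iff_not_dvd)
  qed
  have inj: "inj_on (\<lambda>r. h * r mod k) {1..<k}"
  proof (rule inj_onI)
    fix x y assume *: "x \<in> {1..<k}" "y \<in> {1..<k}" "h * x mod k = h * y mod k"
    hence "[x = y] (mod k)" using assms by (simp flip: cong_def add: cong_mult_lcancel_nat)
    thus "x = y" using * by (auto simp: cong_def)
  qed
  show "bij_betw (\<lambda>r. h * r mod k) {1..<k} {1..<k}"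
    unfolding bij_betw_def using inj endo_inj_surj[OF _ sub inj] by auto
qed

text \<open>Write m (m + 1) as the sum of 2 t over t <= m and exchange the sums. What remains is
  counting lattice points under a line; by coprimality none lies on the line, so each t is counted
  for exactly those r that exceed the quotient k t div h.\<close>

lemma sum_quotient_square:
  fixes h k :: nat
  assumes "coprime h k"
  shows "(\<Sum>r = 1..<k. (h * r div k) * (h * r div k + 1)) = (\<Sum>t = 1..<h. 2 * t * (k - 1 - k * t div h))"
proof -
  have eq: "(h * r div k) * (h * r div k + 1) = (\<Sum>t = 1..<h. if t \<le> h * r div k then 2 * t else 0)" if r: "r \<in> {1..<k}" for r
  proof -
    have "h > 0" using assms r by (cases "h = 0") auto
    hence "h * r div k < h" using r by (subst div_less_iff_less_mult) auto
    hence "{1..<h} \<inter> {t. t \<le> h * r div k} = {1..h * r div k}" by auto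
    hence "(\<Sum>t = 1..<h. if t \<le> h * r div k then 2 * t else 0) = (\<Sum>t = 1..h * r div k. 2 * t)"
      by (simp add: sum.If_cases)
    also have "(\<Sum>t = 1..n. 2 * t) = n * (n + 1)" for n :: nat
      by (induction n) auto
    finally show ?thesis by simp
  qed
  have "(\<Sum>r = 1..<k. (h * r div k) * (h * r div k + 1)) = (\<Sum>r = 1..<k. \<Sum>t = 1..<h. if t \<le> h * r div k then 2 * t else 0)"
    by (intro sum.cong eq refl)
  also have "\<dots> = (\<Sum>t = 1..<h. \<Sum>r = 1..<k. if t \<le> h * r div k then 2 * t else 0)"
    by (rule sum.swap)
  also have "\<dots> = (\<Sum>t = 1..<h. 2 * t * (k - 1 - k * t div h))"
  proof (intro sum.cong refl)
    fix t assume t: "t \<in> {1..<h}"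
    have "t \<le> h * r div k \<longleftrightarrow> k * t div h < r" if r: "r \<in> {1..<k}" for r
    proof -
      have "\<not> k dvd h * r" using r assms
        by (simp add: coprime_dvd_mult_right_iff coprime_commute) (auto dest: dvd_imp_le)
      hence "t * k \<noteq> h * r" by (metis dvd_triv_right)
      moreover have "t \<le> h * r div k \<longleftrightarrow> t * k \<le> h * r" using r by (simp add: less_eq_div_iff_mult_less_eq)
      moreover have "k * t div h < r \<longleftrightarrow> k * t < r * h" using t by (simp add: div_less_iff_less_mult)
      ultimately show ?thesis by (auto simp: mult.commute)
    qed
    hence "(\<Sum>r = 1..<k. if t \<le> h * r div k then 2 * t else 0) = (\<Sum>r = 1..<k. if k * t div h < r then 2 * t else 0)"
      by (intro sum.cong) auto
    also have "\<dots> = (\<Sum>r \<in> {r \<in> {1..<k}. k * t div h < r}. 2 * t)"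
      by (rule sum.inter_filter[symmetric]) auto
    also have "{r \<in> {1..<k}. k * t div h < r} = {k * t div h <..<k}" by auto
    finally show "(\<Sum>r = 1..<k. if t \<le> h * r div k then 2 * t else 0) = 2 * t * (k - 1 - k * t div h)"
      by (simp add: mult.commute)
  qed
  finally show ?thesis .
qed

text \<open>Multiplication by h permutes the nonzero residues mod k. Comparing the sums of residues
  and of their squares before and after gives \<open>e1\<close> for U and \<open>e2\<close> relating
  \<open>T h k\<close> to V; the lattice count \<open>e3\<close> ties V + U to \<open>T k h\<close>.
  Eliminating U and V leaves the reciprocity law.\<close>

theorem dedekind_sum_reciprocity:
  fixes h k :: nat
  assumes cop: "coprime h k" and h: "h > 0" and k: "k > 0"
  shows "dedekind_sum (int h) k + dedekind_sum (int k) h =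
           (real h / real k + real k / real h + 1 / (real h * real k)) / 12 - 1 / 4"
proof -
  define S1 where "S1 = (\<lambda>k. \<Sum>r = 1..<k. real r)"
  define S2 where "S2 = (\<lambda>k. \<Sum>r = 1..<k. (real r)\<^sup>2)"
  define T where "T = (\<lambda>h k. \<Sum>r = 1..<k. real r * real (h * r div k))"
  define U where "U = (\<Sum>r = 1..<k. real (h * r div k))"
  define V where "V = (\<Sum>r = 1..<k. (real (h * r div k))\<^sup>2)"
  have S1: "S1 k = real k * (real k - 1) / 2" if "k > 0" for k
    using that unfolding S1_def by (induction k rule: nat_induct_non_zero) (auto simp: field_simps)
  have S2: "S2 k = (real k - 1) * real k * (2 * real k - 1) / 6" if "k > 0" for k
    using that unfolding S2_def by (induction k rule: nat_induct_non_zero) (auto simp: field_simps power2_eq_square)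
  have s: "dedekind_sum (int h) k = real h * S2 k / (real k)\<^sup>2 - T h k / real k - S1 k / (2 * real k)" if "k > 0" for h k
  proof -
    have "dedekind_sum (int h) k = (\<Sum>r = 1..<k. real h / (real k)\<^sup>2 * (real r)\<^sup>2 - real r * real (h * r div k) / real k - real r / (2 * real k))"
      unfolding dedekind_sum_def
    proof (intro sum.cong refl)
      fix r
      have "\<lfloor>real_of_int (int h * int r) / real k\<rfloor> = int (h * r div k)"
        using floor_divide_of_nat_eq[of "h * r" k, where 'a = real] by simp
      thus "real r / real k * (real_of_int (int h * int r) / real k - real_of_int \<lfloor>real_of_int (int h * int r) / real k\<rfloor> - 1 / 2) =
        real h / (real k)\<^sup>2 * (real r)\<^sup>2 - real r * real (h * r div k) / real k - real r / (2 * real k)"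
        using that by (simp add: field_simps power2_eq_square)
    qed
    thus ?thesis
      by (simp add: sum_subtractf S1_def S2_def T_def sum_divide_distrib sum_distrib_left sum_distrib_right)
  qed
  have fl: "real (h * r mod k) = real h * real r - real k * real (h * r div k)" for r
    by (metis add_diff_cancel_left' mult_div_mod_eq of_nat_add of_nat_mult)
  have e1: "real h * S1 k - real k * U = S1 k"
  proof -
    have "(\<Sum>r = 1..<k. real (h * r mod k)) = S1 k"
      unfolding S1_def by (rule sum_permute_residues[OF cop])
    thus ?thesis unfolding fl by (simp add: sum_subtractf S1_def U_def sum_distrib_left)
  qed
  have e2: "(real h)\<^sup>2 * S2 k - 2 * real h * real k * T h k + (real k)\<^sup>2 * V = S2 k"
  proof -
    have "(\<Sum>r = 1..<k. (real (h * r mod k))\<^sup>2) = S2 k"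
      unfolding S2_def by (rule sum_permute_residues[OF cop])
    also have "(\<Sum>r = 1..<k. (real (h * r mod k))\<^sup>2) = 
        (\<Sum>r = 1..<k. (real h)\<^sup>2 * (real r)\<^sup>2 - 2 * real h * real k * (real r * real (h * r div k)) + (real k)\<^sup>2 * (real (h * r div k))\<^sup>2)"
      unfolding fl by (intro sum.cong refl) (simp add: power2_eq_square algebra_simps)
    also have "\<dots> = (real h)\<^sup>2 * S2 k - 2 * real h * real k * T h k + (real k)\<^sup>2 * V"
      by (simp add: sum.distrib sum_subtractf S2_def T_def V_def sum_distrib_left)
    finally show ?thesis .
  qed
  have e3: "V + U = (real k - 1) * real h * (real h - 1) - 2 * T k h"
  proof -
    have "V + U = real (\<Sum>r = 1..<k. (h * r div k) * (h * r div k + 1))"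
      by (simp add: V_def U_def power2_eq_square algebra_simps sum.distrib)
    also have "\<dots> = real (\<Sum>t = 1..<h. 2 * t * (k - 1 - k * t div h))"
      by (subst sum_quotient_square[OF cop]) auto
    also have "\<dots> = (\<Sum>t = 1..<h. 2 * (real k - 1) * real t - 2 * (real t * real (k * t div h)))"
      unfolding of_nat_sum
    proof (intro sum.cong refl)
      fix t assume t: "t \<in> {1..<h}"
      have "k * t div h < k" using t k by (simp add: div_less_iff_less_mult)
      hence "real (k - 1 - k * t div h) = real k - 1 - real (k * t div h)" by (simp add: of_nat_diff)
      moreover have "real (2 * t * X) = 2 * real t * real X" for X by simp
      ultimately show "real (2 * t * (k - 1 - k * t div h)) = 2 * (real k - 1) * real t - 2 * (real t * real (k * t div h))"
        by (simp only:) (simp add: algebra_simps)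
    qed
    also have "\<dots> = 2 * (real k - 1) * S1 h - 2 * T k h"
      by (simp add: sum_subtractf S1_def T_def sum_distrib_left)
    finally show ?thesis unfolding S1[OF h] by (simp add: algebra_simps)
  qed
  define H K where "H = real h" and "K = real k"
  have pos: "H > 0" "K > 0" using h k by (auto simp: H_def K_def)
  have U: "U = (H - 1) * (K - 1) / 2"
  proof -
    have "K * U = H * S1 k - S1 k" using e1 by (simp add: H_def K_def)
    also have "\<dots> = K * ((H - 1) * (K - 1) / 2)"
      unfolding S1[OF k] by (simp add: H_def K_def field_simps)
    finally show ?thesis using pos by simp
  qed
  have V: "V = (K - 1) * H * (H - 1) - 2 * T k h - (H - 1) * (K - 1) / 2"
    using e3 unfolding U by (simp add: H_def[symmetric] K_def[symmetric])
  have T: "T h k / K = (H\<^sup>2 * S2 k - S2 k + K\<^sup>2 * V) / (2 * H * K\<^sup>2)"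
    using e2 pos by (simp add: H_def[symmetric] K_def[symmetric] field_simps power2_eq_square)
  show ?thesis
    unfolding s[OF k] s[OF h] H_def[symmetric] K_def[symmetric] T unfolding V S1[OF k] S1[OF h] S2[OF k] S2[OF h] 
      H_def[symmetric] K_def[symmetric]
    using pos by (simp add: field_simps power2_eq_square)
qed

subsection \<open>Modular transformations\<close>

text \<open>All three arguments lie strictly between -\<pi>/2 and \<pi>/2, so the two logarithms
  being compared differ in imaginary part by less than 2 \<pi> and no sign ambiguity remains. The
  last factor is the square root of 1/i.\<close>

lemma csqrt_mult_csqrt_of_Re_pos:
  assumes "Re a > 0" "Re b > 0" "Re c > 0" "a * b = c / \<i>"
  shows "csqrt a * csqrt b = csqrt c * exp (- of_real pi * \<i> / 4)"
proof -
  have nz: "a \<noteq> 0" "b \<noteq> 0" "c \<noteq> 0" using assms by auto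
  have "Ln a + Ln b = Ln c - of_real pi * \<i> / 2"
  proof (rule exp_complex_eqI)
    have "\<bar>Im (Ln a)\<bar> < pi/2" "\<bar>Im (Ln b)\<bar> < pi/2" "\<bar>Im (Ln c)\<bar> < pi/2"
      by (rule Re_Ln_pos_lt_imp, fact)+
    thus "\<bar>Im (Ln a + Ln b) - Im (Ln c - of_real pi * \<i> / 2)\<bar> < 2 * pi"
      by (simp add: abs_if split: if_splits)
    have "exp (of_real pi * \<i> / 2) = \<i>"
      using exp_pi_i' by (simp add: exp_eq_polar cis_conv_exp[symmetric] mult_ac)
    thus "exp (Ln a + Ln b) = exp (Ln c - of_real pi * \<i> / 2)"
      using nz assms(4) by (simp add: exp_add exp_diff)
  qed
  hence "(Ln a + Ln b) / 2 = (Ln c - of_real pi * \<i> / 2) / 2" by simp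
  hence "Ln a / 2 + Ln b / 2 = Ln c / 2 + - of_real pi * \<i> / 4"
    by (simp add: add_divide_distrib diff_divide_distrib)
  hence "exp (Ln a / 2) * exp (Ln b / 2) = exp (Ln c / 2) * exp (- of_real pi * \<i> / 4)"
    by (simp only: exp_add[symmetric])
  thus ?thesis using nz by (simp add: csqrt_exp_Ln)
qed

text \<open>The modulus of the transformed argument does not involve the real part H, so it
  suffices to know that some H exists.\<close>

lemma euler_phi_transformation:
  fixes k :: nat and h :: int and v :: complex
  assumes "k > 0" "coprime h (int k)" "Re v > 0"
  shows "\<exists>H::real. euler_phi (cexp2pi (of_real H + \<i> / (of_nat k ^ 2 * v))) =
           exp (of_real pi * \<i> * of_real (dedekind_sum h k)) * csqrt (of_nat k * v) *
           exp (of_real pi / (12 * of_nat k ^ 2 * v) - of_real pi * v / 12) *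
           euler_phi (cexp2pi (of_real (of_int h / of_nat k) + \<i> * v))"
  using assms
proof (induction k arbitrary: h v rule: less_induct)
  case (less k h v)
  \<comment> \<open>Reduction mod k changes neither the Dedekind sum nor the nome. The residue is
    smaller than k and becomes the next denominator, as in Euclid's algorithm.\<close>
  define h0 where "h0 = nat (h mod int k)"
  have h0: "int h0 = h mod int k" "h0 < k" using less.prems by (auto simp: h0_def nat_less_iff)
  have s: "dedekind_sum h k = dedekind_sum (int h0) k"
    by (rule dedekind_sum_periodic) (simp add: h0 cong_def)
  have cop: "coprime h0 k"
    using less.prems(2) h0(1) by (metis coprime_int_iff coprime_mod_left_iff less.prems(1) of_nat_0 of_nat_eq_iff not_gr_zero)
  define t where "t = of_real (of_nat h0 / of_nat k) + \<i> * v"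
  have q: "cexp2pi (of_real (of_int h / of_nat k) + \<i> * v) = cexp2pi t"
  proof -
    have "real_of_int h = real_of_int (int h0 + int k * (h div int k))"
      unfolding h0(1) by simp
    hence "real_of_int h / real k = real h0 / real k + of_int (h div int k)"
      using less.prems(1) by (simp add: field_simps)
    hence "of_real (of_int h / of_nat k) + \<i> * v = t + of_int (h div int k)"
      by (simp only: t_def of_real_add of_real_of_int_eq) simp
    thus ?thesis by (simp only: cexp2pi_add_of_int)
  qed
  have t: "Im t > 0" "t \<noteq> 0" "v \<noteq> 0" using less.prems(3) by (auto simp: t_def complex_eq_iff)
  have inv: "euler_phi (cexp2pi (-1/t)) = exp (of_real pi * \<i> * (t + 1/t) / 12) * csqrt (t / \<i>) * euler_phi (cexp2pi t)"
    by (rule euler_phi_inversion[OF t(1)])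
  show ?case
  proof (cases "k = 1")
    case True
    hence [simp]: "h0 = 0" using h0 by simp
    have tv: "-1/t = of_real 0 + \<i> / (of_nat k ^ 2 * v)" "t / \<i> = of_nat k * v"
      "of_real pi * \<i> * (t + 1/t) / 12 = of_real pi / (12 * of_nat k ^ 2 * v) - of_real pi * v / 12"
      using t by (auto simp: t_def True field_simps)
    show ?thesis
      using inv unfolding tv q s by (intro exI[of _ 0]) (simp add: True dedekind_sum_def mult_ac)
  next
    case False
    have h0_pos: "h0 > 0" using cop False less.prems(1) by (cases "h0 = 0") auto
    \<comment> \<open>Chosen so that -1/t = -k/h0 + i \<open>v'\<close>: inversion moves the cusp
      h0/k to -k/h0, where the induction hypothesis applies.\<close>
    define v' where "v' = of_nat k * v / (of_nat h0 * t)"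
    have v'_Re: "Re v' > 0"
    proof -
      have "v' = of_real (real k / real h0) * (v / t)" by (simp add: v'_def)
      also have "Re \<dots> = real k / real h0 * Re (v / t)" by (simp only: times_complex.sel Re_complex_of_real Im_complex_of_real mult_zero_left diff_zero)
      also have "Re (v / t) = Re v * (real h0 / real k) / (norm t)\<^sup>2"
      proof -
        have parts: "Re t = real h0 / real k - Im v" "Im t = Re v" by (simp_all add: t_def)
        have "Re v * (real h0 / real k - Im v) + Im v * Re v = Re v * (real h0 / real k)"
          by (simp add: algebra_simps)
        thus ?thesis by (simp only: Re_divide cmod_power2 parts)
      qed
      also have "real k / real h0 * \<dots> > 0"
        using h0_pos less.prems t by (intro mult_pos_pos divide_pos_pos) auto
      finally show ?thesis .
    qed
    have cop': "coprime (- int k) (int h0)" using cop by (simp add: coprime_commute)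
    from less.IH[OF h0(2) h0_pos cop' v'_Re] obtain H where H:
      "euler_phi (cexp2pi (of_real H + \<i> / (of_nat h0 ^ 2 * v'))) =
           exp (of_real pi * \<i> * of_real (dedekind_sum (- int k) h0)) * csqrt (of_nat h0 * v') *
           exp (of_real pi / (12 * of_nat h0 ^ 2 * v') - of_real pi * v' / 12) *
           euler_phi (cexp2pi (of_real (of_int (- int k) / of_nat h0) + \<i> * v'))" by blast
    have nz: "of_nat k \<noteq> (0::complex)" "of_nat h0 \<noteq> (0::complex)" using h0_pos less.prems by auto
    have ht: "of_nat k * t = of_nat h0 + \<i> * of_nat k * v"
      using nz by (simp add: t_def field_simps)
    have iv': "\<i> * v' = -1/t + of_nat k / of_nat h0"
    proof -
      have "\<i> * v' = (of_nat k * t - of_nat h0) / (of_nat h0 * t)" unfolding ht by (simp add: v'_def)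
      thus ?thesis using nz t by (simp add: field_simps)
    qed
    have q1: "of_real (of_int (- int k) / of_nat h0) + \<i> * v' = -1/t"
      unfolding iv' by simp
    have q2: "1 / (of_nat h0 ^ 2 * v') = 1 / (of_nat k ^ 2 * v) + \<i> / (of_nat h0 * of_nat k)"
    proof -
      have "1 / (of_nat h0 ^ 2 * v') = of_nat k * t / (of_nat h0 * of_nat k ^ 2 * v)"
        using nz t by (simp add: v'_def field_simps power2_eq_square)
      also have "\<dots> = 1 / (of_nat k ^ 2 * v) + \<i> / (of_nat h0 * of_nat k)"
        unfolding ht using nz t by (simp add: field_simps power2_eq_square)
      finally show ?thesis .
    qed
    have q3: "of_real H + \<i> / (of_nat h0 ^ 2 * v') = of_real (H - 1 / (real h0 * real k)) + \<i> / (of_nat k ^ 2 * v)"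
    proof -
      have "\<i> / (of_nat h0 ^ 2 * v') = \<i> * (1 / (of_nat h0 ^ 2 * v'))" by simp
      also have "\<dots> = \<i> / (of_nat k ^ 2 * v) - 1 / (of_nat h0 * of_nat k)"
        unfolding q2 by (simp add: distrib_left)
      finally show ?thesis by simp
    qed
    have cs: "csqrt (t / \<i>) * csqrt (of_nat h0 * v') = csqrt (of_nat k * v) * exp (- of_real pi * \<i> / 4)"
    proof (rule csqrt_mult_csqrt_of_Re_pos)
      show "Re (t / \<i>) > 0" using t by simp
      show "Re (of_nat h0 * v') > 0" "Re (of_nat k * v) > 0" using v'_Re h0_pos less.prems by auto
      show "t / \<i> * (of_nat h0 * v') = of_nat k * v / \<i>" using nz t by (simp add: v'_def)
    qed
    define S where "S = dedekind_sum (int h0) k"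
    have rec: "dedekind_sum (- int k) h0 = S - ((real h0 / real k + real k / real h0 + 1 / (real h0 * real k)) / 12 - 1 / 4)"
      using dedekind_sum_reciprocity[OF cop h0_pos less.prems(1)] cop 
      by (subst dedekind_sum_minus) (auto simp: S_def coprime_commute)
    have v'2: "- of_real pi * v' / 12 = of_real pi * \<i> * (-1/t + of_nat k / of_nat h0) / 12"
      unfolding iv'[symmetric] by (simp add: mult.assoc)
    have v2: "- of_real pi * v / 12 = of_real pi * \<i> * (t - of_nat h0 / of_nat k) / 12"
      by (simp add: t_def mult.assoc)
    have p2: "of_real pi / (12 * of_nat h0 ^ 2 * v') = of_real pi / 12 * (1 / (of_nat k ^ 2 * v) + \<i> / (of_nat h0 * of_nat k))"
      unfolding q2[symmetric] by (simp add: mult.assoc)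
    have p3: "of_real pi / (12 * of_nat k ^ 2 * v) = of_real pi / 12 * (1 / (of_nat k ^ 2 * v))"
      by (simp add: mult.assoc)
    \<comment> \<open>Exact cancellation with reciprocity: the terms h0/k, k/h0 and 1/(h0 k) match
      the imaginary parts split off in \<open>v2\<close>, \<open>v'2\<close> and \<open>p2\<close>,
      and the 1/4 matches the phase of the two square roots.\<close>
    have expo: "of_real pi * \<i> * of_real (dedekind_sum (- int k) h0) + (of_real pi / (12 * of_nat h0 ^ 2 * v') - of_real pi * v' / 12)
         + of_real pi * \<i> * (t + 1/t) / 12 + - of_real pi * \<i> / 4
      = of_real pi * \<i> * of_real S + (of_real pi / (12 * of_nat k ^ 2 * v) - of_real pi * v / 12)"
    proof -
      have "of_real pi / (12 * of_nat h0 ^ 2 * v') - of_real pi * v' / 12 = of_real pi / (12 * of_nat h0 ^ 2 * v') + - of_real pi * v' / 12"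
           "of_real pi / (12 * of_nat k ^ 2 * v) - of_real pi * v / 12 = of_real pi / (12 * of_nat k ^ 2 * v) + - of_real pi * v / 12" by simp_all
      note * = this
      show ?thesis unfolding * unfolding rec v'2 v2 p2 p3
        by (simp add: algebra_simps add_divide_distrib diff_divide_distrib)
    qed
    have "exp (of_real pi * \<i> * of_real (dedekind_sum (- int k) h0)) * csqrt (of_nat h0 * v') *
           exp (of_real pi / (12 * of_nat h0 ^ 2 * v') - of_real pi * v' / 12) *
           (exp (of_real pi * \<i> * (t + 1/t) / 12) * csqrt (t / \<i>) * euler_phi (cexp2pi t)) =
        (csqrt (t / \<i>) * csqrt (of_nat h0 * v')) * (exp (of_real pi * \<i> * of_real (dedekind_sum (- int k) h0)) *
          exp (of_real pi / (12 * of_nat h0 ^ 2 * v') - of_real pi * v' / 12) * exp (of_real pi * \<i> * (t + 1/t) / 12)) * euler_phi (cexp2pi t)"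
      by (simp only: mult_ac)
    also have "\<dots> = csqrt (of_nat k * v) * (exp (of_real pi * \<i> * of_real (dedekind_sum (- int k) h0)) *
          exp (of_real pi / (12 * of_nat h0 ^ 2 * v') - of_real pi * v' / 12) * exp (of_real pi * \<i> * (t + 1/t) / 12) * exp (- of_real pi * \<i> / 4)) * euler_phi (cexp2pi t)"
      unfolding cs by (simp only: mult_ac)
    also have "\<dots> = csqrt (of_nat k * v) * exp (of_real pi * \<i> * of_real S + (of_real pi / (12 * of_nat k ^ 2 * v) - of_real pi * v / 12)) * euler_phi (cexp2pi t)"
      by (simp only: exp_add[symmetric] expo)
    finally show ?thesis
      using H unfolding q3 q1 inv q s S_def[symmetric]
      by (intro exI[of _ "H - 1 / (real h0 * real k)"]) (simp only: exp_add mult_ac)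
  qed
qed

section \<open>The generating function near a cusp\<close>

lemma norm_exp_minus_one_le: "norm (exp z - 1 :: complex) \<le> norm z * exp (norm z)"
proof -
  have "norm (exp z - exp 0) \<le> exp (norm z) * norm (z - 0)"
  proof (rule field_differentiable_bound[where S = "cball 0 (norm z)"])
    show "(exp has_field_derivative exp w) (at w within cball 0 (norm z))" for w :: complex
      by (auto intro!: derivative_eq_intros)
    show "norm (exp w) \<le> exp (norm z)" if "w \<in> cball 0 (norm z)" for w :: complex
      using that complex_Re_le_cmod[of w] by simp
  qed auto
  thus ?thesis by (simp add: mult.commute)
qed

text \<open>From (-q;q) = (q^2;q^2)/(q;q) and the same identity with q^2 for q, after which one
  factor (q^2;q^2) cancels.\<close>

definition cubic_over_gf :: "complex \<Rightarrow> complex" where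
  "cubic_over_gf q = euler_phi (q ^ 4) / (euler_phi q ^ 2 * euler_phi (q ^ 2))"

lemma csqrt_nat_mult:
  assumes "Re w > 0"
  shows "csqrt (of_nat n * w) = of_real (sqrt (real n)) * csqrt w"
proof (cases "n = 0")
  case False
  have "csqrt (of_nat n * w) = csqrt (of_nat n) * csqrt w"
    using False Arg_bounded[of w] Arg_of_real[of "real n"] by (intro csqrt_mult) auto
  thus ?thesis using csqrt_of_real[of "real n"] by simp
qed auto

text \<open>Keeps the transformed nomes at modulus at most 1/2, away from the unit circle.\<close>

lemma exp_minus_quarter_pi_le: "exp (- pi / 4) \<le> (1/2 :: real)"
proof -
  have "2 \<le> 1 + 3/4 + (3/4)\<^sup>2 / (2::real)" by (simp add: power2_eq_square)
  also have "\<dots> \<le> exp (3/4)" by (rule exp_lower_Taylor_quadratic) auto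
  also have "\<dots> \<le> exp (pi / 4)" using pi_gt3 by simp
  finally show ?thesis by (simp add: exp_minus field_simps)
qed

text \<open>Here h2/k2 and h4/k4 are 2h/k and 4h/k in lowest terms, so that one lemma serves every
  class of k mod 4. Each phi carries one factor \<open>csqrt w\<close> in its denominator, and three
  denominators against one numerator leave w itself. The linear terms in the exponents have weights
  2 * 1 + 2 - 4 = 0, so only the terms in 1/w survive. Q collects the values of phi at the
  transformed nomes.\<close>

lemma cubic_over_gf_near_cusp:
  fixes h k h2 k2 h4 k4 :: nat and w :: complex
  assumes k: "k > 0" "k2 > 0" "k4 > 0" "k2 \<le> k" "k4 \<le> k"
    and cop: "coprime h k" "coprime h2 k2" "coprime h4 k4"
    and eq: "2 * h * k2 = h2 * k" "4 * h * k4 = h4 * k"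
    and w: "Re w > 0" "Re (1 / w) \<ge> real k ^ 2 / 2"
  shows "\<exists>Q. cubic_over_gf (cexp2pi (of_real (real h / real k) + \<i> * w)) =
     exp (of_real pi * \<i> * of_real (2 * dedekind_sum (int h) k + dedekind_sum (int h2) k2 - dedekind_sum (int h4) k4)) *
     of_real (real k * sqrt (real k2 / (2 * real k4))) * w *
     exp (of_real (pi / 12 * (2 / real k ^ 2 + 1 / (2 * real k2 ^ 2) - 1 / (4 * real k4 ^ 2))) / w) * Q \<and>
     norm (Q - 1) \<le> 16 * exp 8 * exp (- pi / (2 * real k ^ 2) * Re (1 / w))"
proof -
  \<comment> \<open>A common bound for the three transformed nomes exp(-2 \<pi> Re(1/w) / (k'^2 m)),
    using k' <= k and m <= 4.\<close>
  define y where "y = exp (- pi / (2 * real k ^ 2) * Re (1 / w))"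
  have y: "0 < y" "y \<le> 1/2"
  proof -
    have "y \<le> exp (- pi / (2 * real k ^ 2) * (real k ^ 2 / 2))"
      unfolding y_def exp_le_cancel_iff using w k by (intro mult_left_mono_neg) auto
    also have "\<dots> = exp (- pi / 4)" using k by simp
    finally show "y \<le> 1/2" using exp_minus_quarter_pi_le by linarith
  qed (simp add: y_def)
  have tr: "\<exists>L. euler_phi (cexp2pi (of_nat m * (of_real (real h / real k) + \<i> * w))) =
      exp L / (exp (of_real pi * \<i> * of_real (dedekind_sum (int h') k')) * of_real (sqrt (real (k' * m))) * csqrt w *
           exp (of_real (pi / (12 * real k' ^ 2 * real m)) / w - of_real (pi * real m / 12) * w)) \<and> norm L \<le> 4 * y"
    if m: "m > 0" "k' > 0" "k' \<le> k" "m \<le> 4" "coprime h' k'" "m * h * k' = h' * k" for m h' k'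
  proof -
    have "Re (of_nat m * w) > 0" using m w by simp
    from euler_phi_transformation[of k' "int h'", OF m(2) _ this] m(5) obtain H where H:
      "euler_phi (cexp2pi (of_real H + \<i> / (of_nat k' ^ 2 * (of_nat m * w)))) =
           exp (of_real pi * \<i> * of_real (dedekind_sum (int h') k')) * csqrt (of_nat k' * (of_nat m * w)) *
           exp (of_real pi / (12 * of_nat k' ^ 2 * (of_nat m * w)) - of_real pi * (of_nat m * w) / 12) *
           euler_phi (cexp2pi (of_real (of_int (int h') / of_nat k') + \<i> * (of_nat m * w)))" by auto
    define u where "u = cexp2pi (of_real H + \<i> / (of_nat k' ^ 2 * (of_nat m * w)))"
    have "real m * real h * real k' = real h' * real k" using m(6) by (metis of_nat_mult)
    hence "real h' / real k' = real m * (real h / real k)"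
      using m k by (simp add: field_simps)
    hence arg: "of_real (of_int (int h') / of_nat k') + \<i> * (of_nat m * w) = of_nat m * (of_real (real h / real k) + \<i> * w)"
      by (simp add: algebra_simps)
    have sq: "csqrt (of_nat k' * (of_nat m * w)) = of_real (sqrt (real (k' * m))) * csqrt w"
      using csqrt_nat_mult[OF w(1), of "k' * m"] by (simp add: mult.assoc)
    have w0: "w \<noteq> 0" using w by auto
    have ex: "of_real pi / (12 * of_nat k' ^ 2 * (of_nat m * w)) - of_real pi * (of_nat m * w) / 12 =
       of_real (pi / (12 * real k' ^ 2 * real m)) / w - of_real (pi * real m / 12) * w"
      by (simp add: mult.assoc)
    have "norm u = exp (-2 * pi * Re (1 / w) / (real k' ^ 2 * real m))"
    proof -
      have "\<i> / (of_nat k' ^ 2 * (of_nat m * w)) = of_real (1 / (real k' ^ 2 * real m)) * (\<i> * (1 / w))" by simp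
      also have "Im \<dots> = 1 / (real k' ^ 2 * real m) * Re (1 / w)" by (simp only: times_complex.sel Re_complex_of_real Im_complex_of_real imaginary_unit.sel mult_zero_left mult_1_left add_0_left add_0_right)
      finally show ?thesis by (simp add: u_def norm_cexp2pi)
    qed
    also have "\<dots> \<le> y"
    proof -
      have "real k' ^ 2 * real m \<le> real k ^ 2 * 4"
        using m by (intro mult_mono power_mono) auto
      moreover have "Re (1 / w) \<ge> 0" using w(2) by (meson order.trans zero_le_power2 divide_nonneg_pos zero_less_numeral)
      ultimately have "2 * pi * Re (1 / w) / (real k ^ 2 * 4) \<le> 2 * pi * Re (1 / w) / (real k' ^ 2 * real m)"
        using m k by (intro divide_left_mono mult_pos_pos mult_nonneg_nonneg) auto
      thus ?thesis by (simp add: y_def field_simps)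
    qed
    finally have u: "norm u \<le> y" .
    have "norm (euler_log 0 u) \<le> norm u ^ Suc 0 / (1 - norm u) ^ 2"
      using u y by (intro norm_euler_log_le) auto
    also have "\<dots> \<le> y ^ Suc 0 / (1/2) ^ 2"
      using u y by (intro frac_le power_mono) auto
    finally have L: "norm (- euler_log 0 u) \<le> 4 * y" by (simp add: power2_eq_square)
    have "exp (- euler_log 0 u) = exp (of_real pi * \<i> * of_real (dedekind_sum (int h') k')) * of_real (sqrt (real (k' * m))) * csqrt w *
           exp (of_real (pi / (12 * real k' ^ 2 * real m)) / w - of_real (pi * real m / 12) * w) * 
           euler_phi (cexp2pi (of_nat m * (of_real (real h / real k) + \<i> * w)))"
      using H unfolding u_def[symmetric] arg sq ex by (simp only: euler_phi_def mult.assoc)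
    moreover have "exp (of_real pi * \<i> * of_real (dedekind_sum (int h') k')) * of_real (sqrt (real (k' * m))) * csqrt w *
           exp (of_real (pi / (12 * real k' ^ 2 * real m)) / w - of_real (pi * real m / 12) * w) \<noteq> 0"
      using w0 m by simp
    ultimately show ?thesis using L
      by (intro exI[of _ "- euler_log 0 u"] conjI) (simp only: nonzero_mult_div_cancel_left not_False_eq_True)
  qed
  have w0: "w \<noteq> 0" using w by auto
  define t where "t = of_real (real h / real k) + \<i> * w"
  obtain L1 where L1: "euler_phi (cexp2pi t) = exp L1 / (exp (of_real pi * \<i> * of_real (dedekind_sum (int h) k)) * of_real (sqrt (real k)) * csqrt w *
           exp (of_real (pi / (12 * real k ^ 2)) / w - of_real (pi / 12) * w))" "norm L1 \<le> 4 * y"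
    using tr[of 1 k h] k cop by (auto simp: t_def)
  obtain L2 where L2: "euler_phi (cexp2pi t ^ 2) = exp L2 / (exp (of_real pi * \<i> * of_real (dedekind_sum (int h2) k2)) * of_real (sqrt (real (k2 * 2))) * csqrt w *
           exp (of_real (pi / (12 * real k2 ^ 2 * 2)) / w - of_real (pi * 2 / 12) * w))" "norm L2 \<le> 4 * y"
    using tr[of 2 k2 h2] k cop eq unfolding cexp2pi_power t_def by auto
  obtain L4 where L4: "euler_phi (cexp2pi t ^ 4) = exp L4 / (exp (of_real pi * \<i> * of_real (dedekind_sum (int h4) k4)) * of_real (sqrt (real (k4 * 4))) * csqrt w *
           exp (of_real (pi / (12 * real k4 ^ 2 * 4)) / w - of_real (pi * 4 / 12) * w))" "norm L4 \<le> 4 * y"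
    using tr[of 4 k4 h4] k cop eq unfolding cexp2pi_power t_def by auto
  define Q where "Q = exp (L4 - 2 * L1 - L2)"
  have "norm (L4 - 2 * L1 - L2) \<le> norm L4 + norm (2 * L1) + norm L2"
    by (intro order.trans[OF norm_triangle_ineq4] add_mono order.refl)
  \<comment> \<open>16 = 4 + 2 * 4 + 4, one summand for each phi. Since y <= 1/2, the exponential of
    this bound is at most exp 8.\<close>
  also have "\<dots> \<le> 16 * y" using L1(2) L2(2) L4(2) by (simp add: norm_mult)
  finally have nL: "norm (L4 - 2 * L1 - L2) \<le> 16 * y" .
  have "norm (Q - 1) \<le> norm (L4 - 2 * L1 - L2) * exp (norm (L4 - 2 * L1 - L2))"
    unfolding Q_def by (rule norm_exp_minus_one_le)
  also have "\<dots> \<le> (16 * y) * exp 8"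
    using nL y by (intro mult_mono) auto
  finally have nQ: "norm (Q - 1) \<le> 16 * exp 8 * y" by (simp add: mult_ac)
  define s1 s2 s4 where "s1 = of_real pi * \<i> * of_real (dedekind_sum (int h) k)" and "s2 = of_real pi * \<i> * of_real (dedekind_sum (int h2) k2)"
     and "s4 = of_real pi * \<i> * of_real (dedekind_sum (int h4) k4)"
  define e1 e2 e4 where "e1 = of_real (pi / (12 * real k ^ 2)) / w - of_real (pi / 12) * w" and
    "e2 = of_real (pi / (12 * real k2 ^ 2 * 2)) / w - of_real (pi * 2 / 12) * w" and
    "e4 = of_real (pi / (12 * real k4 ^ 2 * 4)) / w - of_real (pi * 4 / 12) * w"
  define r1 r2 r4 :: complex where "r1 = of_real (sqrt (real k))" and "r2 = of_real (sqrt (real (k2 * 2)))" and "r4 = of_real (sqrt (real (k4 * 4)))"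
  have r0: "r1 \<noteq> 0" "r2 \<noteq> 0" "r4 \<noteq> 0" using k by (auto simp: r1_def r2_def r4_def)
  define W where "W = csqrt w"
  have W: "W \<noteq> 0" "W\<^sup>2 = w" using w0 by (auto simp: W_def)
  have "cubic_over_gf (cexp2pi t) = (exp L4 / (exp s4 * r4 * W * exp e4)) / ((exp L1 / (exp s1 * r1 * W * exp e1))\<^sup>2 * (exp L2 / (exp s2 * r2 * W * exp e2)))"
    unfolding cubic_over_gf_def L1(1) L2(1) L4(1) s1_def s2_def s4_def e1_def e2_def e4_def r1_def r2_def r4_def W_def ..
  also have "\<dots> = (exp s1 ^ 2 * exp s2 / exp s4) * (r1\<^sup>2 * r2 / r4) * W\<^sup>2 * (exp e1 ^ 2 * exp e2 / exp e4) * (exp L4 / (exp L1 ^ 2 * exp L2))"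
    using r0 W(1) by (simp add: power2_eq_square mult_ac)
  also have "exp s1 ^ 2 * exp s2 / exp s4 = exp (2 * s1 + s2 - s4)"
    by (simp add: exp_diff exp_add exp_double)
  also have "exp e1 ^ 2 * exp e2 / exp e4 = exp (2 * e1 + e2 - e4)"
    by (simp add: exp_diff exp_add exp_double)
  also have "exp L4 / (exp L1 ^ 2 * exp L2) = Q"
    by (simp add: Q_def exp_diff exp_double)
  also have "2 * e1 + e2 - e4 = of_real (pi / 12 * (2 / real k ^ 2 + 1 / (2 * real k2 ^ 2) - 1 / (4 * real k4 ^ 2))) / w"
    using w0 k by (simp add: e1_def e2_def e4_def) (simp add: algebra_simps add_divide_distrib diff_divide_distrib)
  also have "2 * s1 + s2 - s4 = of_real pi * \<i> * of_real (2 * dedekind_sum (int h) k + dedekind_sum (int h2) k2 - dedekind_sum (int h4) k4)"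
    by (simp add: s1_def s2_def s4_def algebra_simps)
  also have "r1\<^sup>2 * r2 / r4 = of_real ((sqrt (real k))\<^sup>2 * sqrt (real (k2 * 2)) / sqrt (real (k4 * 4)))"
    by (simp only: r1_def r2_def r4_def of_real_mult of_real_divide of_real_power)
  also have "(sqrt (real k))\<^sup>2 * sqrt (real (k2 * 2)) / sqrt (real (k4 * 4)) = real k * sqrt (real (k2 * 2) / real (k4 * 4))"
    by (simp only: real_sqrt_divide real_sqrt_pow2 of_nat_0_le_iff times_divide_eq_right)
  also have "real (k2 * 2) / real (k4 * 4) = real k2 / (2 * real k4)" by simp
  finally show ?thesis
    using nQ unfolding t_def y_def W(2) by blast
qed

subsection \<open>Farey dissection\<close>

text \<open>The window N - k < d <= N holds k consecutive numbers, hence every residue class mod k.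
  Its lower end says that the mediant denominator k + d exceeds N, the mark of Farey
  neighbours.\<close>

lemma ex_cong_in_window:
  fixes N k d0 :: nat
  assumes "k > 0" "k \<le> N"
  shows "\<exists>d. N < d + k \<and> d \<le> N \<and> [d = d0] (mod k)"
proof -
  define e where "e = nat ((int N - int d0) mod int k)"
  have e: "int e = (int N - int d0) mod int k" using assms by (simp add: e_def)
  have "e < k" using assms by (simp add: e_def nat_less_iff)
  moreover have "[N - e = d0] (mod k)"
  proof -
    have "int (N - e) = int N - (int N - int d0) mod int k"
      using \<open>e < k\<close> assms e by (simp add: of_nat_diff)
    also have "[\<dots> = int N - (int N - int d0)] (mod int k)"
      by (intro cong_diff) (auto simp: cong_def)
    finally have "[int (N - e) = int d0] (mod int k)" by simp
    thus ?thesis by (simp only: cong_int_iff)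
  qed
  ultimately show ?thesis using assms by (intro exI[of _ "N - e"]) auto
qed

lemma cong_in_window_unique:
  fixes N k d d' :: nat
  assumes "N < d + k" "d \<le> N" "N < d' + k" "d' \<le> N" "[d = d'] (mod k)"
  shows "d = d'"
proof -
  have *: "d = d'" if "d \<le> d'" "N < d + k" "d' \<le> N" "[d = d'] (mod k)" for d d'
  proof -
    have "k dvd d' - d" using that by (metis cong_altdef_nat cong_sym)
    moreover have "d' - d < k" using that by linarith
    ultimately show ?thesis using that by (auto dest: dvd_imp_le)
  qed
  show ?thesis using *[of d d'] *[of d' d] assms by (metis cong_sym nat_le_linear)
qed

text \<open>The right end of each Farey arc is the mediant that is also the left end of the next arc, so
  the sum telescopes once the successor map is known to be a bijection. The denominator of the
  right neighbour of h/k is \<open>rd h k\<close>, that of the left neighbour is \<open>ld h k\<close>.\<close>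

lemma farey_dissection:
  fixes N :: nat
  assumes N: "N \<ge> 1"
  defines "L \<equiv> {(h, k). h < k \<and> k \<le> N \<and> coprime h k}"
  shows "\<exists>\<theta>1 \<theta>2 :: nat \<Rightarrow> nat \<Rightarrow> real.
    (\<forall>h k. (h, k) \<in> L \<longrightarrow> 1 / (2 * real k * real N) \<le> \<theta>1 h k \<and> \<theta>1 h k \<le> 1 / (real k * real N)) \<and>
    (\<forall>h k. (h, k) \<in> L \<longrightarrow> 1 / (2 * real k * real N) \<le> \<theta>2 h k \<and> \<theta>2 h k \<le> 1 / (real k * real N)) \<and>
    (\<forall>(G :: real \<Rightarrow> complex) D. (\<forall>x. G (x + 1) - G x = D) \<longrightarrow>
       (\<Sum>(h, k)\<in>L. G (real h / real k + \<theta>2 h k) - G (real h / real k - \<theta>1 h k)) = D)"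
proof -
  \<comment> \<open>The fractions of \<open>L\<close> with 0/1 replaced by 1/1: the possible right
    neighbours.\<close>
  define R where "R = {(c, d). 1 \<le> c \<and> c \<le> d \<and> d \<le> N \<and> coprime c d}"
  \<comment> \<open>A right neighbour c/d satisfies k c - h d = 1, so d is minus the inverse of h
    mod k; the witness x (k - 1) represents -x.\<close>
  have ex1: "\<exists>d. N < d + k \<and> d \<le> N \<and> k dvd h * d + 1" if k: "k \<ge> 1" "k \<le> N" "coprime h k" for h k
  proof -
    obtain x where x: "[h * x = 1] (mod k)" using cong_solve_coprime_nat[OF k(3)] by auto
    obtain d where d: "N < d + k" "d \<le> N" "[d = x * (k - 1)] (mod k)"
      using ex_cong_in_window[of k N "x * (k - 1)"] k by auto
    have "[h * d + 1 = h * (x * (k - 1)) + 1] (mod k)"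
      by (intro cong_add cong_mult d(3)) auto
    also have "h * (x * (k - 1)) + 1 = h * x * (k - 1) + 1" by simp
    also have "[\<dots> = 1 * (k - 1) + 1] (mod k)"
      by (intro cong_add cong_mult x) auto
    also have "1 * (k - 1) + 1 = k" using k by simp
    also have "[k = 0] (mod k)" by (simp add: cong_def)
    finally show ?thesis using d by (auto simp: cong_0_iff)
  qed
  have ex2: "\<exists>b. N < b + k \<and> b \<le> N \<and> [h * b = 1] (mod k)" if k: "k \<ge> 1" "k \<le> N" "coprime h k" for h k
  proof -
    obtain x where x: "[h * x = 1] (mod k)" using cong_solve_coprime_nat[OF k(3)] by auto
    obtain d where d: "N < d + k" "d \<le> N" "[d = x] (mod k)"
      using ex_cong_in_window[of k N x] k by auto
    have "[h * d = h * x] (mod k)" by (intro cong_mult d(3)) auto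
    thus ?thesis using d x by (blast intro: cong_trans)
  qed
  obtain rd where rd: "\<And>h k. k \<ge> 1 \<Longrightarrow> k \<le> N \<Longrightarrow> coprime h k \<Longrightarrow> N < rd h k + k \<and> rd h k \<le> N \<and> k dvd h * rd h k + 1"
  proof (rule that)
    show "N < (SOME d. N < d + k \<and> d \<le> N \<and> k dvd h * d + 1) + k \<and> (SOME d. N < d + k \<and> d \<le> N \<and> k dvd h * d + 1) \<le> N
      \<and> k dvd h * (SOME d. N < d + k \<and> d \<le> N \<and> k dvd h * d + 1) + 1"
      if "k \<ge> 1" "k \<le> N" "coprime h k" for h k
      by (rule someI_ex[OF ex1[OF that]])
  qed
  obtain ld where ld: "\<And>h k. k \<ge> 1 \<Longrightarrow> k \<le> N \<Longrightarrow> coprime h k \<Longrightarrow> N < ld h k + k \<and> ld h k \<le> N \<and> [h * ld h k = 1] (mod k)"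
  proof (rule that)
    show "N < (SOME d. N < d + k \<and> d \<le> N \<and> [h * d = 1] (mod k)) + k \<and> (SOME d. N < d + k \<and> d \<le> N \<and> [h * d = 1] (mod k)) \<le> N
      \<and> [h * (SOME d. N < d + k \<and> d \<le> N \<and> [h * d = 1] (mod k)) = 1] (mod k)"
      if "k \<ge> 1" "k \<le> N" "coprime h k" for h k
      by (rule someI_ex[OF ex2[OF that]])
  qed
  \<comment> \<open>Distance from h/k to the mediant with its neighbour. The stated bounds are N < k
    + d <= 2 N.\<close>
  define \<theta>1 where "\<theta>1 = (\<lambda>h k. 1 / (real k * real (k + ld h k)))"
  define \<theta>2 where "\<theta>2 = (\<lambda>h k. 1 / (real k * real (k + rd h k)))"
  have bounds: "1 / (2 * real k * real N) \<le> 1 / (real k * real (k + d)) \<and> 1 / (real k * real (k + d)) \<le> 1 / (real k * real N)"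
    if "1 \<le> k" "k \<le> N" "N < d + k" "d \<le> N" for k d
  proof
    have "real k * real (k + d) \<le> real k * (2 * real N)" using that by (intro mult_left_mono) auto
    thus "1 / (2 * real k * real N) \<le> 1 / (real k * real (k + d))"
      using that by (intro divide_left_mono mult_pos_pos) (auto simp: mult_ac)
    show "1 / (real k * real (k + d)) \<le> 1 / (real k * real N)"
      using that by (intro divide_left_mono mult_left_mono mult_pos_pos) auto
  qed
  define nxt where "nxt = (\<lambda>(h, k). ((h * rd h k + 1) div k, rd h k))"
  have nxt: "k * c = h * d + 1 \<and> (c, d) \<in> R \<and> ld c d = k" if hk: "(h, k) \<in> L" and cd: "nxt (h, k) = (c, d)" for h k c d
  proof -
    have k: "k \<ge> 1" "k \<le> N" "coprime h k" "h < k" using hk by (auto simp: L_def)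
    have d: "d = rd h k" "N < d + k" "d \<le> N" "k dvd h * d + 1" and c: "c = (h * d + 1) div k"
      using rd[OF k(1-3)] cd by (auto simp: nxt_def)
    have kc: "k * c = h * d + 1" using d c by simp
    have "d \<ge> 1" using d k by linarith
    have "c \<ge> 1" using kc by (cases c) auto
    have "k * c \<le> k * d"
    proof -
      have "h * d + d \<le> k * d" using k by (metis Suc_leI add.commute mult_Suc mult_le_mono1)
      thus ?thesis unfolding kc using \<open>d \<ge> 1\<close> by linarith
    qed
    hence "c \<le> d" using k by simp
    have cop: "coprime c d"
    proof (rule coprimeI)
      fix x assume "x dvd c" "x dvd d"
      hence "x dvd k * c" "x dvd h * d" by auto
      thus "is_unit x" using dvd_diff_nat[of x "h * d + 1" "h * d"] unfolding kc by simp
    qed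
    have "ld c d = k"
    proof (rule cong_in_window_unique)
      show "N < ld c d + d" "ld c d \<le> N" using ld[of d c] cop \<open>d \<ge> 1\<close> d by auto
      show "N < k + d" "k \<le> N" using d k by auto
      have "[c * k = 1] (mod d)" using kc by (simp only: cong_def mod_mult_self3 mult.commute[of c k])
      moreover have "[c * ld c d = 1] (mod d)" using ld[of d c] cop \<open>d \<ge> 1\<close> d by auto
      ultimately have "[c * ld c d = c * k] (mod d)" by (metis cong_sym cong_trans)
      thus "[ld c d = k] (mod d)" using cop by (simp add: cong_mult_lcancel_nat)
    qed
    thus ?thesis using kc cop \<open>c \<ge> 1\<close> \<open>c \<le> d\<close> d by (auto simp: R_def)
  qed
  have fin: "finite L" "finite R"
    by (rule finite_subset[of _ "{..N} \<times> {..N}"]; auto simp: L_def R_def)+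
  have "(h, k) \<in> L \<longleftrightarrow> (h, k) \<in> insert (0, 1) (R - {(1, 1)})" for h k
  proof (cases "h = 0")
    case False
    have "h \<noteq> k" if "coprime h k" "(h, k) \<noteq> (1, 1)" using that False by auto
    thus ?thesis using False by (auto simp: L_def R_def)
  qed (use N in \<open>auto simp: L_def R_def\<close>)
  hence "L = insert (0, 1) (R - {(1, 1)})" by auto
  moreover have "(0, 1) \<notin> R - {(1, 1)}" "(1, 1) \<in> R" using N by (auto simp: R_def)
  ultimately have LR: "L = insert (0, 1) (R - {(1, 1)})" "(0, 1) \<notin> R - {(1, 1)}" "(1, 1) \<in> R"
    by blast+
  \<comment> \<open>The image (c, d) determines k as \<open>ld c d\<close>, and then k c = h d + 1
    determines h. Surjectivity follows by counting, without an explicit inverse.\<close>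
  have "inj_on nxt L"
  proof (rule inj_onI, clarsimp)
    fix h k h' k' assume L: "(h, k) \<in> L" "(h', k') \<in> L" "nxt (h, k) = nxt (h', k')"
    obtain c d where cd: "nxt (h, k) = (c, d)" by force
    have cd': "nxt (h', k') = (c, d)" using L(3) cd by simp
    have *: "k * c = h * d + 1" "ld c d = k" "(c, d) \<in> R" "k' * c = h' * d + 1" "ld c d = k'"
      using nxt[OF L(1) cd] nxt[OF L(2) cd'] by blast+
    hence "h * d = h' * d" by simp
    thus "h = h' \<and> k = k'" using * by (auto simp: R_def)
  qed
  moreover have "nxt ` L \<subseteq> R"
  proof clarify
    fix h k c d assume "(h, k) \<in> L" "(c, d) = nxt (h, k)"
    thus "(c, d) \<in> R" using nxt[of h k c d] by metis
  qed
  moreover have "card L = card R"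
    using LR(2,3) fin(2) card_Suc_Diff1[OF fin(2) LR(3)] unfolding LR(1) by simp
  ultimately have bij: "bij_betw nxt L R"
    using fin by (simp add: bij_betw_def card_image card_subset_eq)
  have sum_eq: "(\<Sum>(h, k)\<in>L. G (real h / real k + \<theta>2 h k) - G (real h / real k - \<theta>1 h k)) = D"
    if G: "\<And>x. G (x + 1) - G x = D" for G :: "real \<Rightarrow> complex" and D
  proof -
    have "(\<Sum>(h, k)\<in>L. G (real h / real k + \<theta>2 h k)) = (\<Sum>x\<in>L. (\<lambda>(c, d). G (real c / real d - \<theta>1 c d)) (nxt x))"
    proof (intro sum.cong refl, clarify)
      fix h k assume hk: "(h, k) \<in> L"
      obtain c d where cd: "nxt (h, k) = (c, d)" by force
      have *: "k * c = h * d + 1" "ld c d = k" "(c, d) \<in> R" "d = rd h k"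
        using nxt[OF hk cd] cd by (auto simp: nxt_def)
      have pos: "real k > 0" "real d > 0" using hk * by (auto simp: L_def R_def)
      have "real k * real c = real h * real d + 1"
        using *(1) by (metis of_nat_1 of_nat_add of_nat_mult)
      hence "real c = (real h * real d + 1) / real k" using pos by (simp add: field_simps)
      hence "real c / real d - 1 / (real d * (real d + real k)) = real h / real k + 1 / (real k * (real k + real d))"
        using pos by (simp only:) (simp add: divide_simps, simp add: algebra_simps)
      hence "real h / real k + \<theta>2 h k = real c / real d - \<theta>1 c d"
        using * by (simp add: \<theta>1_def \<theta>2_def)
      thus "G (real h / real k + \<theta>2 h k) = (case nxt (h, k) of (c, d) \<Rightarrow> G (real c / real d - \<theta>1 c d))"
        using cd by simp
    qed
    also have "\<dots> = (\<Sum>(c, d)\<in>R. G (real c / real d - \<theta>1 c d))"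
      by (rule sum.reindex_bij_betw[OF bij])
    also have "\<dots> = G (1 - \<theta>1 1 1) + (\<Sum>(c, d)\<in>R - {(1, 1)}. G (real c / real d - \<theta>1 c d))"
      using sum.remove[OF fin(2) LR(3), of "\<lambda>(c, d). G (real c / real d - \<theta>1 c d)"] by simp
    finally have 1: "(\<Sum>(h, k)\<in>L. G (real h / real k + \<theta>2 h k)) = \<dots>" .
    have 2: "(\<Sum>(h, k)\<in>L. G (real h / real k - \<theta>1 h k)) = G (- \<theta>1 0 1) + (\<Sum>(c, d)\<in>R - {(1, 1)}. G (real c / real d - \<theta>1 c d))"
      using fin LR(2) by (subst LR(1), subst sum.insert) auto
    \<comment> \<open>The arcs around 0 and 1 are translates of each other, so the ends left over by
      the telescoping differ by exactly one period.\<close>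
    have "\<theta>1 1 1 = \<theta>1 0 1"
      using ld[of 1 1] ld[of 1 0] N by (simp add: \<theta>1_def)
    hence 3: "G (1 - \<theta>1 1 1) - G (- \<theta>1 0 1) = D"
      using G[of "- \<theta>1 0 1"] by (simp add: algebra_simps)
    show ?thesis
      using 1 2 3 by (simp add: case_prod_unfold sum_subtractf)
  qed
  have b1: "1 / (2 * real k * real N) \<le> \<theta>1 h k \<and> \<theta>1 h k \<le> 1 / (real k * real N)" if "(h, k) \<in> L" for h k
  proof -
    have k: "1 \<le> k" "k \<le> N" "coprime h k" using that by (auto simp: L_def)
    show ?thesis unfolding \<theta>1_def using ld[OF k] k by (intro bounds) auto
  qed
  have b2: "1 / (2 * real k * real N) \<le> \<theta>2 h k \<and> \<theta>2 h k \<le> 1 / (real k * real N)" if "(h, k) \<in> L" for h k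
  proof -
    have k: "1 \<le> k" "k \<le> N" "coprime h k" using that by (auto simp: L_def)
    show ?thesis unfolding \<theta>2_def using rd[OF k] k by (intro bounds) auto
  qed
  show ?thesis
    using b1 b2 sum_eq by (intro exI[of _ \<theta>1] exI[of _ \<theta>2]) simp
qed

subsection \<open>The main term on a Farey arc\<close>

lemma higher_deriv_exp_linear: "(deriv ^^ n) (\<lambda>w. exp (c * w)) = (\<lambda>w. c ^ n * exp (c * w :: complex))"
proof (induction n)
  case (Suc n)
  have "deriv (\<lambda>w. c ^ n * exp (c * w)) w = c ^ Suc n * exp (c * w)" for w
    by (rule DERIV_imp_deriv) (auto intro!: derivative_eq_intros)
  thus ?case by (simp add: Suc)
qed auto

text \<open>Expand exp(A/w) on the unit circle and integrate termwise. The term w^(1-m) A^m exp(B w)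
  / m! has residue A^m B^(m-2) / (m! (m-2)!) for m >= 2 and none for m < 2; shifting m by 2 produces
  A/B times the series of I_2.\<close>

lemma residue_times_exp_inverse:
  fixes A B :: real
  assumes A: "A > 0" and B: "B > 0"
  shows "residue (\<lambda>w. w * exp (of_real A / w + of_real B * w)) 0 = of_real (A / B * bessel_I 2 (2 * sqrt (A * B)))"
proof -
  define f :: "complex \<Rightarrow> complex" where "f = (\<lambda>w. w * exp (of_real A / w + of_real B * w))"
  define R where "R = residue f 0"
  have R: "(f has_contour_integral 2 * of_real pi * \<i> * R) (circlepath 0 1)"
    
  proof -
    have "f holomorphic_on UNIV - {0}" by (auto simp: f_def intro!: holomorphic_intros)
    from base_residue[OF open_UNIV _ _ this, of 1] show ?thesis by (simp add: R_def)
  qed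
  define t :: "nat \<Rightarrow> complex \<Rightarrow> complex" where "t = (\<lambda>m w. w * exp (of_real B * w) * ((of_real A / w) ^ m / fact m))"
  define r where "r = (\<lambda>m. if m < 2 then 0 else A ^ m * B ^ (m - 2) / (fact m * fact (m - 2)))"
  have t: "(t m has_contour_integral 2 * of_real pi * \<i> * of_real (r m)) (circlepath 0 1)" for m
  proof -
    have entire: "(g has_contour_integral 0) (circlepath 0 1)" if "g holomorphic_on UNIV" for g
      by (rule Cauchy_theorem_convex_simple[OF that]) auto
    consider "m = 0" | "m = 1" | j where "m = Suc (Suc j)" by (cases m; cases "m - 1") auto
    thus ?thesis
    proof cases
      assume "m = 0"
      thus ?thesis by (auto simp: r_def t_def intro!: entire holomorphic_intros)
    next
      assume "m = 1"
      \<comment> \<open>By the convention x/0 = 0, \<open>t 1\<close> vanishes at the origin and is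
        not entire; its holomorphic extension agrees with it on the circle.\<close>
      have "((\<lambda>w. of_real A * exp (of_real B * w)) has_contour_integral 0) (circlepath 0 1)"
        by (intro entire holomorphic_intros)
      hence "(t 1 has_contour_integral 0) (circlepath 0 1)"
        by (rule has_contour_integral_eq) (auto simp: t_def)
      thus ?thesis using \<open>m = 1\<close> by (simp add: r_def)
    next
      fix j assume m: "m = Suc (Suc j)"
      have "continuous_on (cball 0 1) (\<lambda>w. exp (complex_of_real B * w))" "(\<lambda>w. exp (complex_of_real B * w)) holomorphic_on ball 0 1"
        by (auto intro!: continuous_intros holomorphic_intros)
      from Cauchy_has_contour_integral_higher_derivative_circlepath[OF this, of 0 j]
      have "((\<lambda>w. exp (of_real B * w) / w ^ Suc j) has_contour_integral (2 * of_real pi * \<i>) / fact j * of_real B ^ j) (circlepath 0 1)"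
        by (simp add: higher_deriv_exp_linear)
      from has_contour_integral_lmul[OF this, of "of_real A ^ m / fact m"]
      have "((\<lambda>w. of_real A ^ m / fact m * (exp (of_real B * w) / w ^ Suc j)) has_contour_integral of_real A ^ m / fact m * ((2 * of_real pi * \<i>) / fact j * of_real B ^ j)) (circlepath 0 1)" .
      also have "of_real A ^ m / fact m * ((2 * of_real pi * \<i>) / fact j * of_real B ^ j) = 2 * of_real pi * \<i> * of_real (r m)"
        by (simp add: r_def m mult_ac del: fact_Suc power_Suc)
      finally have "((\<lambda>w. of_real A ^ m / fact m * (exp (of_real B * w) / w ^ Suc j)) has_contour_integral 2 * of_real pi * \<i> * of_real (r m)) (circlepath 0 1)" .
      thus ?thesis
        by (rule has_contour_integral_eq) (auto simp: t_def m power_divide mult_ac)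
    qed
  qed
  have lim: "uniform_limit (sphere 0 1) (\<lambda>n w. \<Sum>m<n. t m w) (\<lambda>w. \<Sum>m. t m w) sequentially"
  proof (rule Weierstrass_m_test)
    fix m and w :: complex assume w: "w \<in> sphere 0 1"
    have "norm (t m w) = exp (B * Re w) * (A ^ m / fact m)"
      using w A by (simp add: t_def norm_mult norm_divide norm_power)
    also have "\<dots> \<le> exp (B * 1) * (A ^ m / fact m)"
      using w A B complex_Re_le_cmod[of w] by (intro mult_right_mono) auto
    finally show "norm (t m w) \<le> exp B * (inverse (fact m) * A ^ m)" by (simp add: field_simps)
  next
    show "summable (\<lambda>m. exp B * (inverse (fact m) * A ^ m))"
      by (intro summable_mult summable_exp)
  qed
  have eq: "(\<Sum>m. t m w) = f w" if "w \<in> sphere 0 1" for w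
  proof -
    have "(\<lambda>m. (of_real A / w) ^ m /\<^sub>R fact m) sums exp (of_real A / w)"
      by (rule exp_converges)
    hence "(\<lambda>m. (of_real A / w) ^ m / fact m) sums exp (of_real A / w)"
      by (simp add: scaleR_conv_of_real field_simps)
    from sums_mult[OF this, of "w * exp (of_real B * w)"] show ?thesis
      by (simp add: t_def f_def exp_add sums_iff mult_ac)
  qed
  have lim': "uniform_limit (sphere 0 1) (\<lambda>n w. \<Sum>m<n. t m w) f sequentially"
    using lim by (rule uniform_limit_cong'[THEN iffD1, rotated -1]) (use eq in auto)
  have int: "((\<lambda>w. \<Sum>m<n. t m w) has_contour_integral (\<Sum>m<n. 2 * of_real pi * \<i> * of_real (r m))) (circlepath 0 1)" for n
    by (intro has_contour_integral_sum t) auto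
  have "(\<lambda>n. contour_integral (circlepath 0 1) (\<lambda>w. \<Sum>m<n. t m w)) \<longlonglongrightarrow> contour_integral (circlepath 0 1) f"
    by (rule contour_integral_uniform_limit_circlepath(2)[OF _ lim'])
       (use int has_contour_integral_integrable in \<open>auto intro!: always_eventually\<close>)
  hence "(\<lambda>m. 2 * of_real pi * \<i> * of_real (r m)) sums (2 * of_real pi * \<i> * R)"
    unfolding contour_integral_unique[OF int] contour_integral_unique[OF R] sums_def .
  hence "(\<lambda>m. complex_of_real (r m)) sums R"
    by (subst (asm) sums_mult_iff) auto
  hence "(\<lambda>m. complex_of_real (r (m + 2))) sums (R - (\<Sum>i<2. complex_of_real (r i)))"
    by (rule sums_split_initial_segment)
  hence 1: "(\<lambda>m. complex_of_real (r (m + 2))) sums R"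
    by (simp add: r_def numeral_2_eq_2)
  define b where "b = (\<lambda>m. sqrt (A * B) ^ (2 * m + 2) / (fact m * fact (m + 2)))"
  have rb: "r (m + 2) = A / B * b m" for m
  proof -
    have "sqrt (A * B) ^ (2 * m + 2) = (sqrt (A * B) ^ 2) ^ (m + 1)"
      by (simp only: power_mult[symmetric]) (simp add: algebra_simps)
    also have "\<dots> = (A * B) ^ (m + 1)" using A B by simp
    finally show ?thesis using A B by (simp add: r_def b_def power_mult_distrib field_simps)
  qed
  have "summable (\<lambda>m. A / B * b m)"
    using 1 unfolding rb by (auto simp: sums_iff summable_of_real_iff)
  hence "summable b" using A B by simp
  hence "b sums bessel_I 2 (2 * sqrt (A * B))"
    by (simp add: bessel_I_def b_def summable_sums)
  hence "(\<lambda>m. complex_of_real (A / B * b m)) sums of_real (A / B * bessel_I 2 (2 * sqrt (A * B)))"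
    by (intro sums_of_real sums_mult)
  with 1 show ?thesis unfolding rb R_def f_def using sums_unique2 by blast
qed

text \<open>Since k <= N, both coordinates of w are at most 1/(k N) in modulus, so |w|^2 <= 2/(k
  N)^2 and Re(1/w) = Re w / |w|^2 >= k^2/2.\<close>

lemma farey_arc_points:
  fixes k N :: nat and \<theta>1 \<theta>2 :: real
  assumes k: "1 \<le> k" "k \<le> N"
    and \<theta>1: "1 / (2 * real k * real N) \<le> \<theta>1" "\<theta>1 \<le> 1 / (real k * real N)"
    and \<theta>2: "1 / (2 * real k * real N) \<le> \<theta>2" "\<theta>2 \<le> 1 / (real k * real N)"
    and w: "w \<in> closed_segment (Complex (1 / real N ^ 2) (-\<theta>2)) (Complex (1 / real N ^ 2) \<theta>1)"
  shows "Re w = 1 / real N ^ 2" "-\<theta>2 \<le> Im w" "Im w \<le> \<theta>1" "norm w \<le> 2 / (real k * real N)"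
    "Re (1 / w) \<ge> real k ^ 2 / 2"
proof -
  define T where "T = 1 / (real k * real N)"
  have T: "T > 0" using k by (simp add: T_def)
  have pos: "\<theta>1 > 0" "\<theta>2 > 0" using \<theta>1 \<theta>2 T k by (auto intro: less_le_trans[rotated])
  show re: "Re w = 1 / real N ^ 2" and im: "-\<theta>2 \<le> Im w" "Im w \<le> \<theta>1"
    using w pos by (auto simp: closed_segment_same_Re closed_segment_eq_real_ivl)
  have NT: "1 / real N ^ 2 \<le> T"
    using k by (auto simp: T_def power2_eq_square intro!: divide_left_mono mult_right_mono)
  have abs_im: "\<bar>Im w\<bar> \<le> T" using im \<theta>1 \<theta>2 by (auto simp: T_def)
  have "norm w \<le> \<bar>Re w\<bar> + \<bar>Im w\<bar>" by (rule cmod_le)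
  also have "\<dots> \<le> 2 * T" using NT abs_im re by simp
  finally show "norm w \<le> 2 / (real k * real N)" by (simp add: T_def)
  define n where "n = real N"
  have n: "n \<ge> 1" "real k \<le> n" using k by (auto simp: n_def)
  have "(Im w)\<^sup>2 \<le> T\<^sup>2" using abs_im T by (simp add: abs_le_square_iff[symmetric])
  also have "T\<^sup>2 = 1 / (real k ^ 2 * n ^ 2)" by (simp add: T_def n_def power_mult_distrib power_divide)
  finally have "(Re w)\<^sup>2 + (Im w)\<^sup>2 \<le> (1 / n\<^sup>2)\<^sup>2 + 1 / (real k ^ 2 * n ^ 2)"
    using re by (simp add: n_def)
  also have "(1 / n\<^sup>2)\<^sup>2 \<le> 1 / (real k ^ 2 * n\<^sup>2)"
    unfolding power_divide using n k 
    by (intro frac_le) (auto simp: power2_eq_square intro!: mult_mono)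
  finally have le: "(Re w)\<^sup>2 + (Im w)\<^sup>2 \<le> 2 / (real k ^ 2 * n\<^sup>2)" by (simp add: mult.commute)
  have "Re w > 0" using re k by simp
  hence sq: "(Re w)\<^sup>2 + (Im w)\<^sup>2 > 0" by (simp add: sum_power2_gt_zero_iff)
  have "real k ^ 2 / 2 = (1 / n\<^sup>2) / (2 / (real k ^ 2 * n\<^sup>2))" using n by (simp add: field_simps)
  also have "\<dots> \<le> Re w / ((Re w)\<^sup>2 + (Im w)\<^sup>2)"
    using le sq re n k by (intro frac_le) (auto simp: n_def)
  also have "\<dots> = Re (1 / w)" by (simp add: Re_divide)
  finally show "Re (1 / w) \<ge> real k ^ 2 / 2" .
qed

text \<open>Close the segment to the rectangle with vertical sides Re w = 1/N^2 and Re w = -1/N^2,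
  which winds once around 0. On the left side 1/w has negative real part. On the horizontal sides
  |Im w| >= T/2 gives Re(1/w) <= 4 k^2, so the exponent is at most 4 \<alpha> <= \<pi>; this is the
  use of \<alpha> <= \<pi>/4. Three sides of length at most 2 T with integrand at most 2 T exp(\<pi>
  + B) give the constant 12.\<close>

lemma rectangle_main_term:
  fixes k N :: nat and \<alpha> B \<theta>1 \<theta>2 :: real
  assumes k: "1 \<le> k" "k \<le> N"
    and \<theta>1: "1 / (2 * real k * real N) \<le> \<theta>1" "\<theta>1 \<le> 1 / (real k * real N)"
    and \<theta>2: "1 / (2 * real k * real N) \<le> \<theta>2" "\<theta>2 \<le> 1 / (real k * real N)"
    and \<alpha>: "0 < \<alpha>" "\<alpha> \<le> pi / 4" and B: "B > 0"
  defines "f \<equiv> \<lambda>w. w * exp (of_real (\<alpha> / real k ^ 2) / w + of_real B * w)"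
  shows "f contour_integrable_on linepath (Complex (1 / real N ^ 2) (-\<theta>2)) (Complex (1 / real N ^ 2) \<theta>1)"
    and "norm (contour_integral (linepath (Complex (1 / real N ^ 2) (-\<theta>2)) (Complex (1 / real N ^ 2) \<theta>1)) f
            - 2 * of_real pi * \<i> * residue f 0) \<le> 12 * exp (pi + B) / (real k * real N) ^ 2"
proof -
  define c where "c = 1 / real N ^ 2"
  define T where "T = 1 / (real k * real N)"
  have T: "T > 0" using k by (simp add: T_def)
  have c: "c > 0" "c \<le> T" "c \<le> 1"
  proof -
    show "c > 0" using k by (simp add: c_def)
    show "c \<le> T"
      using k by (auto simp: c_def T_def power2_eq_square intro!: divide_left_mono mult_right_mono)
    have "1 \<le> real N ^ 2" using k by (intro one_le_power) auto
    thus "c \<le> 1" using k by (simp add: c_def field_simps)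
  qed
  have th: "\<theta>1 \<ge> T / 2" "\<theta>2 \<ge> T / 2" "\<theta>1 \<le> T" "\<theta>2 \<le> T" using \<theta>1 \<theta>2 by (auto simp: T_def mult_ac)
  have pos: "\<theta>1 > 0" "\<theta>2 > 0" using th T by auto
  define a1 a2 a3 a4 where "a1 = Complex (-c) (-\<theta>2)" and "a2 = Complex c (-\<theta>2)" and "a3 = Complex c \<theta>1" and "a4 = Complex (-c) \<theta>1"
  have rp: "rectpath a1 a3 = linepath a1 a2 +++ linepath a2 a3 +++ linepath a3 a4 +++ linepath a4 a1"
    by (simp add: rectpath_def a1_def a2_def a3_def a4_def Let_def)
  have holo: "f holomorphic_on - {0}"
    unfolding f_def by (auto intro!: holomorphic_intros)
  have cont: "continuous_on S f" if "0 \<notin> S" for S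
    by (rule continuous_on_subset[OF holomorphic_on_imp_continuous_on[OF holo]]) (use that in auto)
  have seg: "w \<in> closed_segment a1 a2 \<Longrightarrow> Im w = -\<theta>2 \<and> \<bar>Re w\<bar> \<le> c"
            "w \<in> closed_segment a2 a3 \<Longrightarrow> Re w = c"
            "w \<in> closed_segment a3 a4 \<Longrightarrow> Im w = \<theta>1 \<and> \<bar>Re w\<bar> \<le> c"
            "w \<in> closed_segment a4 a1 \<Longrightarrow> Re w = -c \<and> \<bar>Im w\<bar> \<le> T" for w
    unfolding a1_def a2_def a3_def a4_def using c pos th
    by (auto simp: closed_segment_same_Re closed_segment_same_Im closed_segment_eq_real_ivl)
  have nz: "0 \<notin> closed_segment a1 a2" "0 \<notin> closed_segment a2 a3" "0 \<notin> closed_segment a3 a4" "0 \<notin> closed_segment a4 a1"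
    using seg[of 0] pos c by auto
  have int: "f contour_integrable_on linepath a1 a2" "f contour_integrable_on linepath a2 a3"
      "f contour_integrable_on linepath a3 a4" "f contour_integrable_on linepath a4 a1"
    by (intro contour_integrable_continuous_linepath cont nz)+
  show "f contour_integrable_on linepath (Complex (1 / real N ^ 2) (-\<theta>2)) (Complex (1 / real N ^ 2) \<theta>1)"
    using int(2) by (simp add: a2_def a3_def c_def)
  have "contour_integral (rectpath a1 a3) f = contour_integral (linepath a1 a2) f + (contour_integral (linepath a2 a3) f +
     (contour_integral (linepath a3 a4) f + contour_integral (linepath a4 a1) f))"
    unfolding rp using int by (simp add: contour_integrable_joinI)
  also have "contour_integral (rectpath a1 a3) f = of_real (2 * pi) * \<i> * (\<Sum>p\<in>{0}. winding_number (rectpath a1 a3) p * residue f p)"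
  proof (rule Residue_theorem)
    show "f holomorphic_on UNIV - {0}" using holo by (simp add: Compl_eq_Diff_UNIV)
    show "path_image (rectpath a1 a3) \<subseteq> UNIV - {0}"
      using nz unfolding rp by (auto simp: path_image_join)
  qed auto
  also have "(\<Sum>p\<in>{0}. winding_number (rectpath a1 a3) p * residue f p) = residue f 0"
    using pos c winding_number_rectpath[of 0 a1 a3] by (simp add: in_box_complex_iff a1_def a3_def)
  finally have eq: "contour_integral (linepath a2 a3) f - 2 * of_real pi * \<i> * residue f 0 =
     - (contour_integral (linepath a1 a2) f + contour_integral (linepath a3 a4) f + contour_integral (linepath a4 a1) f)"
    by (simp add: algebra_simps)
  define M where "M = 2 * T * exp (pi + B)"
  have fb: "norm (f w) \<le> M" if w: "\<bar>Re w\<bar> \<le> c" "\<bar>Im w\<bar> \<le> T" "Re w \<ge> 0 \<Longrightarrow> \<bar>Im w\<bar> \<ge> T / 2" for w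
  proof -
    have "norm w \<le> \<bar>Re w\<bar> + \<bar>Im w\<bar>" by (rule cmod_le)
    also have "\<dots> \<le> 2 * T" using w c by simp
    finally have nw: "norm w \<le> 2 * T" .
    have "Re (of_real (\<alpha> / real k ^ 2) / w) = Re (of_real (\<alpha> / real k ^ 2) * (1 / w))" by simp
    also have "\<dots> = \<alpha> / real k ^ 2 * Re (1 / w)"
      by (simp only: times_complex.sel Re_complex_of_real Im_complex_of_real mult_zero_left diff_zero)
    also have "Re (1 / w) = Re w / ((Re w)\<^sup>2 + (Im w)\<^sup>2)" by (simp add: Re_divide)
    also have "\<alpha> / real k ^ 2 * (Re w / ((Re w)\<^sup>2 + (Im w)\<^sup>2)) \<le> pi"
    proof (cases "Re w \<ge> 0")
      case True
      have "(T / 2)\<^sup>2 \<le> (Im w)\<^sup>2" using w(3)[OF True] T by (simp add: abs_le_square_iff[symmetric])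
      hence "(T / 2)\<^sup>2 \<le> (Re w)\<^sup>2 + (Im w)\<^sup>2" using zero_le_power2[of "Re w"] by linarith
      hence "Re w / ((Re w)\<^sup>2 + (Im w)\<^sup>2) \<le> c / (T / 2)\<^sup>2"
        using True w c T by (intro frac_le) auto
      also have "\<dots> = 4 * real k ^ 2" using k by (simp add: c_def T_def power_divide power_mult_distrib)
      finally have "\<alpha> / real k ^ 2 * (Re w / ((Re w)\<^sup>2 + (Im w)\<^sup>2)) \<le> \<alpha> / real k ^ 2 * (4 * real k ^ 2)"
        using \<alpha> by (intro mult_left_mono) auto
      also have "\<dots> = 4 * \<alpha>" using k by simp
      also have "\<dots> \<le> pi" using \<alpha> by simp
      finally show ?thesis .
    next
      case False
      hence "\<alpha> / real k ^ 2 * (Re w / ((Re w)\<^sup>2 + (Im w)\<^sup>2)) \<le> 0"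
        using \<alpha> by (intro mult_nonneg_nonpos divide_nonpos_nonneg) auto
      thus ?thesis using pi_gt_zero by linarith
    qed
    finally have 1: "Re (of_real (\<alpha> / real k ^ 2) / w) \<le> pi" .
    have "B * Re w \<le> B * 1" using B w c by (intro mult_left_mono) auto
    hence "exp (Re (of_real (\<alpha> / real k ^ 2) / w + of_real B * w)) \<le> exp (pi + B)" using 1 by simp
    hence "norm (f w) \<le> 2 * T * exp (pi + B)"
      unfolding f_def norm_mult norm_exp_eq_Re using nw T by (intro mult_mono) auto
    thus ?thesis by (simp add: M_def)
  qed
  have M: "M \<ge> 0" using T by (simp add: M_def)
  have "norm (contour_integral (linepath a1 a2) f) \<le> M * norm (a2 - a1)"
    using seg(1) th T by (intro contour_integral_bound_linepath int M fb) force+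
  also have "a2 - a1 = of_real (2 * c)" by (simp add: a1_def a2_def complex_eq_iff)
  also have "M * norm (of_real (2 * c) :: complex) \<le> M * (2 * T)" using M c by (intro mult_left_mono) auto
  finally have b1: "norm (contour_integral (linepath a1 a2) f) \<le> M * (2 * T)" .
  have "norm (contour_integral (linepath a3 a4) f) \<le> M * norm (a4 - a3)"
    using seg(3) th T by (intro contour_integral_bound_linepath int M fb) force+
  also have "a4 - a3 = - of_real (2 * c)" by (simp add: a3_def a4_def complex_eq_iff)
  also have "M * norm (- of_real (2 * c) :: complex) \<le> M * (2 * T)" using M c by (intro mult_left_mono) auto
  finally have b2: "norm (contour_integral (linepath a3 a4) f) \<le> M * (2 * T)" .
  have "norm (contour_integral (linepath a4 a1) f) \<le> M * norm (a1 - a4)"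
    using seg(4) c by (intro contour_integral_bound_linepath int M fb) force+
  also have "a1 - a4 = - (\<i> * of_real (\<theta>1 + \<theta>2))" by (simp add: a1_def a4_def complex_eq_iff)
  also have "M * norm (- (\<i> * of_real (\<theta>1 + \<theta>2))) \<le> M * (2 * T)"
    using M th pos by (intro mult_left_mono) (auto simp: norm_mult simp del: of_real_add)
  finally have b3: "norm (contour_integral (linepath a4 a1) f) \<le> M * (2 * T)" .
  have "norm (contour_integral (linepath a2 a3) f - 2 * of_real pi * \<i> * residue f 0) \<le> M * (2 * T) + M * (2 * T) + M * (2 * T)"
    unfolding eq norm_minus_cancel
    by (intro order.trans[OF norm_triangle_ineq] add_mono b1 b2 b3)
  also have "\<dots> = 12 * exp (pi + B) / (real k * real N) ^ 2"
    by (simp add: M_def T_def field_simps power2_eq_square)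
  finally show "norm (contour_integral (linepath (Complex (1 / real N ^ 2) (-\<theta>2)) (Complex (1 / real N ^ 2) \<theta>1)) f
            - 2 * of_real pi * \<i> * residue f 0) \<le> 12 * exp (pi + B) / (real k * real N) ^ 2"
    by (simp add: a2_def a3_def c_def)
qed

text \<open>The switch \<delta> keeps or drops the exponential. The remainder E costs path length 2
  T times |w| <= 2 T, whence 4 K. The scale \<kappa> <= k turns T^2 = 1/(k N)^2 into 1/(k N^2),
  which is small enough to sum over all arcs.\<close>

lemma farey_arc_integral:
  fixes k N :: nat and \<alpha> B \<theta>1 \<theta>2 K \<kappa> \<delta> :: real and \<zeta> :: complex
  assumes k: "1 \<le> k" "k \<le> N"
    and \<theta>1: "1 / (2 * real k * real N) \<le> \<theta>1" "\<theta>1 \<le> 1 / (real k * real N)"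
    and \<theta>2: "1 / (2 * real k * real N) \<le> \<theta>2" "\<theta>2 \<le> 1 / (real k * real N)"
    and \<alpha>: "0 < \<alpha>" "\<alpha> \<le> pi / 4" and B: "B > 0"
    and \<zeta>: "norm \<zeta> = 1" and \<kappa>: "0 \<le> \<kappa>" "\<kappa> \<le> real k" and \<delta>: "\<delta> \<in> {0, 1}" and K: "K \<ge> 0"
    and g_int: "g contour_integrable_on linepath (Complex (1 / real N ^ 2) (-\<theta>2)) (Complex (1 / real N ^ 2) \<theta>1)"
    and g: "\<And>w. w \<in> closed_segment (Complex (1 / real N ^ 2) (-\<theta>2)) (Complex (1 / real N ^ 2) \<theta>1) \<Longrightarrow>
      \<exists>E. g w = \<zeta> * of_real \<kappa> * w * exp (of_real B * w) * (of_real \<delta> * exp (of_real (\<alpha> / real k ^ 2) / w) + E) \<and> norm E \<le> K"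
  shows "norm (contour_integral (linepath (Complex (1 / real N ^ 2) (-\<theta>2)) (Complex (1 / real N ^ 2) \<theta>1)) g -
       \<zeta> * of_real (\<kappa> * \<delta>) * (2 * of_real pi * \<i> * of_real (\<alpha> / real k ^ 2 / B * bessel_I 2 (2 * sqrt (\<alpha> / real k ^ 2 * B)))))
     \<le> (12 * exp (pi + B) + 4 * K * exp B) / (real k * real N ^ 2)"
proof -
  define L where "L = linepath (Complex (1 / real N ^ 2) (-\<theta>2)) (Complex (1 / real N ^ 2) \<theta>1)"
  define f :: "complex \<Rightarrow> complex" where "f = (\<lambda>w. w * exp (of_real (\<alpha> / real k ^ 2) / w + of_real B * w))"
  define T where "T = 1 / (real k * real N)"
  have T: "T > 0" using k by (simp add: T_def)
  have f_int: "f contour_integrable_on L"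
    unfolding f_def L_def by (rule rectangle_main_term(1)) fact+
  have f_bound: "norm (contour_integral L f - 2 * of_real pi * \<i> * residue f 0) \<le> 12 * exp (pi + B) * T\<^sup>2"
    using rectangle_main_term(2)[OF k \<theta>1 \<theta>2 \<alpha> B] unfolding f_def L_def T_def by (simp add: power_divide)
  have res: "residue f 0 = of_real (\<alpha> / real k ^ 2 / B * bessel_I 2 (2 * sqrt (\<alpha> / real k ^ 2 * B)))"
    unfolding f_def using residue_times_exp_inverse[of "\<alpha> / real k ^ 2" B] \<alpha> B k by simp
  define c where "c = \<zeta> * of_real (\<kappa> * \<delta>)"
  have c: "norm c \<le> \<kappa>" using \<zeta> \<kappa> \<delta> by (auto simp: c_def norm_mult)
  have d_int: "(\<lambda>w. g w - c * f w) contour_integrable_on L"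
    unfolding L_def using g_int f_int[unfolded L_def] by (intro contour_integrable_diff contour_integrable_lmul)
  have "norm (contour_integral L (\<lambda>w. g w - c * f w)) \<le> (\<kappa> * (2 * T) * exp B * K) * norm (Complex (1 / real N ^ 2) \<theta>1 - Complex (1 / real N ^ 2) (-\<theta>2))"
    unfolding L_def
  proof (rule contour_integral_bound_linepath[OF d_int[unfolded L_def]])
    show "0 \<le> \<kappa> * (2 * T) * exp B * K" using \<kappa> T K by simp
    fix w assume w: "w \<in> closed_segment (Complex (1 / real N ^ 2) (-\<theta>2)) (Complex (1 / real N ^ 2) \<theta>1)"
    note pts = farey_arc_points[OF k \<theta>1 \<theta>2 w]
    from g[OF w] obtain E where E: "g w = \<zeta> * of_real \<kappa> * w * exp (of_real B * w) * (of_real \<delta> * exp (of_real (\<alpha> / real k ^ 2) / w) + E)" "norm E \<le> K"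
      by blast
    have "g w - c * f w = \<zeta> * of_real \<kappa> * w * exp (of_real B * w) * E"
      unfolding E(1) c_def f_def by (simp add: exp_add algebra_simps)
    also have "norm \<dots> = \<kappa> * norm w * exp (B * Re w) * norm E"
      using \<zeta> \<kappa> by (simp add: norm_mult)
    also have "\<dots> \<le> \<kappa> * (2 * T) * exp B * K"
    proof -
      have "Re w \<le> 1" using pts(1) k by (simp add: divide_le_eq)
      hence "B * Re w \<le> B" using B by simp
      thus ?thesis using pts(4) \<kappa> T E(2) K by (intro mult_mono) (auto simp: T_def)
    qed
    finally show "norm (g w - c * f w) \<le> \<kappa> * (2 * T) * exp B * K" .
  qed
  also have "Complex (1 / real N ^ 2) \<theta>1 - Complex (1 / real N ^ 2) (-\<theta>2) = \<i> * of_real (\<theta>1 + \<theta>2)"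
    by (simp add: complex_eq_iff)
  also have "(\<kappa> * (2 * T) * exp B * K) * norm (\<i> * of_real (\<theta>1 + \<theta>2)) \<le> (\<kappa> * (2 * T) * exp B * K) * (2 * T)"
  proof -
    have "\<theta>1 \<ge> 0" "\<theta>2 \<ge> 0" using \<theta>1(1) \<theta>2(1) by (auto intro: order.trans[rotated])
    hence "norm (\<i> * of_real (\<theta>1 + \<theta>2)) \<le> 2 * T"
      using add_mono[OF \<theta>1(2) \<theta>2(2)] by (simp add: norm_mult T_def mult.commute del: of_real_add)
    thus ?thesis using \<kappa> T K by (intro mult_left_mono) auto
  qed
  also have "contour_integral L (\<lambda>w. g w - c * f w) = contour_integral L g - c * contour_integral L f"
    using g_int f_int unfolding L_def
    by (subst contour_integral_diff) (auto intro: contour_integrable_lmul simp: contour_integral_lmul)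
  finally have 1: "norm (contour_integral L g - c * contour_integral L f) \<le> \<kappa> * (4 * K * exp B * T\<^sup>2)"
    by (simp add: power2_eq_square mult_ac)
  have "norm (c * (contour_integral L f - 2 * of_real pi * \<i> * residue f 0)) \<le> \<kappa> * (12 * exp (pi + B) * T\<^sup>2)"
    unfolding norm_mult using c f_bound \<kappa> by (intro mult_mono) auto
  hence 2: "norm (c * contour_integral L f - c * (2 * of_real pi * \<i> * residue f 0)) \<le> \<kappa> * (12 * exp (pi + B) * T\<^sup>2)"
    by (simp add: right_diff_distrib)
  have "norm (contour_integral L g - c * (2 * of_real pi * \<i> * residue f 0)) \<le> \<kappa> * (4 * K * exp B * T\<^sup>2) + \<kappa> * (12 * exp (pi + B) * T\<^sup>2)"
    using norm_triangle_ineq[of "contour_integral L g - c * contour_integral L f" "c * contour_integral L f - c * (2 * of_real pi * \<i> * residue f 0)"] 1 2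
    by simp
  also have "\<dots> = \<kappa> * ((12 * exp (pi + B) + 4 * K * exp B) * T\<^sup>2)" by (simp add: algebra_simps)
  also have "\<dots> \<le> real k * ((12 * exp (pi + B) + 4 * K * exp B) * T\<^sup>2)"
    using \<kappa> K T by (intro mult_right_mono) auto
  also have "\<dots> = (12 * exp (pi + B) + 4 * K * exp B) / (real k * real N ^ 2)"
    using k by (simp add: T_def power2_eq_square field_simps)
  finally show ?thesis unfolding res c_def L_def .
qed

subsection \<open>Coefficients of the generating function\<close>

definition of_real_fps :: "real fps \<Rightarrow> complex fps" where
  "of_real_fps f = Abs_fps (\<lambda>n. complex_of_real (fps_nth f n))"

lemma of_real_fps_nth [simp]: "fps_nth (of_real_fps f) n = of_real (fps_nth f n)"
  by (simp add: of_real_fps_def)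

lemma of_real_fps_simps [simp]:
  "of_real_fps 1 = 1" "of_real_fps fps_X = fps_X"
  "of_real_fps (f + g) = of_real_fps f + of_real_fps g"
  "of_real_fps (f - g) = of_real_fps f - of_real_fps g"
  "of_real_fps (f * g) = of_real_fps f * of_real_fps g"
  by (auto simp: fps_eq_iff fps_mult_nth fps_X_def)

lemma of_real_fps_power [simp]: "of_real_fps (f ^ n) = of_real_fps f ^ n"
  by (induction n) auto

lemma of_real_fps_prod [simp]: "of_real_fps (prod f A) = (\<Prod>x\<in>A. of_real_fps (f x))"
  by (induction A rule: infinite_finite_induct) auto

lemma of_real_fps_inverse:
  assumes "fps_nth f 0 \<noteq> 0"
  shows "of_real_fps (inverse f) = inverse (of_real_fps f)"
proof -
  have "of_real_fps f * of_real_fps (inverse f) = 1"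
    using inverse_mult_eq_1'[OF assms] by (metis of_real_fps_simps(1,5))
  thus ?thesis by (metis fps_inverse_unique)
qed

text \<open>Generic in the field, so that the real product defining the coefficients and its complex
  counterpart in the contour integral are instances of one formula.\<close>

definition cubic_over_fps :: "nat \<Rightarrow> 'a :: field fps" where
  "cubic_over_fps M = (\<Prod>j\<in>{1..M}. (1 + fps_X ^ j) * (1 + fps_X ^ (2 * j))
                * inverse ((1 - fps_X ^ j) * (1 - fps_X ^ (2 * j))))"

lemma fps_nth_cubic_over_denominator:
  "j > 0 \<Longrightarrow> fps_nth ((1 - fps_X ^ j) * (1 - fps_X ^ (2 * j)) :: 'a :: field fps) 0 = 1"
  by simp

text \<open>The factor with index j is 1 plus a multiple of X^j, so factors beyond n do not touch
  the coefficient of X^n.\<close>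

lemma fps_nth_cubic_over_fps_mono:
  assumes "n \<le> M"
  shows "fps_nth (cubic_over_fps M :: 'a :: field fps) n = fps_nth (cubic_over_fps n) n"
  using assms
proof (induction M rule: dec_induct)
  case (step M)
  define j where "j = Suc M"
  define y :: "'a fps" where "y = fps_X ^ j"
  define D where "D = (1 - y) * (1 - y ^ 2)"
  have "fps_nth y 0 = 0" by (simp add: y_def j_def)
  hence D: "fps_nth D 0 \<noteq> 0" by (simp add: D_def power2_eq_square)
  have "(1 + y) * (1 + y ^ 2) = D + y * (2 + 2 * y)"
    by (simp add: D_def algebra_simps power2_eq_square)
  hence eq1: "(1 + y) * (1 + y ^ 2) * inverse D = 1 + y * ((2 + 2 * y) * inverse D)"
    using inverse_mult_eq_1'[OF D] by (simp add: distrib_right mult.assoc)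
  have "cubic_over_fps (Suc M) = cubic_over_fps M * ((1 + y) * (1 + y ^ 2) * inverse D)"
    by (simp add: cubic_over_fps_def D_def y_def j_def prod.nat_ivl_Suc' mult.commute power_mult[symmetric] del: power_Suc)
  also have "\<dots> = cubic_over_fps M + y * (cubic_over_fps M * ((2 + 2 * y) * inverse D))"
    by (subst eq1) (simp only: ring_distribs mult_1_right mult_1_left mult_ac)
  finally have "fps_nth (cubic_over_fps (Suc M) :: 'a fps) n = fps_nth (cubic_over_fps M) n + fps_nth (y * (cubic_over_fps M * ((2 + 2 * y) * inverse D))) n"
    by simp
  hence "fps_nth (cubic_over_fps (Suc M) :: 'a fps) n = fps_nth (cubic_over_fps M) n"
    unfolding y_def
    using step by (simp add: fps_X_power_mult_nth j_def del: power_Suc)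
  thus ?case using step by simp
qed auto

lemma of_real_cubic_overpartition:
  assumes "n \<le> M"
  shows "complex_of_real (cubic_overpartition n) = fps_nth (cubic_over_fps M) n"
proof -
  have "complex_of_real (cubic_overpartition n) = fps_nth (of_real_fps (cubic_over_fps n)) n"
    unfolding cubic_overpartition_def cubic_over_fps_def of_real_fps_nth ..
  also have "of_real_fps (cubic_over_fps n) = (cubic_over_fps n :: complex fps)"
    unfolding cubic_over_fps_def of_real_fps_prod
    by (intro prod.cong refl) (simp add: of_real_fps_inverse fps_nth_cubic_over_denominator)
  finally show ?thesis using fps_nth_cubic_over_fps_mono[OF assms, where 'a = complex] by simp
qed

definition cubic_over_prod :: "nat \<Rightarrow> complex \<Rightarrow> complex" where
  "cubic_over_prod M q = (\<Prod>j\<in>{1..M}. (1 + q ^ j) * (1 + q ^ (2 * j)) * inverse ((1 - q ^ j) * (1 - q ^ (2 * j))))"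

lemma one_minus_power_nonzero:
  fixes q :: complex
  assumes "norm q < 1" "n > 0"
  shows "1 - q ^ n \<noteq> 0"
  using norm_one_minus_power_ge[OF assms] assms by auto

lemma cubic_over_prod_fps: "cubic_over_prod M has_fps_expansion cubic_over_fps M"
  unfolding cubic_over_prod_def cubic_over_fps_def
  by (intro fps_expansion_intros) auto

lemma cubic_over_prod_holomorphic: "cubic_over_prod M holomorphic_on ball 0 1"
  unfolding cubic_over_prod_def using one_minus_power_nonzero
  by (intro holomorphic_intros) auto

text \<open>Factor by factor this is 1 - x^4 = (1 - x)(1 + x)(1 + x^2); the exponential measures the
  effect of truncating at M.\<close>

lemma cubic_over_prod_eq:
  fixes q :: complex
  assumes q: "norm q < 1"
  shows "cubic_over_prod M q = cubic_over_gf q * exp (euler_log M (q ^ 4) - 2 * euler_log M q - euler_log M (q ^ 2))"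
proof -
  have q': "norm (q ^ m) < 1" if "m > 0" for m using q that by (simp add: norm_power power_less_one_iff)
  have "cubic_over_prod M q = (\<Prod>j = 1..M. (1 - (q ^ 4) ^ j) / ((1 - q ^ j) ^ 2 * (1 - (q ^ 2) ^ j)))"
    unfolding cubic_over_prod_def
  proof (intro prod.cong refl)
    fix j assume j: "j \<in> {1..M}"
    define x where "x = q ^ j"
    have x: "1 - x \<noteq> 0" "1 - x ^ 2 \<noteq> 0"
      using one_minus_power_nonzero[OF q, of j] one_minus_power_nonzero[OF q, of "j * 2"] j by (auto simp: x_def power_mult)
    have xs: "q ^ (2 * j) = x ^ 2" "(q ^ 2) ^ j = x ^ 2" "(q ^ 4) ^ j = x ^ 4"
      by (simp_all add: x_def flip: power_mult) (simp_all add: mult.commute)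
    have e4: "1 - x ^ 4 = (1 - x) * ((1 + x) * (1 + x ^ 2))"
      by (simp add: algebra_simps power2_eq_square power4_eq_xxxx)
    have can: "(1 - x ^ 4) / ((1 - x) ^ 2 * (1 - x ^ 2)) = (1 + x) * (1 + x ^ 2) / ((1 - x) * (1 - x ^ 2))"
    proof -
      have "(1 - x) * Y / ((1 - x) * (1 - x) * Z) = Y / ((1 - x) * Z)" for Y Z
        using x(1) by (simp add: mult.assoc)
      thus ?thesis unfolding e4 power2_eq_square[of "1 - x"] .
    qed
    show "(1 + q ^ j) * (1 + q ^ (2 * j)) * inverse ((1 - q ^ j) * (1 - q ^ (2 * j))) = (1 - (q ^ 4) ^ j) / ((1 - q ^ j) ^ 2 * (1 - (q ^ 2) ^ j))"
      unfolding xs x_def[symmetric] by (simp only: can) (simp only: divide_inverse)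
  qed
  also have "\<dots> = (\<Prod>j = 1..M. 1 - (q ^ 4) ^ j) / ((\<Prod>j = 1..M. 1 - q ^ j) ^ 2 * (\<Prod>j = 1..M. 1 - (q ^ 2) ^ j))"
    by (simp add: prod_dividef prod.distrib prod_power_distrib)
  also have "\<dots> = exp (euler_log M (q ^ 4) - euler_log 0 (q ^ 4)) / (exp (euler_log M q - euler_log 0 q) ^ 2 * exp (euler_log M (q ^ 2) - euler_log 0 (q ^ 2)))"
    by (simp only: prod_one_minus_power_eq q q' zero_less_numeral)
  also have "\<dots> = cubic_over_gf q * exp (euler_log M (q ^ 4) - 2 * euler_log M q - euler_log M (q ^ 2))"
    unfolding cubic_over_gf_def euler_phi_def exp_double[symmetric] exp_add[symmetric] exp_diff[symmetric]
    by (simp add: algebra_simps)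
  finally show ?thesis .
qed

lemma cubic_over_gf_holomorphic: "(\<lambda>t. cubic_over_gf (cexp2pi t)) holomorphic_on {t. Im t > 0}"
proof -
  have phi: "(\<lambda>t. euler_phi (cexp2pi t ^ m)) holomorphic_on {t. Im t > 0}" if "m > 0" for m
  proof (unfold cexp2pi_power, intro holomorphic_onI)
    fix t assume "t \<in> {t. Im t > 0}"
    hence t: "Im (of_nat m * t) > 0" using that by simp
    have "((\<lambda>t. euler_log 0 (cexp2pi (of_nat m * t))) has_field_derivative (- \<i> / (2 * of_real pi) * csc2_sum (of_nat m * t) * of_nat m)) (at t within {t. Im t > 0})"
      by (rule DERIV_chain2[where f = "\<lambda>t. euler_log 0 (cexp2pi t)" and g = "\<lambda>t. of_nat m * t", OF has_field_derivative_euler_log[OF t]]) (auto intro!: derivative_eq_intros)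
    note D = DERIV_chain2[where f = exp and g = "\<lambda>t. - euler_log 0 (cexp2pi (of_nat m * t))", OF DERIV_exp DERIV_minus[OF this]]
    show "(\<lambda>t. euler_phi (cexp2pi (of_nat m * t))) field_differentiable at t within {t. Im t > 0}"
      unfolding euler_phi_def field_differentiable_def by (rule exI, rule D)
  qed
  show ?thesis
    unfolding cubic_over_gf_def using phi[of 1] phi[of 2] phi[of 4]
    by (intro holomorphic_on_divide holomorphic_on_mult holomorphic_on_power) (auto simp: euler_phi_def)
qed

text \<open>Cauchy's coefficient formula in the variable t: the circle of radius exp(-2 \<pi> c)
  unrolls to a horizontal segment of length 1, and dq = 2 \<pi> i q dt cancels one power of
  q.\<close>

lemma has_contour_integral_fps_coeff:
  assumes holo: "f holomorphic_on ball 0 1" and fps: "f has_fps_expansion F" and c: "c > 0"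
  shows "((\<lambda>t. f (cexp2pi t) * cexp2pi (- of_nat n * t)) has_contour_integral fps_nth F n)
           (linepath (\<i> * of_real c) (\<i> * of_real c + 1))"
proof -
  define \<rho> where "\<rho> = exp (- 2 * pi * c)"
  have \<rho>: "0 < \<rho>" "\<rho> < 1" using c by (auto simp: \<rho>_def)
  have "continuous_on (cball 0 \<rho>) f" "f holomorphic_on ball 0 \<rho>"
    using \<rho> by (auto intro!: holomorphic_on_imp_continuous_on intro: holomorphic_on_subset[OF holo])
  from Cauchy_has_contour_integral_higher_derivative_circlepath[OF this, of 0 n] \<rho>
  have "((\<lambda>u. f u / u ^ Suc n) has_contour_integral 2 * of_real pi * \<i> * fps_nth F n) (circlepath 0 \<rho>)"
    by (simp add: fps_nth_fps_expansion[OF fps])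
  hence "((\<lambda>x. f (circlepath 0 \<rho> x) / circlepath 0 \<rho> x ^ Suc n * vector_derivative (circlepath 0 \<rho>) (at x))
           has_integral 2 * of_real pi * \<i> * fps_nth F n) {0..1}"
    by (simp only: has_contour_integral)
  also have "(\<lambda>x. f (circlepath 0 \<rho> x) / circlepath 0 \<rho> x ^ Suc n * vector_derivative (circlepath 0 \<rho>) (at x)) =
    (\<lambda>x. 2 * of_real pi * \<i> * (f (cexp2pi (\<i> * of_real c + of_real x)) * cexp2pi (- of_nat n * (\<i> * of_real c + of_real x))))"
  proof
    fix x :: real
    define u where "u = cexp2pi (\<i> * of_real c + of_real x)"
    have u: "circlepath 0 \<rho> x = u"
    proof -
      have "u = exp (of_real (- 2 * pi * c) + 2 * of_real pi * \<i> * of_real x)"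
        by (simp add: u_def cexp2pi_def distrib_left mult_ac)
      thus ?thesis by (simp only: exp_add exp_of_real) (simp add: circlepath \<rho>_def)
    qed
    have vd: "vector_derivative (circlepath 0 \<rho>) (at x) = 2 * of_real pi * \<i> * u"
      using u by (simp only: vector_derivative_circlepath) (simp add: circlepath)
    have inv: "cexp2pi (- of_nat n * (\<i> * of_real c + of_real x)) = inverse (u ^ n)"
      by (simp add: u_def cexp2pi_power) (simp add: cexp2pi_def exp_minus[symmetric])
    moreover have "u \<noteq> 0" by (simp add: u_def cexp2pi_def)
    ultimately show "f (circlepath 0 \<rho> x) / circlepath 0 \<rho> x ^ Suc n * vector_derivative (circlepath 0 \<rho>) (at x) =
      2 * of_real pi * \<i> * (f (cexp2pi (\<i> * of_real c + of_real x)) * cexp2pi (- of_nat n * (\<i> * of_real c + of_real x)))"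
      unfolding vd u u_def[symmetric] inv by (simp add: field_simps)
  qed
  finally have I: "((\<lambda>x. 2 * of_real pi * \<i> * (f (cexp2pi (\<i> * of_real c + of_real x)) * cexp2pi (- of_nat n * (\<i> * of_real c + of_real x))))
     has_integral 2 * of_real pi * \<i> * fps_nth F n) {0..1}" .
  have "((\<lambda>x. f (cexp2pi (\<i> * of_real c + of_real x)) * cexp2pi (- of_nat n * (\<i> * of_real c + of_real x))) has_integral fps_nth F n) {0..1}"
    using has_integral_mult_right[OF I, of "1 / (2 * of_real pi * \<i>)"] by simp
  thus ?thesis
    unfolding has_contour_integral_linepath by (simp add: linepath_def algebra_simps scaleR_conv_of_real)
qed

text \<open>For M >= n the truncated product already has the exact n-th coefficient, so its integral
  does not depend on M. It differs from the full function by the exponential of tails that vanish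
  uniformly on the segment, so the power series of the infinite product never has to be
  identified.\<close>

lemma cubic_overpartition_contour_integral:
  assumes c: "c > 0"
  shows "((\<lambda>t. cubic_over_gf (cexp2pi t) * cexp2pi (- of_nat n * t)) has_contour_integral of_real (cubic_overpartition n))
           (linepath (\<i> * of_real c) (\<i> * of_real c + 1))"
proof -
  define L where "L = linepath (\<i> * of_real c) (\<i> * of_real c + 1)"
  define S where "S = closed_segment (\<i> * of_real c) (\<i> * of_real c + 1)"
  define H where "H = (\<lambda>t. cubic_over_gf (cexp2pi t) * cexp2pi (- of_nat n * t))"
  define \<rho> where "\<rho> = exp (- 2 * pi * c)"
  have \<rho>: "0 < \<rho>" "\<rho> < 1" using c by (auto simp: \<rho>_def)
  have S: "Im t = c" if "t \<in> S" for t
    using that by (auto simp: S_def closed_segment_same_Im)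
  have cont: "continuous_on S H"
  proof -
    have "(\<lambda>t. cexp2pi (- of_nat n * t)) holomorphic_on {t. Im t > 0}"
      unfolding cexp2pi_def by (intro holomorphic_intros)
    hence "H holomorphic_on {t. Im t > 0}"
      unfolding H_def by (intro holomorphic_on_mult cubic_over_gf_holomorphic)
    thus ?thesis
      by (rule continuous_on_subset[OF holomorphic_on_imp_continuous_on]) (use S c in auto)
  qed
  have H_int: "H contour_integrable_on L"
    unfolding L_def by (rule contour_integrable_continuous_linepath) (use cont in \<open>simp add: S_def\<close>)
  obtain C where C: "\<And>t. t \<in> S \<Longrightarrow> norm (H t) \<le> C"
  proof -
    have "compact (H ` S)" by (intro compact_continuous_image cont) (simp add: S_def)
    thus ?thesis using that by (meson bounded_iff compact_imp_bounded imageI)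
  qed
  have "\<i> * of_real c \<in> S" by (simp add: S_def)
  from order.trans[OF norm_ge_zero C[OF this]] have C0: "C \<ge> 0" .
  \<comment> \<open>4 = 1 + 2 + 1, the multiplicities of the tails at q^4, q and q^2.\<close>
  define \<epsilon> where "\<epsilon> = (\<lambda>M. 4 * \<rho> ^ Suc M / (1 - \<rho>)\<^sup>2)"
  have bound: "norm (of_real (cubic_overpartition n) - contour_integral L H) \<le> C * (\<epsilon> M * exp (\<epsilon> M))" if M: "n \<le> M" for M
  proof -
    define h where "h = (\<lambda>t. cubic_over_prod M (cexp2pi t) * cexp2pi (- of_nat n * t))"
    have h: "(h has_contour_integral of_real (cubic_overpartition n)) L"
      unfolding h_def L_def of_real_cubic_overpartition[OF M]
      by (rule has_contour_integral_fps_coeff[OF cubic_over_prod_holomorphic cubic_over_prod_fps c])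
    have "((\<lambda>t. h t - H t) has_contour_integral (of_real (cubic_overpartition n) - contour_integral L H)) L"
      by (intro has_contour_integral_diff h has_contour_integral_integral H_int)
    hence d: "((\<lambda>t. h t - H t) has_contour_integral (of_real (cubic_overpartition n) - contour_integral L H)) (linepath (\<i> * of_real c) (\<i> * of_real c + 1))"
      by (simp only: L_def[symmetric])
    have "norm (of_real (cubic_overpartition n) - contour_integral L H) \<le> C * (\<epsilon> M * exp (\<epsilon> M)) * norm ((\<i> * of_real c + 1) - \<i> * of_real c)"
    proof (rule has_contour_integral_bound_linepath[OF d, folded S_def])
      show "0 \<le> C * (\<epsilon> M * exp (\<epsilon> M))" using C0 \<rho> by (simp add: \<epsilon>_def)
      fix t assume t: "t \<in> S"
      define q where "q = cexp2pi t"
      have nq: "norm q = \<rho>" using S[OF t] by (simp add: q_def norm_cexp2pi \<rho>_def)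
      define u where "u = euler_log M (q ^ 4) - 2 * euler_log M q - euler_log M (q ^ 2)"
      have el: "norm (euler_log M (q ^ m)) \<le> \<rho> ^ Suc M / (1 - \<rho>)\<^sup>2" if "m > 0" for m
      proof -
        have le: "norm (q ^ m) \<le> \<rho>"
          using power_decreasing[of 1 m \<rho>] that \<rho> by (simp add: norm_power nq)
        hence "norm (euler_log M (q ^ m)) \<le> norm (q ^ m) ^ Suc M / (1 - norm (q ^ m))\<^sup>2"
          using \<rho> by (intro norm_euler_log_le) linarith
        also have "\<dots> \<le> \<rho> ^ Suc M / (1 - \<rho>)\<^sup>2"
          using le \<rho> by (intro frac_le power_mono) auto
        finally show ?thesis .
      qed
      have "norm u \<le> norm (euler_log M (q ^ 4)) + norm (2 * euler_log M q) + norm (euler_log M (q ^ 2))"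
        unfolding u_def by (intro order.trans[OF norm_triangle_ineq4] add_mono order.refl)
      also have "\<dots> \<le> \<epsilon> M" using el[of 1] el[of 2] el[of 4] by (simp add: norm_mult \<epsilon>_def)
      finally have u: "norm u \<le> \<epsilon> M" .
      have "cubic_over_prod M q = cubic_over_gf q * exp u"
        unfolding u_def using nq \<rho> by (intro cubic_over_prod_eq) auto
      hence "h t - H t = H t * (exp u - 1)"
        by (simp add: h_def H_def q_def[symmetric] algebra_simps)
      also have "norm \<dots> \<le> C * (norm u * exp (norm u))"
        unfolding norm_mult using C[OF t] C0 by (intro mult_mono norm_exp_minus_one_le) auto
      also have "\<dots> \<le> C * (\<epsilon> M * exp (\<epsilon> M))"
        using u C0 order.trans[OF norm_ge_zero u] by (intro mult_left_mono mult_mono) auto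
      finally show "norm (h t - H t) \<le> C * (\<epsilon> M * exp (\<epsilon> M))" .
    qed
    thus ?thesis by simp
  qed
  have "(\<lambda>M. \<rho> ^ Suc M) \<longlonglongrightarrow> 0" using \<rho> by (intro LIMSEQ_Suc LIMSEQ_power_zero) auto
  hence "\<epsilon> \<longlonglongrightarrow> 4 * 0 / (1 - \<rho>)\<^sup>2" unfolding \<epsilon>_def using \<rho> by (intro tendsto_intros) auto
  hence eps: "\<epsilon> \<longlonglongrightarrow> 0" by simp
  have "(\<lambda>M. C * (\<epsilon> M * exp (\<epsilon> M))) \<longlonglongrightarrow> C * (0 * exp 0)" by (intro tendsto_intros eps)
  hence "norm (of_real (cubic_overpartition n) - contour_integral L H) \<le> C * (0 * exp 0)"
    by (rule tendsto_lowerbound) (auto intro!: eventually_mono[OF eventually_ge_at_top[of n]] bound)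
  hence "contour_integral L H = of_real (cubic_overpartition n)" by simp
  thus ?thesis using has_contour_integral_integral[OF H_int] by (simp add: L_def H_def)
qed

subsection \<open>The circle method\<close>

text \<open>If 4 divides k, then \<open>cusp_polar k\<close> vanishes and the value of \<open>cusp_exponent k\<close> is irrelevant.\<close>

definition cusp_exponent :: "nat \<Rightarrow> real" where
  "cusp_exponent k = (if odd k then 3 * pi / 16 else pi / 4)"

definition cusp_polar :: "nat \<Rightarrow> real" where
  "cusp_polar k = (if 4 dvd k then 0 else 1)"

text \<open>k sqrt(k2 / (2 k4)), where k2 and k4 are the reduced denominators of 2h/k and 4h/k: k2 =
  k4 unless 4 divides k, and then k2 = 2 k4.\<close>

definition cusp_scale :: "nat \<Rightarrow> real" where
  "cusp_scale k = (if 4 dvd k then real k else real k / sqrt 2)"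

definition cusp_phase :: "nat \<Rightarrow> nat \<Rightarrow> real" where
  "cusp_phase h k = 2 * dedekind_sum (int h) k +
     (if odd k then dedekind_sum (2 * int h) k - dedekind_sum (4 * int h) k
      else if 4 dvd k then dedekind_sum (int h) (k div 2) - dedekind_sum (int h) (k div 4)
      else dedekind_sum (int h) (k div 2) - dedekind_sum (2 * int h) (k div 2))"

text \<open>The reduced denominators of 2h/k and 4h/k are k, k for odd k, then k/2, k/2 for k = 2
  mod 4, and k/2, k/4 for 4 | k. The exponent is \<pi>/12 times 2 + 1/2 - 1/4, 2 + 2 - 1 and 2 + 2 -
  4 respectively, that is 3\<pi>/16, \<pi>/4 and 0. The multiplicative error Q becomes an additive
  one because the decay rate \<pi>/(2 k^2) of Q - 1 beats the growth rate, at most \<pi>/(4 k^2), of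
  the exponential.\<close>

lemma cubic_over_gf_at_cusp:
  fixes h k :: nat and w :: complex
  assumes k: "k > 0" and cop: "coprime h k" and w: "Re w > 0" "Re (1 / w) \<ge> real k ^ 2 / 2"
  shows "\<exists>E. cubic_over_gf (cexp2pi (of_real (real h / real k) + \<i> * w)) =
     exp (of_real pi * \<i> * of_real (cusp_phase h k)) * of_real (cusp_scale k) * w *
     (of_real (cusp_polar k) * exp (of_real (cusp_exponent k / real k ^ 2) / w) + E) \<and> norm E \<le> 1 + 16 * exp 8"
proof -
  define F where "F = cubic_over_gf (cexp2pi (of_real (real h / real k) + \<i> * w))"
  define X where "X = Re (1 / w)"
  have X: "X \<ge> 0" using w(2) order.trans[of 0 "real k ^ 2 / 2" X] by (simp add: X_def)
  have small: "exp (- pi / (2 * real k ^ 2) * X) \<le> 1"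
    using X by (auto intro!: divide_nonneg_nonneg mult_nonneg_nonneg)
  have polar: ?thesis
    if \<alpha>: "cusp_polar k = 1" "cusp_exponent k \<le> pi / 4" and
       ex: "\<exists>Q. F = exp (of_real pi * \<i> * of_real (cusp_phase h k)) * of_real (cusp_scale k) * w *
         exp (of_real (cusp_exponent k / real k ^ 2) / w) * Q \<and> norm (Q - 1) \<le> 16 * exp 8 * exp (- pi / (2 * real k ^ 2) * X)"
  proof -
    from ex obtain Q where Q: "F = exp (of_real pi * \<i> * of_real (cusp_phase h k)) * of_real (cusp_scale k) * w *
         exp (of_real (cusp_exponent k / real k ^ 2) / w) * Q" "norm (Q - 1) \<le> 16 * exp 8 * exp (- pi / (2 * real k ^ 2) * X)" by blast
    define E where "E = exp (of_real (cusp_exponent k / real k ^ 2) / w) * (Q - 1)"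
    have "Re (of_real (cusp_exponent k / real k ^ 2) / w) = Re (of_real (cusp_exponent k / real k ^ 2) * (1 / w))" by simp
    also have "\<dots> = cusp_exponent k / real k ^ 2 * X"
      by (simp only: times_complex.sel Re_complex_of_real Im_complex_of_real mult_zero_left diff_zero X_def)
    also have "\<dots> \<le> (pi / 4) / real k ^ 2 * X"
      using \<alpha>(2) X by (intro mult_right_mono divide_right_mono) auto
    also have "\<dots> \<le> (pi / 2) / real k ^ 2 * X"
      using X by (intro mult_right_mono divide_right_mono) auto
    finally have re: "Re (of_real (cusp_exponent k / real k ^ 2) / w) \<le> pi / (2 * real k ^ 2) * X" by simp
    have "norm E \<le> exp (pi / (2 * real k ^ 2) * X) * (16 * exp 8 * exp (- pi / (2 * real k ^ 2) * X))"
      unfolding E_def norm_mult norm_exp_eq_Re using re Q(2) by (intro mult_mono) auto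
    also have "\<dots> = 16 * exp 8 * exp (pi / (2 * real k ^ 2) * X + - pi / (2 * real k ^ 2) * X)"
      by (simp only: exp_add mult_ac)
    also have "\<dots> = 16 * exp 8" by simp
    finally have E: "norm E \<le> 1 + 16 * exp 8" by simp
    have "F = exp (of_real pi * \<i> * of_real (cusp_phase h k)) * of_real (cusp_scale k) * w *
      (of_real (cusp_polar k) * exp (of_real (cusp_exponent k / real k ^ 2) / w) + E)"
      unfolding Q(1) \<alpha>(1) E_def by (simp add: algebra_simps)
    with E show ?thesis unfolding F_def by blast
  qed
  have half: "sqrt (1 / 2) = 1 / sqrt 2" by (simp add: real_sqrt_divide)
  consider "odd k" | "even k" "\<not> 4 dvd k" | "4 dvd k" by blast
  thus ?thesis
  proof cases
    case 1
    have ex: "\<exists>Q. F = exp (of_real pi * \<i> * of_real (2 * dedekind_sum (int h) k + dedekind_sum (int (2 * h)) k - dedekind_sum (int (4 * h)) k)) *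
     of_real (real k * sqrt (real k / (2 * real k))) * w *
     exp (of_real (pi / 12 * (2 / real k ^ 2 + 1 / (2 * real k ^ 2) - 1 / (4 * real k ^ 2))) / w) * Q \<and>
     norm (Q - 1) \<le> 16 * exp 8 * exp (- pi / (2 * real k ^ 2) * X)"
      unfolding F_def X_def
    proof (rule cubic_over_gf_near_cusp)
      have "coprime (2 ^ 2) k" using 1 by (intro coprime_power_left_iff[THEN iffD2]) (auto simp: coprime_left_2_iff_odd)
      thus "coprime (2 * h) k" "coprime (4 * h) k"
        using cop 1 by (auto simp: coprime_mult_left_iff coprime_left_2_iff_odd)
    qed (use k cop w in auto)
    have e1: "pi / 12 * (2 / real k ^ 2 + 1 / (2 * real k ^ 2) - 1 / (4 * real k ^ 2)) = cusp_exponent k / real k ^ 2"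
      using 1 k by (simp add: cusp_exponent_def field_simps)
    have k4: "\<not> 4 dvd k" using 1 by (meson dvd_trans even_numeral)
    have e2: "real k * sqrt (real k / (2 * real k)) = cusp_scale k"
      using 1 k k4 half by (simp add: cusp_scale_def)
    have e3: "2 * dedekind_sum (int h) k + dedekind_sum (int (2 * h)) k - dedekind_sum (int (4 * h)) k = cusp_phase h k"
      using 1 by (simp add: cusp_phase_def)
    show ?thesis
      by (rule polar[OF _ _ ex[unfolded e1 e2 e3]]) (use 1 k4 in \<open>auto simp: cusp_polar_def cusp_exponent_def\<close>)
  next
    case 2
    define m where "m = k div 2"
    have m: "k = 2 * m" "odd m" "m > 0" using 2 k by (auto simp: m_def)
    have copm: "coprime h m" using cop m(1) by simp
    have ex: "\<exists>Q. F = exp (of_real pi * \<i> * of_real (2 * dedekind_sum (int h) k + dedekind_sum (int h) m - dedekind_sum (int (2 * h)) m)) *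
     of_real (real k * sqrt (real m / (2 * real m))) * w *
     exp (of_real (pi / 12 * (2 / real k ^ 2 + 1 / (2 * real m ^ 2) - 1 / (4 * real m ^ 2))) / w) * Q \<and>
     norm (Q - 1) \<le> 16 * exp 8 * exp (- pi / (2 * real k ^ 2) * X)"
      unfolding F_def X_def
    proof (rule cubic_over_gf_near_cusp)
      show "coprime (2 * h) m" using copm m by (auto simp: coprime_mult_left_iff coprime_left_2_iff_odd)
    qed (use m cop copm w in auto)
    have e1: "pi / 12 * (2 / real k ^ 2 + 1 / (2 * real m ^ 2) - 1 / (4 * real m ^ 2)) = cusp_exponent k / real k ^ 2"
      using m by (simp add: cusp_exponent_def field_simps)
    have e2: "real k * sqrt (real m / (2 * real m)) = cusp_scale k"
      using 2 m half by (simp add: cusp_scale_def)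
    have e3: "2 * dedekind_sum (int h) k + dedekind_sum (int h) m - dedekind_sum (int (2 * h)) m = cusp_phase h k"
      using 2 by (simp add: cusp_phase_def m_def)
    show ?thesis
      by (rule polar[OF _ _ ex[unfolded e1 e2 e3]]) (use 2 in \<open>auto simp: cusp_polar_def cusp_exponent_def\<close>)
  next
    case 3
    define m where "m = k div 4"
    have m: "k = 4 * m" "m > 0" using 3 k by (auto simp: m_def elim!: dvdE)
    have copm: "coprime h m" "coprime h (2 * m)" using cop m(1) by (auto simp: coprime_mult_right_iff)
    have ex: "\<exists>Q. F = exp (of_real pi * \<i> * of_real (2 * dedekind_sum (int h) k + dedekind_sum (int h) (2 * m) - dedekind_sum (int h) m)) *
     of_real (real k * sqrt (real (2 * m) / (2 * real m))) * w *
     exp (of_real (pi / 12 * (2 / real k ^ 2 + 1 / (2 * real (2 * m) ^ 2) - 1 / (4 * real m ^ 2))) / w) * Q \<and>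
     norm (Q - 1) \<le> 16 * exp 8 * exp (- pi / (2 * real k ^ 2) * X)"
      unfolding F_def X_def
      by (rule cubic_over_gf_near_cusp) (use m cop copm w in auto)
    have e1: "pi / 12 * (2 / real k ^ 2 + 1 / (2 * real (2 * m) ^ 2) - 1 / (4 * real m ^ 2)) = 0"
      using m by (simp add: field_simps)
    have e2: "real k * sqrt (real (2 * m) / (2 * real m)) = cusp_scale k"
      using 3 m by (simp add: cusp_scale_def)
    have e3: "2 * dedekind_sum (int h) k + dedekind_sum (int h) (2 * m) - dedekind_sum (int h) m = cusp_phase h k"
      using 3 m by (simp add: cusp_phase_def)
    from ex[unfolded e1 e2 e3] obtain Q where Q: "F = exp (of_real pi * \<i> * of_real (cusp_phase h k)) * of_real (cusp_scale k) * w * Q"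
       "norm (Q - 1) \<le> 16 * exp 8 * exp (- pi / (2 * real k ^ 2) * X)" by auto
    have "norm Q \<le> 1 + norm (Q - 1)" using norm_triangle_ineq[of 1 "Q - 1"] by simp
    also have "norm (Q - 1) \<le> 16 * exp 8 * 1" using Q(2) small by (rule order.trans[OF _ mult_left_mono]) auto
    finally show ?thesis using Q(1) 3 unfolding F_def by (intro exI[of _ Q]) (simp add: cusp_polar_def)
  qed
qed

text \<open>The arc integral is -i times an integral in w, so 2 \<pi> i times the residue becomes 2
  \<pi> times it. The number 2 \<pi> n is the B of the residue, supplied by
  \<open>cexp2pi (- of_nat n * t)\<close>.\<close>

definition rademacher_term :: "nat \<Rightarrow> nat \<Rightarrow> nat \<Rightarrow> complex" where
  "rademacher_term n h k = exp (of_real pi * \<i> * of_real (cusp_phase h k) - 2 * of_real pi * \<i> * of_nat n * of_nat h / of_nat k) *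
     of_real (cusp_scale k * cusp_polar k) * (2 * of_real pi * of_real (cusp_exponent k / real k ^ 2 / (2 * pi * real n) *
       bessel_I 2 (2 * sqrt (cusp_exponent k / real k ^ 2 * (2 * pi * real n)))))"

lemma cexp2pi_minus_nat_mult:
  assumes "k > 0"
  shows "cexp2pi (- of_nat n * (of_real (real h / real k) + \<i> * w)) =
    exp (- 2 * of_real pi * \<i> * of_nat n * of_nat h / of_nat k) * exp (of_real (2 * pi * real n) * w)"
proof -
  have "2 * of_real pi * \<i> * (- of_nat n * (of_real (real h / real k) + \<i> * w)) =
    - 2 * of_real pi * \<i> * of_nat n * of_nat h / of_nat k + of_real (2 * pi * real n) * w"
    by (simp add: algebra_simps)
  thus ?thesis by (simp only: cexp2pi_def exp_add)
qed

lemma sum_coprime_pairs: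
  fixes F :: "nat \<Rightarrow> nat \<Rightarrow> 'a :: comm_monoid_add"
  shows "(\<Sum>(h, k)\<in>{(h, k). h < k \<and> k \<le> N \<and> coprime h k}. F h k) = (\<Sum>k=1..N. \<Sum>h | h < k \<and> coprime h k. F h k)"
proof -
  have "{(h, k). h < k \<and> k \<le> N \<and> coprime h k} = (\<lambda>(k, h). (h, k)) ` (SIGMA k:{1..N}. {h. h < k \<and> coprime h k})"
    by (auto simp: image_iff)
  thus ?thesis
    by (simp only:) (subst sum.reindex, auto simp: inj_on_def sum.Sigma case_prod_unfold)
qed

text \<open>Working with a primitive \<Phi> on the upper half-plane turns the dissection into
  telescoping differences of endpoint values. Since the integrand has period 1, \<Phi> gains a
  constant \<open>a\<close> per period, and this constant is the coefficient sought.\<close>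

lemma circle_method_estimate:
  fixes n N :: nat
  assumes n: "n \<ge> 1" and N: "N \<ge> 1"
  defines "C \<equiv> 12 * exp (pi + 2 * pi * real n) + 4 * (1 + 16 * exp 8) * exp (2 * pi * real n)"
  shows "norm (of_real (cubic_overpartition n) - (\<Sum>k=1..N. \<Sum>h | h < k \<and> coprime h k. rademacher_term n h k)) \<le> C / real N"
proof -
  define U where "U = {t. Im t > 0}"
  define f where "f = (\<lambda>t. cubic_over_gf (cexp2pi t) * cexp2pi (- of_nat n * t))"
  have U: "convex U" "open U" by (auto simp: U_def convex_halfspace_Im_gt open_halfspace_Im_gt)
  have holo: "f holomorphic_on U"
  proof -
    have "(\<lambda>t. cexp2pi (- of_nat n * t)) holomorphic_on U"
      unfolding cexp2pi_def by (intro holomorphic_intros)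
    thus ?thesis unfolding f_def U_def by (intro holomorphic_on_mult cubic_over_gf_holomorphic)
  qed
  obtain \<Phi> where \<Phi>: "\<And>t. t \<in> U \<Longrightarrow> (\<Phi> has_field_derivative f t) (at t within U)"
    using holomorphic_convex_primitive'[OF U holo] by blast
  have per: "f (t + 1) = f t" for t
  proof -
    have "cexp2pi (t + of_int 1) = cexp2pi t" "cexp2pi (- of_nat n * t + of_int (- int n)) = cexp2pi (- of_nat n * t)"
      by (rule cexp2pi_add_of_int)+
    thus ?thesis by (simp add: f_def algebra_simps)
  qed
  have "\<exists>a. \<forall>t\<in>U. \<Phi> (t + 1) - \<Phi> t = a"
  proof (rule has_field_derivative_zero_constant[OF U(1)])
    fix t assume t: "t \<in> U"
    hence t1: "t + 1 \<in> U" by (simp add: U_def)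
    have "(\<Phi> has_field_derivative f (t + 1)) (at (t + 1))" "(\<Phi> has_field_derivative f t) (at t)"
      using \<Phi>[OF t1] \<Phi>[OF t] at_within_open[OF t1 U(2)] at_within_open[OF t U(2)] by simp_all
    hence "((\<lambda>t. \<Phi> (t + 1) - \<Phi> t) has_field_derivative f (t + 1) * 1 - f t) (at t)"
      by (intro DERIV_diff DERIV_chain2[where f = \<Phi> and g = "\<lambda>t. t + 1"]) (auto intro!: derivative_eq_intros)
    thus "((\<lambda>t. \<Phi> (t + 1) - \<Phi> t) has_field_derivative 0) (at t within U)"
      by (simp add: per has_field_derivative_at_within)
  qed
  then obtain a where a: "\<And>t. t \<in> U \<Longrightarrow> \<Phi> (t + 1) - \<Phi> t = a" by blast
  define c where "c = 1 / real N ^ 2"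
  have c: "c > 0" using N by (simp add: c_def)
  have a_eq: "a = of_real (cubic_overpartition n)"
  proof -
    have "closed_segment (\<i> * of_real c) (\<i> * of_real c + 1) \<subseteq> U"
      using c by (auto simp: U_def closed_segment_same_Im)
    hence "(f has_contour_integral \<Phi> (\<i> * of_real c + 1) - \<Phi> (\<i> * of_real c)) (linepath (\<i> * of_real c) (\<i> * of_real c + 1))"
      using contour_integral_primitive[of U \<Phi> f "linepath (\<i> * of_real c) (\<i> * of_real c + 1)"] \<Phi> by simp
    moreover have "\<i> * of_real c \<in> U" using c by (simp add: U_def)
    ultimately show ?thesis
      using cubic_overpartition_contour_integral[OF c, of n] a has_contour_integral_unique unfolding f_def by metis
  qed
  define L where "L = {(h, k). h < k \<and> k \<le> N \<and> coprime h k}"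
  obtain \<theta>1 \<theta>2 :: "nat \<Rightarrow> nat \<Rightarrow> real" where th:
    "\<And>h k. (h, k) \<in> L \<Longrightarrow> 1 / (2 * real k * real N) \<le> \<theta>1 h k \<and> \<theta>1 h k \<le> 1 / (real k * real N)"
    "\<And>h k. (h, k) \<in> L \<Longrightarrow> 1 / (2 * real k * real N) \<le> \<theta>2 h k \<and> \<theta>2 h k \<le> 1 / (real k * real N)"
    "\<And>(G :: real \<Rightarrow> complex) D. (\<And>x. G (x + 1) - G x = D) \<Longrightarrow>
       (\<Sum>(h, k)\<in>L. G (real h / real k + \<theta>2 h k) - G (real h / real k - \<theta>1 h k)) = D"
    using farey_dissection[OF N, folded L_def] by blast
  define G where "G = (\<lambda>x. \<Phi> (of_real x + \<i> * of_real c))"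
  have "G (x + 1) - G x = a" for x
    using a[of "of_real x + \<i> * of_real c"] c by (simp add: G_def U_def add_ac)
  hence sum_a: "(\<Sum>(h, k)\<in>L. G (real h / real k + \<theta>2 h k) - G (real h / real k - \<theta>1 h k)) = a"
    by (rule th(3))
  have arc: "norm (G (real h / real k + \<theta>2 h k) - G (real h / real k - \<theta>1 h k) - rademacher_term n h k) \<le> C / (real k * real N ^ 2)"
    if hk: "(h, k) \<in> L" for h k
  proof -
    have k: "1 \<le> k" "k \<le> N" "coprime h k" using hk by (auto simp: L_def)
    note t1 = th(1)[OF hk, THEN conjunct1] th(1)[OF hk, THEN conjunct2]
    note t2 = th(2)[OF hk, THEN conjunct1] th(2)[OF hk, THEN conjunct2]
    define S where "S = closed_segment (Complex (1 / real N ^ 2) (- \<theta>2 h k)) (Complex (1 / real N ^ 2) (\<theta>1 h k))"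
    define P where "P = linepath (Complex (1 / real N ^ 2) (- \<theta>2 h k)) (Complex (1 / real N ^ 2) (\<theta>1 h k))"
    define g where "g = (\<lambda>w. f (of_real (real h / real k) + \<i> * w))"
    note pts = farey_arc_points[OF k(1,2) t1 t2, folded S_def]
    have w0: "Re w > 0" if "w \<in> S" for w using pts(1)[OF that] N by simp
    define \<zeta> where "\<zeta> = exp (of_real pi * \<i> * of_real (cusp_phase h k) - 2 * of_real pi * \<i> * of_nat n * of_nat h / of_nat k)"
    define \<Psi> where "\<Psi> = (\<lambda>w. - \<i> * \<Phi> (of_real (real h / real k) + \<i> * w))"
    have prim: "(g has_contour_integral (\<Psi> (Complex (1 / real N ^ 2) (\<theta>1 h k)) - \<Psi> (Complex (1 / real N ^ 2) (- \<theta>2 h k)))) P"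
    proof -
      have "(\<Psi> has_field_derivative g w) (at w within {w. Re w > 0})" if "w \<in> {w. Re w > 0}" for w
      proof -
        have tU: "of_real (real h / real k) + \<i> * w \<in> U" using that by (simp add: U_def)
        have "(\<Phi> has_field_derivative f (of_real (real h / real k) + \<i> * w)) (at (of_real (real h / real k) + \<i> * w))"
          using \<Phi>[OF tU] at_within_open[OF tU U(2)] by simp
        hence "((\<lambda>w. \<Phi> (of_real (real h / real k) + \<i> * w)) has_field_derivative f (of_real (real h / real k) + \<i> * w) * \<i>) (at w within {w. Re w > 0})"
          by (rule DERIV_chain2[where f = \<Phi> and g = "\<lambda>w. of_real (real h / real k) + \<i> * w"]) (auto intro!: derivative_eq_intros)
        moreover have "- \<i> * (y * \<i>) = y" for y by (simp add: mult.left_commute)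
        ultimately show ?thesis
          using DERIV_cmult[of "\<lambda>w. \<Phi> (of_real (real h / real k) + \<i> * w)" _ w _ "- \<i>"]
          unfolding \<Psi>_def g_def by metis
      qed
      from contour_integral_primitive[OF this, of P] show ?thesis
        using w0 by (auto simp: P_def S_def)
    qed
    \<comment> \<open>With t = h/k + i w, Im w is minus the horizontal displacement:
      \<open>P\<close> runs through the arc from right to left, which explains the endpoints and the
      sign.\<close>
    have J: "G (real h / real k + \<theta>2 h k) - G (real h / real k - \<theta>1 h k) = - \<i> * contour_integral P g"
    proof -
      have "of_real (real h / real k) + \<i> * Complex (1 / real N ^ 2) (- \<theta>2 h k) = of_real (real h / real k + \<theta>2 h k) + \<i> * of_real c"
           "of_real (real h / real k) + \<i> * Complex (1 / real N ^ 2) (\<theta>1 h k) = of_real (real h / real k - \<theta>1 h k) + \<i> * of_real c"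
        by (simp_all add: complex_eq_iff c_def)
      thus ?thesis unfolding contour_integral_unique[OF prim] \<Psi>_def G_def
        by (simp only:) (simp add: algebra_simps)
    qed
    have "norm (contour_integral P g - \<zeta> * of_real (cusp_scale k * cusp_polar k) *
       (2 * of_real pi * \<i> * of_real (cusp_exponent k / real k ^ 2 / (2 * pi * real n) *
       bessel_I 2 (2 * sqrt (cusp_exponent k / real k ^ 2 * (2 * pi * real n))))))
     \<le> (12 * exp (pi + 2 * pi * real n) + 4 * (1 + 16 * exp 8) * exp (2 * pi * real n)) / (real k * real N ^ 2)"
      unfolding P_def
    proof (rule farey_arc_integral[OF k(1,2) t1 t2, folded S_def])
      show "0 < cusp_exponent k" "cusp_exponent k \<le> pi / 4" by (auto simp: cusp_exponent_def)
      show "0 < 2 * pi * real n" using n by simp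
      show "norm \<zeta> = 1" by (simp add: \<zeta>_def)
      show "0 \<le> cusp_scale k" "cusp_scale k \<le> real k"
        by (auto simp: cusp_scale_def divide_le_eq mult_le_cancel_left1)
      show "cusp_polar k \<in> {0, 1}" by (auto simp: cusp_polar_def)
      show "g contour_integrable_on linepath (Complex (1 / real N ^ 2) (- \<theta>2 h k)) (Complex (1 / real N ^ 2) (\<theta>1 h k))"
        using prim has_contour_integral_integrable unfolding P_def by blast
      fix w assume w: "w \<in> S"
      from cubic_over_gf_at_cusp[OF _ k(3) w0[OF w] pts(5)[OF w]] k obtain E where E:
        "cubic_over_gf (cexp2pi (of_real (real h / real k) + \<i> * w)) =
         exp (of_real pi * \<i> * of_real (cusp_phase h k)) * of_real (cusp_scale k) * w *
         (of_real (cusp_polar k) * exp (of_real (cusp_exponent k / real k ^ 2) / w) + E)" "norm E \<le> 1 + 16 * exp 8" by auto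
      have "\<zeta> = exp (of_real pi * \<i> * of_real (cusp_phase h k)) * exp (- 2 * of_real pi * \<i> * of_nat n * of_nat h / of_nat k)"
        unfolding \<zeta>_def exp_add[symmetric] by simp
      hence "g w = \<zeta> * of_real (cusp_scale k) * w * exp (of_real (2 * pi * real n) * w) *
         (of_real (cusp_polar k) * exp (of_real (cusp_exponent k / real k ^ 2) / w) + E)"
        using k(1) unfolding g_def f_def E(1) by (subst cexp2pi_minus_nat_mult) (simp_all only: mult_ac)
      thus "\<exists>E. g w = \<zeta> * of_real (cusp_scale k) * w * exp (of_real (2 * pi * real n) * w) *
         (of_real (cusp_polar k) * exp (of_real (cusp_exponent k / real k ^ 2) / w) + E) \<and> norm E \<le> 1 + 16 * exp 8"
        using E(2) by blast
    qed auto
    also have "\<dots> = C / (real k * real N ^ 2)" by (simp add: C_def)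
    finally have est: "norm (contour_integral P g - \<zeta> * of_real (cusp_scale k * cusp_polar k) *
       (2 * of_real pi * \<i> * of_real (cusp_exponent k / real k ^ 2 / (2 * pi * real n) *
       bessel_I 2 (2 * sqrt (cusp_exponent k / real k ^ 2 * (2 * pi * real n)))))) \<le> C / (real k * real N ^ 2)" .
    have "G (real h / real k + \<theta>2 h k) - G (real h / real k - \<theta>1 h k) - rademacher_term n h k =
      - \<i> * (contour_integral P g - \<zeta> * of_real (cusp_scale k * cusp_polar k) *
       (2 * of_real pi * \<i> * of_real (cusp_exponent k / real k ^ 2 / (2 * pi * real n) *
       bessel_I 2 (2 * sqrt (cusp_exponent k / real k ^ 2 * (2 * pi * real n))))))"
      unfolding J rademacher_term_def \<zeta>_def[symmetric] by (simp only: right_diff_distrib) (simp add: mult_ac)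
    thus ?thesis using est by (simp only: norm_mult norm_minus_cancel norm_ii mult_1_left)
  qed
  note swap = sum_coprime_pairs[where N = N, folded L_def]
  have C0: "C \<ge> 0" by (simp add: C_def)
  have "of_real (cubic_overpartition n) - (\<Sum>k=1..N. \<Sum>h | h < k \<and> coprime h k. rademacher_term n h k) =
     (\<Sum>(h, k)\<in>L. G (real h / real k + \<theta>2 h k) - G (real h / real k - \<theta>1 h k) - rademacher_term n h k)"
    unfolding swap[where F = "rademacher_term n", symmetric] a_eq[symmetric] sum_a[symmetric] by (simp add: case_prod_unfold sum_subtractf)
  also have "norm \<dots> \<le> (\<Sum>(h, k)\<in>L. C / (real k * real N ^ 2))"
    by (rule sum_norm_le) (use arc in auto)
  also have "\<dots> = (\<Sum>k=1..N. \<Sum>h | h < k \<and> coprime h k. C / (real k * real N ^ 2))"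
    by (rule swap)
  also have "\<dots> \<le> (\<Sum>k=1..N. C / real N ^ 2)"
  proof (rule sum_mono)
    fix k assume k: "k \<in> {1..N}"
    have "card {h. h < k \<and> coprime h k} \<le> card {..<k}" by (rule card_mono) auto
    hence "real (card {h. h < k \<and> coprime h k}) * (C / (real k * real N ^ 2)) \<le> real k * (C / (real k * real N ^ 2))"
      using C0 by (intro mult_right_mono) auto
    also have "\<dots> = C / real N ^ 2" using k by simp
    finally show "(\<Sum>h | h < k \<and> coprime h k. C / (real k * real N ^ 2)) \<le> C / real N ^ 2" by simp
  qed
  also have "\<dots> = C / real N" using N by (simp add: power2_eq_square)
  finally show ?thesis .
qed

section \<open>Absolute convergence of the Bessel series\<close>

lemma bessel_I_bounds:
  fixes x :: real
  assumes x: "x \<ge> 0"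
  shows "bessel_I 2 x \<ge> 0"
    "k \<ge> 1 \<Longrightarrow> bessel_I 2 (x / real k) \<le> bessel_I 2 x / real k ^ 2"
proof -
  have S: "(\<lambda>m. (x / 2) ^ (2 * m + 2) / (fact m * fact (m + 2))) sums bessel_I 2 x" if "x \<ge> 0" for x :: real
  proof -
    have "summable (\<lambda>m. (x / 2) ^ 2 * (inverse (fact m) * ((x / 2) ^ 2) ^ m))"
      by (intro summable_mult summable_exp)
    hence "summable (\<lambda>m. (x / 2) ^ (2 * m + 2) / (fact m * fact (m + 2)))"
    proof (rule summable_comparison_test'[where N = 0])
      fix m :: nat
      have nonneg: "0 \<le> (x / 2) ^ (2 * m + 2) / (fact m * fact (m + 2))"
        using that by (intro divide_nonneg_nonneg zero_le_power mult_nonneg_nonneg) auto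
      have split: "(x / 2) ^ (2 * m + 2) = (x / 2) ^ 2 * ((x / 2) ^ 2) ^ m"
        by (simp only: power_add power_mult) (rule mult.commute)
      have "(x / 2) ^ (2 * m + 2) / (fact m * fact (m + 2)) \<le> (x / 2) ^ (2 * m + 2) / (fact m * 1)"
        by (intro divide_left_mono mult_left_mono fact_ge_1) (use that in auto)
      also have "\<dots> = (x / 2) ^ 2 * (inverse (fact m) * ((x / 2) ^ 2) ^ m)"
        unfolding split by (simp only: divide_inverse mult_1_left mult_1_right mult_ac)
      finally show "norm ((x / 2) ^ (2 * m + 2) / (fact m * fact (m + 2))) \<le> (x / 2) ^ 2 * (inverse (fact m) * ((x / 2) ^ 2) ^ m)"
        unfolding real_norm_def abs_of_nonneg[OF nonneg] .
    qed
    thus ?thesis by (simp add: bessel_I_def summable_sums)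
  qed
  show "bessel_I 2 x \<ge> 0" by (rule sums_le[OF _ sums_zero S[OF x]]) (use x in auto)
  assume k: "k \<ge> 1"
  have "x / real k \<ge> 0" using x by simp
  \<comment> \<open>Each term contains at least the square of the argument, so dividing the argument
    by k gains k^2.\<close>
  show "bessel_I 2 (x / real k) \<le> bessel_I 2 x / real k ^ 2"
  proof (rule sums_le[OF _ S[OF \<open>x / real k \<ge> 0\<close>] sums_divide[OF S[OF x]]])
    fix m :: nat
    have "(1 / real k) ^ (2 * m + 2) \<le> (1 / real k) ^ 2"
      using k by (intro power_decreasing) auto
    hence "(x / 2) ^ (2 * m + 2) * (1 / real k) ^ (2 * m + 2) \<le> (x / 2) ^ (2 * m + 2) * (1 / real k) ^ 2"
      using x by (intro mult_left_mono) auto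
    hence "(x / real k / 2) ^ (2 * m + 2) \<le> (x / 2) ^ (2 * m + 2) / real k ^ 2"
      by (simp only: power_mult_distrib[symmetric]) (simp add: power_divide field_simps)
    hence "(x / real k / 2) ^ (2 * m + 2) / (fact m * fact (m + 2)) \<le> (x / 2) ^ (2 * m + 2) / real k ^ 2 / (fact m * fact (m + 2))"
      by (rule divide_right_mono) simp
    thus "(x / real k / 2) ^ (2 * m + 2) / (fact m * fact (m + 2)) \<le> (x / 2) ^ (2 * m + 2) / (fact m * fact (m + 2)) / real k ^ 2"
      by (simp only: divide_divide_eq_left mult.commute)
  qed
qed

text \<open>The gain k^-2 in I_2 makes the trivial bound k on the exponential sum sufficient. The
  map \<open>g\<close> enumerates a residue class, and \<open>g m > m\<close> allows comparison with
  1/(m + 1)^2.\<close>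

lemma summable_exponential_sum_bessel:
  fixes A :: "nat \<Rightarrow> complex" and g :: "nat \<Rightarrow> nat"
  assumes A: "\<And>k. norm (A k) \<le> real k" and x: "x \<ge> 0" and g: "\<And>m. g m > m"
  shows "summable (\<lambda>m. norm (A (g m) / of_nat (g m) * of_real (bessel_I 2 (x / real (g m)))))"
proof (rule summable_comparison_test'[where N = 0])
  show "summable (\<lambda>m. bessel_I 2 x * (1 / (real m + 1)\<^sup>2))"
    using inverse_squares_sums by (intro summable_mult) (auto simp: sums_iff add_ac)
  fix m :: nat
  have pos: "g m \<ge> 1" using g[of m] by linarith
  have "norm (A (g m) / of_nat (g m) * of_real (bessel_I 2 (x / real (g m)))) = norm (A (g m)) / real (g m) * bessel_I 2 (x / real (g m))"
    using bessel_I_bounds(1)[of "x / real (g m)"] x by (simp add: norm_mult norm_divide)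
  also have "\<dots> \<le> 1 * (bessel_I 2 x / real (g m) ^ 2)"
    using A[of "g m"] pos bessel_I_bounds(1)[of "x / real (g m)"] bessel_I_bounds(2)[OF x pos] x
    by (intro mult_mono) auto
  also have "\<dots> \<le> 1 * (bessel_I 2 x / (real m + 1) ^ 2)"
    using g[of m] bessel_I_bounds(1)[OF x] by (intro mult_left_mono divide_left_mono power_mono mult_pos_pos) auto
  finally show "norm (norm (A (g m) / of_nat (g m) * of_real (bessel_I 2 (x / real (g m))))) \<le> bessel_I 2 x * (1 / (real m + 1)\<^sup>2)"
    by simp
qed

lemma norm_exponential_sum_le:
  assumes "\<And>h. norm (f h) \<le> 1"
  shows "norm (\<Sum>h | h < k \<and> coprime h k. f h :: complex) \<le> real k"
proof -
  have "norm (\<Sum>h | h < k \<and> coprime h k. f h) \<le> real (card {h. h < k \<and> coprime h k}) * 1"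
    by (rule sum_norm_bound) (use assms in auto)
  also have "card {h. h < k \<and> coprime h k} \<le> card {..<k}" by (rule card_mono) auto
  finally show ?thesis by simp
qed

theorem theorem2p1:
  fixes n :: nat
  assumes "n \<ge> 1"
  defines "T1 \<equiv> (\<lambda>k::nat. A1 k n / of_nat k *
                   of_real (bessel_I 2 (pi / real k * sqrt (3 * real n / 2))))"
      and "T2 \<equiv> (\<lambda>k::nat. A2 k n / of_nat k *
                   of_real (bessel_I 2 (pi / real k * sqrt (2 * real n))))"
  shows "summable (\<lambda>m. norm (T1 (2 * m + 1)))
    \<and> summable (\<lambda>m. norm (T2 (4 * m + 2)))
    \<and> complex_of_real (cubic_overpartition n) =
        of_real (3 * pi / (16 * real n * sqrt 2)) * (\<Sum>m. T1 (2 * m + 1))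
      + of_real (pi / (4 * real n * sqrt 2)) * (\<Sum>m. T2 (4 * m + 2))"
proof -
  have n: "n \<ge> 1" by fact
  define t where "t = (\<lambda>k. \<Sum>h | h < k \<and> coprime h k. rademacher_term n h k)"
  define c1 c2 :: complex where "c1 = of_real (3 * pi / (16 * real n * sqrt 2))" and "c2 = of_real (pi / (4 * real n * sqrt 2))"
  have S1: "summable (\<lambda>m. norm (T1 (2 * m + 1)))"
    using summable_exponential_sum_bessel[of "\<lambda>k. A1 k n" "pi * sqrt (3 * real n / 2)" "\<lambda>m. 2 * m + 1"]
    by (simp add: T1_def A1_def norm_exponential_sum_le)
  have S2: "summable (\<lambda>m. norm (T2 (4 * m + 2)))"
    using summable_exponential_sum_bessel[of "\<lambda>k. A2 k n" "pi * sqrt (2 * real n)" "\<lambda>m. 4 * m + 2"]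
    by (simp add: T2_def A2_def norm_exponential_sum_le)
  have "(\<lambda>N. \<Sum>k=1..N. t k) \<longlonglongrightarrow> of_real (cubic_overpartition n)"
  proof -
    define C where "C = 12 * exp (pi + 2 * pi * real n) + 4 * (1 + 16 * exp 8) * exp (2 * pi * real n)"
    have "(\<lambda>N. of_real (cubic_overpartition n) - (\<Sum>k=1..N. t k)) \<longlonglongrightarrow> 0"
    proof (rule Lim_null_comparison)
      show "\<forall>\<^sub>F N in sequentially. norm (of_real (cubic_overpartition n) - (\<Sum>k=1..N. t k)) \<le> C / real N"
        unfolding t_def C_def
        by (intro eventually_mono[OF eventually_ge_at_top[of 1]]) (rule circle_method_estimate[OF n])
      show "(\<lambda>N. C / real N) \<longlonglongrightarrow> 0" by (rule lim_const_over_n)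
    qed
    from tendsto_diff[OF tendsto_const[of "of_real (cubic_overpartition n)"] this] show ?thesis by simp
  qed
  \<comment> \<open>There is no h < 0, so the summand at k = 0 is empty and the series may start at
    0.\<close>
  moreover have "(\<Sum>k=1..N. t k) = (\<Sum>k<Suc N. t k)" for N
  proof -
    have "{..<Suc N} = insert 0 {1..N}" by auto
    moreover have "t 0 = 0" by (simp add: t_def)
    ultimately show ?thesis by simp
  qed
  ultimately have "(\<lambda>N. \<Sum>k<Suc N. t k) \<longlonglongrightarrow> of_real (cubic_overpartition n)" by simp
  hence t_sums: "t sums of_real (cubic_overpartition n)"
    unfolding sums_def by (rule LIMSEQ_imp_Suc)
  have pull: "t k = (\<Sum>h | h < k \<and> coprime h k. exp (of_real pi * \<i> * of_real (cusp_phase h k) - 2 * of_real pi * \<i> * of_nat n * of_nat h / of_nat k)) *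
     of_real (cusp_scale k * cusp_polar k * (cusp_exponent k / (real k ^ 2 * real n))) *
       of_real (bessel_I 2 (2 * sqrt (cusp_exponent k / real k ^ 2 * (2 * pi * real n))))" for k
    unfolding t_def rademacher_term_def sum_distrib_right by (intro sum.cong refl) simp
  \<comment> \<open>The scale k/sqrt 2 times (3\<pi>/16)/(k^2 n) gives the prefactor over k, and 2
    sqrt((3\<pi>/16)(2\<pi>n)/k^2) is the Bessel argument.\<close>
  have t1: "t k = c1 * T1 k" if k: "odd k" for k
  proof -
    have k0: "k > 0" using k by (cases k) auto
    have k4: "\<not> 4 dvd k" using k by (meson dvd_trans even_numeral)
    have A: "A1 k n = (\<Sum>h | h < k \<and> coprime h k. exp (of_real pi * \<i> * of_real (cusp_phase h k) - 2 * of_real pi * \<i> * of_nat n * of_nat h / of_nat k))"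
      unfolding A1_def using k by (simp add: cusp_phase_def add_diff_eq)
    have "2 * sqrt (cusp_exponent k / real k ^ 2 * (2 * pi * real n)) = pi / real k * sqrt (3 * real n / 2)"
    proof -
      have "cusp_exponent k / real k ^ 2 * (2 * pi * real n) = (pi / (2 * real k))\<^sup>2 * (3 * real n / 2)"
        using k k0 by (simp add: cusp_exponent_def power2_eq_square field_simps)
      thus ?thesis by (simp only: real_sqrt_mult real_sqrt_abs) simp
    qed
    moreover have "cusp_scale k * cusp_polar k * (cusp_exponent k / (real k ^ 2 * real n)) = 3 * pi / (16 * real n * sqrt 2) / real k"
      using k k0 k4 by (simp add: cusp_scale_def cusp_polar_def cusp_exponent_def power2_eq_square field_simps)
    ultimately show ?thesis
      unfolding pull A[symmetric] T1_def c1_def by (simp add: field_simps)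
  qed
  have t2: "t k = c2 * T2 k" if k: "even k" "\<not> 4 dvd k" for k
  proof -
    have k0: "k > 0" using k by (cases k) auto
    have A: "A2 k n = (\<Sum>h | h < k \<and> coprime h k. exp (of_real pi * \<i> * of_real (cusp_phase h k) - 2 * of_real pi * \<i> * of_nat n * of_nat h / of_nat k))"
      unfolding A2_def using k by (simp add: cusp_phase_def add_diff_eq)
    have "2 * sqrt (cusp_exponent k / real k ^ 2 * (2 * pi * real n)) = pi / real k * sqrt (2 * real n)"
    proof -
      have "cusp_exponent k / real k ^ 2 * (2 * pi * real n) = (pi / (2 * real k))\<^sup>2 * (2 * real n)"
        using k k0 by (simp add: cusp_exponent_def power2_eq_square field_simps)
      thus ?thesis by (simp only: real_sqrt_mult real_sqrt_abs) simp
    qed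
    moreover have "cusp_scale k * cusp_polar k * (cusp_exponent k / (real k ^ 2 * real n)) = pi / (4 * real n * sqrt 2) / real k"
      using k k0 by (simp add: cusp_scale_def cusp_polar_def cusp_exponent_def power2_eq_square field_simps)
    ultimately show ?thesis
      unfolding pull A[symmetric] T2_def c2_def by (simp add: field_simps)
  qed
  have t3: "t k = 0" if "4 dvd k" for k
    unfolding pull using that by (simp add: cusp_polar_def)
  \<comment> \<open>Both classes are extended by zero to all k, so that their sums add termwise to
    \<open>t\<close>; each converges because its nonzero terms form one of the absolutely convergent
    series.\<close>
  define t' where "t' = (\<lambda>k. if odd k then t k else 0)"
  define t'' where "t'' = (\<lambda>k. if odd k then 0 else t k)"
  have s1: "t' sums (c1 * (\<Sum>m. T1 (2 * m + 1)))"
  proof -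
    have "(\<lambda>m. t' (2 * m + 1)) sums (c1 * (\<Sum>m. T1 (2 * m + 1)))"
      using sums_mult[OF summable_sums[OF summable_norm_cancel[OF S1]], of c1] by (simp add: t'_def t1)
    moreover have "strict_mono (\<lambda>m::nat. 2 * m + 1)" by (auto simp: strict_mono_def)
    moreover have "t' k = 0" if "k \<notin> range (\<lambda>m. 2 * m + 1)" for k
      using that by (auto simp: t'_def elim!: oddE)
    ultimately show ?thesis by (subst (asm) sums_mono_reindex) auto
  qed
  have s2: "t'' sums (c2 * (\<Sum>m. T2 (4 * m + 2)))"
  proof -
    have "\<not> 4 dvd 4 * m + 2" for m :: nat by presburger
    hence "(\<lambda>m. t'' (4 * m + 2)) sums (c2 * (\<Sum>m. T2 (4 * m + 2)))"
      using sums_mult[OF summable_sums[OF summable_norm_cancel[OF S2]], of c2] by (simp add: t''_def t2)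
    moreover have "strict_mono (\<lambda>m::nat. 4 * m + 2)" by (auto simp: strict_mono_def)
    moreover have "t'' k = 0" if "k \<notin> range (\<lambda>m. 4 * m + 2)" for k
    proof -
      have "odd k \<or> 4 dvd k \<or> k = 4 * (k div 4) + 2" by presburger
      thus ?thesis using that t3[of k] by (auto simp: t''_def)
    qed
    ultimately show ?thesis by (subst (asm) sums_mono_reindex) auto
  qed
  have "(\<lambda>k. t' k + t'' k) = t" by (auto simp: t'_def t''_def)
  with sums_add[OF s1 s2] have "t sums (c1 * (\<Sum>m. T1 (2 * m + 1)) + c2 * (\<Sum>m. T2 (4 * m + 2)))" by simp
  with t_sums have "of_real (cubic_overpartition n) = c1 * (\<Sum>m. T1 (2 * m + 1)) + c2 * (\<Sum>m. T2 (4 * m + 2))"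
    by (rule sums_unique2)
  with S1 S2 show ?thesis unfolding c1_def c2_def by blast
qed

end
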